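(* Let $\mathbb D$ be a symmetric 2-rig doctrine. Let $\mathbb D[Y^\partial]$ be the free $\mathbb D$-rig on the countable set of generators $\{Y=Y^{(0)},Y^{(1)},Y^{(2)},\dots,Y^{(n)},\dots\}$, equipped with the derivation $\partial$ determined by $\partial(Y^{(i)})=Y^{(i+1)}$ for all $i\ge 0$, i.e. the derivation which is the second component of the $\mathbb D$-rig map $\mathbb D[Y^\partial]\to\mathbb D[Y^\partial][\varepsilon]$ sending $Y^{(i)}$ to $(Y^{(i)},Y^{(i+1)})$. Then $(\mathbb D[Y^\partial],\partial)$ is the free differential $\mathbb D$-rig on a single generator $Y$: for every differential $\mathbb D$-rig $(\mathcal S,\partial')$ and every object $A\in\mathcal S$ there is an (essentially) unique morphism of differential $\mathbb D$-rigs $\mathbb D[Y^\partial]\to\mathcal S$ sending $Y$ to $A$.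
   Context: Fix an additive doctrine $\mathbb A$: a class of colimit shapes containing at least all finite discrete diagrams, given by the 2-monad on $\mathsf{Cat}$ whose algebras ($\mathbb A$-algebras) are the categories with all colimits of that class; morphisms are the functors preserving these colimits ($\mathbb A$-cocontinuous functors), 2-cells are natural transformations. Coproducts are written $+$, the initial object $0$. For the corresponding symmetric 2-rig doctrine $\mathbb D$, a $\mathbb D$-rig is a symmetric monoidal category $(\mathcal R,\otimes,I)$ with all $\mathbb A$-colimits such that $\otimes$ preserves them in each variable separately; a morphism of $\mathbb D$-rigs is a strong symmetric monoidal $\mathbb A$-cocontinuous functor; 2-cells are monoidal natural transformations. The free $\mathbb D$-rig on a category (or set, viewed as a discrete category) $S$ is the $\mathbb D$-rig $\mathbb D[S]$ with a functor $S\to\mathbb D[S]$ inducing, for all $\mathbb D$-rigs $\mathcal R$, an equivalence between $\mathbb D$-rig maps $\mathbb D[S]\to\mathcal R$ and functors $S\to\mathcal R$. Uniqueness is in the corresponding essential sense (unique up to unique isomorphism). A derivation on a $\mathbb D$-rig $\mathcal R$ is an $\mathbb A$-cocontinuous functor $\partial:\mathcal R\to\mathcal R$ with a left strength $R\otimes\partial C\to\partial(R\otimes C)$ and a right strength $\partial C\otimes R\to\partial(C\otimes R)$, natural, satisfying the usual unit and associativity axioms for tensorial strengths and compatible with each other (a bimodule morphism from $\mathcal R$, acting on itself on both sides by $\otimes$, to itself), such that the induced map $\partial C\otimes C'+C\otimes\partial C'\to\partial(C\otimes C')$ (the leibnizator) and the map $0\to\partial(I)$ are isomorphisms. A differential $\mathbb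 D$-rig is a $\mathbb D$-rig equipped with a derivation on it. A morphism of differential $\mathbb D$-rigs $(\mathcal R,\partial)\to(\mathcal S,\partial')$ is a $\mathbb D$-rig morphism $F$ with $\partial'\circ F=F\circ\partial$. $\mathcal R[\varepsilon]$ denotes the $\mathbb D$-rig with underlying category $\mathcal R\times\mathcal R$, unit $(I,0)$ and product $(A,M)\boxtimes(B,N)=(A\otimes B,\,A\otimes N+M\otimes B)$. Derivations $\partial$ on $\mathcal R$ correspond to $\mathbb D$-rig maps $\mathcal R\to\mathcal R[\varepsilon]$ whose first component is the identity, with $\partial$ the second component.
   Formalization: The equation ∂'∘F = F∘∂ is replaced by an invertible natural transformation respecting both strengths (2-cells commute with it), since strictly it fails; and the symmetry is required to exchange the left and right strengths of a derivation, as maps R → R[ε] force. *)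

theory Defs
  imports "HOL-Library.FuncSet"
begin

section \<open>Categories, functors and colimits\<close>

record ('o, 'a) category =
  Ob :: "'o set"
  Ar :: "'a set"
  Dom :: "'a \<Rightarrow> 'o"
  Cod :: "'a \<Rightarrow> 'o"
  Id :: "'o \<Rightarrow> 'a"
  Cmp :: "'a \<Rightarrow> 'a \<Rightarrow> 'a" (infixl "\<cdot>\<index>" 65)

definition hom :: "('o, 'a, 'm) category_scheme \<Rightarrow> 'o \<Rightarrow> 'o \<Rightarrow> 'a set" where
  "hom C A B = {f \<in> Ar C. Dom C f = A \<and> Cod C f = B}"

locale category =
  fixes C :: "('o, 'a, 'm) category_scheme" (structure)
  assumes dom_Ob: "f \<in> Ar C \<Longrightarrow> Dom C f \<in> Ob C"
    and cod_Ob: "f \<in> Ar C \<Longrightarrow> Cod C f \<in> Ob C"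
    and Id_hom: "A \<in> Ob C \<Longrightarrow> Id C A \<in> hom C A A"
    and Cmp_hom: "f \<in> hom C A B \<Longrightarrow> g \<in> hom C B D \<Longrightarrow> g \<cdot> f \<in> hom C A D"
    and Cmp_Id_right: "f \<in> hom C A B \<Longrightarrow> f \<cdot> Id C A = f"
    and Cmp_Id_left: "f \<in> hom C A B \<Longrightarrow> Id C B \<cdot> f = f"
    and Cmp_assoc: "f \<in> hom C A B \<Longrightarrow> g \<in> hom C B D \<Longrightarrow> h \<in> hom C D E \<Longrightarrow>
      h \<cdot> (g \<cdot> f) = (h \<cdot> g) \<cdot> f"

definition inverse_arrows :: "('o, 'a, 'm) category_scheme \<Rightarrow> 'a \<Rightarrow> 'a \<Rightarrow> bool" where
  "inverse_arrows C f g \<longleftrightarrow> f \<in> hom C (Dom C f) (Cod C f) \<and> g \<in> hom C (Cod C f) (Dom C f) \<and>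
     g \<cdot>\<^bsub>C\<^esub> f = Id C (Dom C f) \<and> f \<cdot>\<^bsub>C\<^esub> g = Id C (Cod C f)"

definition inv_arrow :: "('o, 'a, 'm) category_scheme \<Rightarrow> 'a \<Rightarrow> 'a" where
  "inv_arrow C f = (THE g. inverse_arrows C f g)"

definition isos :: "('o, 'a, 'm) category_scheme \<Rightarrow> 'o \<Rightarrow> 'o \<Rightarrow> 'a set" where
  "isos C A B = {f \<in> hom C A B. \<exists>g. inverse_arrows C f g}"

definition isomorphic :: "('o, 'a, 'm) category_scheme \<Rightarrow> 'o \<Rightarrow> 'o \<Rightarrow> bool" where
  "isomorphic C A B \<longleftrightarrow> isos C A B \<noteq> {}"

record ('o, 'a, 'p, 'b) functor_data =
  FO :: "'o \<Rightarrow> 'p"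
  FA :: "'a \<Rightarrow> 'b"

definition is_functor ::
  "('o, 'a, 'm) category_scheme \<Rightarrow> ('p, 'b, 'n) category_scheme \<Rightarrow>
   ('o, 'a, 'p, 'b, 'k) functor_data_scheme \<Rightarrow> bool" where
  "is_functor C C' F \<longleftrightarrow>
     (\<forall>A\<in>Ob C. FO F A \<in> Ob C') \<and>
     (\<forall>A B. \<forall>f\<in>hom C A B. FA F f \<in> hom C' (FO F A) (FO F B)) \<and>
     (\<forall>A\<in>Ob C. FA F (Id C A) = Id C' (FO F A)) \<and>
     (\<forall>A B D. \<forall>f\<in>hom C A B. \<forall>g\<in>hom C B D. FA F (g \<cdot>\<^bsub>C\<^esub> f) = FA F g \<cdot>\<^bsub>C'\<^esub> FA F f)"

definition is_cocone ::
  "('i, 'j, 'k) category_scheme \<Rightarrow> ('o, 'a, 'm) category_scheme \<Rightarrow>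
   ('i, 'j, 'o, 'a, 'n) functor_data_scheme \<Rightarrow> 'o \<Rightarrow> ('i \<Rightarrow> 'a) \<Rightarrow> bool" where
  "is_cocone J C D L c \<longleftrightarrow> L \<in> Ob C \<and>
     (\<forall>x\<in>Ob J. c x \<in> hom C (FO D x) L) \<and>
     (\<forall>u\<in>Ar J. c (Cod J u) \<cdot>\<^bsub>C\<^esub> FA D u = c (Dom J u))"

definition is_colimit ::
  "('i, 'j, 'k) category_scheme \<Rightarrow> ('o, 'a, 'm) category_scheme \<Rightarrow>
   ('i, 'j, 'o, 'a, 'n) functor_data_scheme \<Rightarrow> 'o \<Rightarrow> ('i \<Rightarrow> 'a) \<Rightarrow> bool" where
  "is_colimit J C D L c \<longleftrightarrow> is_cocone J C D L c \<and>
     (\<forall>X d. is_cocone J C D X d \<longrightarrow> (\<exists>!h. h \<in> hom C L X \<and> (\<forall>x\<in>Ob J. h \<cdot>\<^bsub>C\<^esub> c x = d x)))"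

section \<open>Additive doctrines\<close>

text \<open>An additive doctrine is given by its class of colimit shapes. Finite discrete shapes are
  required up to isomorphism, which is all that matters for colimits. This forces the types
  \<open>'i\<close> and \<open>'j\<close> to be infinite.\<close>

definition discrete_category :: "('i, 'j, 'k) category_scheme \<Rightarrow> bool" where
  "discrete_category J \<longleftrightarrow> category J \<and> Ar J = Id J ` Ob J"

definition additive_doctrine :: "('i, 'j) category set \<Rightarrow> bool" where
  "additive_doctrine \<A> \<longleftrightarrow> (\<forall>J\<in>\<A>. category J) \<and>
     (\<forall>n::nat. \<exists>J\<in>\<A>. discrete_category J \<and> finite (Ob J) \<and> card (Ob J) = n)"

definition has_colimits :: "('i, 'j) category set \<Rightarrow> ('o, 'a, 'm) category_scheme \<Rightarrow> bool" where
  "has_colimits \<A> C \<longleftrightarrow> (\<forall>J\<in>\<A>. \<forall>D :: ('i, 'j, 'o, 'a) functor_data.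
     is_functor J C D \<longrightarrow> (\<exists>L c. is_colimit J C D L c))"

definition cocontinuous ::
  "('i, 'j) category set \<Rightarrow> ('o, 'a, 'm) category_scheme \<Rightarrow> ('p, 'b, 'n) category_scheme \<Rightarrow>
   ('o, 'a, 'p, 'b, 'k) functor_data_scheme \<Rightarrow> bool" where
  "cocontinuous \<A> C C' F \<longleftrightarrow> is_functor C C' F \<and>
     (\<forall>J\<in>\<A>. \<forall>D :: ('i, 'j, 'o, 'a) functor_data. \<forall>L c.
        is_functor J C D \<and> is_colimit J C D L c \<longrightarrow>
        is_colimit J C' \<lparr>FO = \<lambda>x. FO F (FO D x), FA = \<lambda>u. FA F (FA D u)\<rparr>
          (FO F L) (\<lambda>x. FA F (c x)))"

subsection \<open>Chosen initial objects and binary coproducts\<close>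

definition is_initial :: "('o, 'a, 'm) category_scheme \<Rightarrow> 'o \<Rightarrow> bool" where
  "is_initial C Z \<longleftrightarrow> Z \<in> Ob C \<and> (\<forall>X\<in>Ob C. \<exists>!h. h \<in> hom C Z X)"

definition from_initial :: "('o, 'a, 'm) category_scheme \<Rightarrow> 'o \<Rightarrow> 'o \<Rightarrow> 'a" where
  "from_initial C Z X = (THE h. h \<in> hom C Z X)"

definition initial_obj :: "('o, 'a, 'm) category_scheme \<Rightarrow> 'o" where
  "initial_obj C = (SOME Z. is_initial C Z)"

definition is_coproduct ::
  "('o, 'a, 'm) category_scheme \<Rightarrow> 'o \<Rightarrow> 'o \<Rightarrow> 'o \<times> 'a \<times> 'a \<Rightarrow> bool" where
  "is_coproduct C A B = (\<lambda>(P, i, j). P \<in> Ob C \<and> i \<in> hom C A P \<and> j \<in> hom C B P \<and>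
     (\<forall>X f g. f \<in> hom C A X \<and> g \<in> hom C B X \<longrightarrow>
        (\<exists>!h. h \<in> hom C P X \<and> h \<cdot>\<^bsub>C\<^esub> i = f \<and> h \<cdot>\<^bsub>C\<^esub> j = g)))"

definition coprod :: "('o, 'a, 'm) category_scheme \<Rightarrow> 'o \<Rightarrow> 'o \<Rightarrow> 'o" where
  "coprod C A B = fst (SOME p. is_coproduct C A B p)"

definition inj1 :: "('o, 'a, 'm) category_scheme \<Rightarrow> 'o \<Rightarrow> 'o \<Rightarrow> 'a" where
  "inj1 C A B = fst (snd (SOME p. is_coproduct C A B p))"

definition inj2 :: "('o, 'a, 'm) category_scheme \<Rightarrow> 'o \<Rightarrow> 'o \<Rightarrow> 'a" where
  "inj2 C A B = snd (snd (SOME p. is_coproduct C A B p))"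

text \<open>The arrow \<open>coprod C (Dom C f) (Dom C g) \<rightarrow> X\<close> induced by \<open>f\<close> and \<open>g\<close> with common
  codomain \<open>X\<close>.\<close>

definition copair :: "('o, 'a, 'm) category_scheme \<Rightarrow> 'a \<Rightarrow> 'a \<Rightarrow> 'a" where
  "copair C f g = (THE h. h \<in> hom C (coprod C (Dom C f) (Dom C g)) (Cod C f) \<and>
     h \<cdot>\<^bsub>C\<^esub> inj1 C (Dom C f) (Dom C g) = f \<and> h \<cdot>\<^bsub>C\<^esub> inj2 C (Dom C f) (Dom C g) = g)"

section \<open>Symmetric monoidal categories and rigs for a doctrine\<close>

text \<open>\<open>\<odot>\<close> is the tensor product on objects, \<open>\<otimes>\<close> the tensor product on arrows.\<close>

record ('o, 'a) monoidal_data = "('o, 'a) category" +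
  TO :: "'o \<Rightarrow> 'o \<Rightarrow> 'o" (infixl "\<odot>\<index>" 70)
  TA :: "'a \<Rightarrow> 'a \<Rightarrow> 'a" (infixl "\<otimes>\<index>" 70)
  Unit :: "'o" ("\<one>\<index>")
  assoc :: "'o \<Rightarrow> 'o \<Rightarrow> 'o \<Rightarrow> 'a"
  lunit :: "'o \<Rightarrow> 'a"
  runit :: "'o \<Rightarrow> 'a"
  braid :: "'o \<Rightarrow> 'o \<Rightarrow> 'a"

locale symmetric_monoidal_category =
  category R for R :: "('o, 'a, 'm) monoidal_data_scheme" (structure) +
  assumes TO_Ob: "A \<in> Ob R \<Longrightarrow> B \<in> Ob R \<Longrightarrow> A \<odot> B \<in> Ob R"
    and TA_hom: "f \<in> hom R A A' \<Longrightarrow> g \<in> hom R B B' \<Longrightarrow> f \<otimes> g \<in> hom R (A \<odot> B) (A' \<odot> B')"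
    and TA_Id: "A \<in> Ob R \<Longrightarrow> B \<in> Ob R \<Longrightarrow> Id R A \<otimes> Id R B = Id R (A \<odot> B)"
    and TA_Cmp: "f \<in> hom R A A' \<Longrightarrow> f' \<in> hom R A' A'' \<Longrightarrow> g \<in> hom R B B' \<Longrightarrow> g' \<in> hom R B' B'' \<Longrightarrow>
      (f' \<cdot> f) \<otimes> (g' \<cdot> g) = (f' \<otimes> g') \<cdot> (f \<otimes> g)"
    and Unit_Ob: "\<one> \<in> Ob R"
    and assoc_iso: "A \<in> Ob R \<Longrightarrow> B \<in> Ob R \<Longrightarrow> D \<in> Ob R \<Longrightarrow>
      assoc R A B D \<in> isos R ((A \<odot> B) \<odot> D) (A \<odot> (B \<odot> D))"
    and assoc_natural: "f \<in> hom R A A' \<Longrightarrow> g \<in> hom R B B' \<Longrightarrow> h \<in> hom R D D' \<Longrightarrow>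
      assoc R A' B' D' \<cdot> ((f \<otimes> g) \<otimes> h) = (f \<otimes> (g \<otimes> h)) \<cdot> assoc R A B D"
    and lunit_iso: "A \<in> Ob R \<Longrightarrow> lunit R A \<in> isos R (\<one> \<odot> A) A"
    and lunit_natural: "f \<in> hom R A A' \<Longrightarrow> lunit R A' \<cdot> (Id R \<one> \<otimes> f) = f \<cdot> lunit R A"
    and runit_iso: "A \<in> Ob R \<Longrightarrow> runit R A \<in> isos R (A \<odot> \<one>) A"
    and runit_natural: "f \<in> hom R A A' \<Longrightarrow> runit R A' \<cdot> (f \<otimes> Id R \<one>) = f \<cdot> runit R A"
    and braid_hom: "A \<in> Ob R \<Longrightarrow> B \<in> Ob R \<Longrightarrow> braid R A B \<in> hom R (A \<odot> B) (B \<odot> A)"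
    and braid_natural: "f \<in> hom R A A' \<Longrightarrow> g \<in> hom R B B' \<Longrightarrow>
      braid R A' B' \<cdot> (f \<otimes> g) = (g \<otimes> f) \<cdot> braid R A B"
    and braid_braid: "A \<in> Ob R \<Longrightarrow> B \<in> Ob R \<Longrightarrow> braid R B A \<cdot> braid R A B = Id R (A \<odot> B)"
    and pentagon: "A \<in> Ob R \<Longrightarrow> B \<in> Ob R \<Longrightarrow> D \<in> Ob R \<Longrightarrow> E \<in> Ob R \<Longrightarrow>
      assoc R A B (D \<odot> E) \<cdot> assoc R (A \<odot> B) D E =
      (Id R A \<otimes> assoc R B D E) \<cdot> assoc R A (B \<odot> D) E \<cdot> (assoc R A B D \<otimes> Id R E)"
    and triangle: "A \<in> Ob R \<Longrightarrow> B \<in> Ob R \<Longrightarrow>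
      (Id R A \<otimes> lunit R B) \<cdot> assoc R A \<one> B = runit R A \<otimes> Id R B"
    and hexagon: "A \<in> Ob R \<Longrightarrow> B \<in> Ob R \<Longrightarrow> D \<in> Ob R \<Longrightarrow>
      assoc R B D A \<cdot> braid R A (B \<odot> D) \<cdot> assoc R A B D =
      (Id R B \<otimes> braid R A D) \<cdot> assoc R B A D \<cdot> (braid R A B \<otimes> Id R D)"

definition is_rig :: "('i, 'j) category set \<Rightarrow> ('o, 'a, 'm) monoidal_data_scheme \<Rightarrow> bool" where
  "is_rig \<A> R \<longleftrightarrow> symmetric_monoidal_category R \<and> has_colimits \<A> R \<and>
     (\<forall>X\<in>Ob R. cocontinuous \<A> R R \<lparr>FO = \<lambda>A. X \<odot>\<^bsub>R\<^esub> A, FA = \<lambda>f. Id R X \<otimes>\<^bsub>R\<^esub> f\<rparr> \<and>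
                cocontinuous \<A> R R \<lparr>FO = \<lambda>A. A \<odot>\<^bsub>R\<^esub> X, FA = \<lambda>f. f \<otimes>\<^bsub>R\<^esub> Id R X\<rparr>)"

record ('o, 'a, 'p, 'b) monoidal_functor_data = "('o, 'a, 'p, 'b) functor_data" +
  Mu :: "'o \<Rightarrow> 'o \<Rightarrow> 'b"
  Eps :: "'b"

definition strong_symmetric_monoidal ::
  "('o, 'a, 'm) monoidal_data_scheme \<Rightarrow> ('p, 'b, 'n) monoidal_data_scheme \<Rightarrow>
   ('o, 'a, 'p, 'b, 'k) monoidal_functor_data_scheme \<Rightarrow> bool" where
  "strong_symmetric_monoidal R S F \<longleftrightarrow> is_functor R S F \<and>
     (\<forall>A\<in>Ob R. \<forall>B\<in>Ob R. Mu F A B \<in> isos S (FO F A \<odot>\<^bsub>S\<^esub> FO F B) (FO F (A \<odot>\<^bsub>R\<^esub> B))) \<and>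
     Eps F \<in> isos S \<one>\<^bsub>S\<^esub> (FO F \<one>\<^bsub>R\<^esub>) \<and>
     (\<forall>A A' B B'. \<forall>f\<in>hom R A A'. \<forall>g\<in>hom R B B'.
        FA F (f \<otimes>\<^bsub>R\<^esub> g) \<cdot>\<^bsub>S\<^esub> Mu F A B = Mu F A' B' \<cdot>\<^bsub>S\<^esub> (FA F f \<otimes>\<^bsub>S\<^esub> FA F g)) \<and>
     (\<forall>A\<in>Ob R. \<forall>B\<in>Ob R. \<forall>D\<in>Ob R.
        FA F (assoc R A B D) \<cdot>\<^bsub>S\<^esub> Mu F (A \<odot>\<^bsub>R\<^esub> B) D \<cdot>\<^bsub>S\<^esub> (Mu F A B \<otimes>\<^bsub>S\<^esub> Id S (FO F D)) =
        Mu F A (B \<odot>\<^bsub>R\<^esub> D) \<cdot>\<^bsub>S\<^esub> (Id S (FO F A) \<otimes>\<^bsub>S\<^esub> Mu F B D) \<cdot>\<^bsub>S\<^esub>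
          assoc S (FO F A) (FO F B) (FO F D)) \<and>
     (\<forall>A\<in>Ob R. FA F (lunit R A) \<cdot>\<^bsub>S\<^esub> Mu F \<one>\<^bsub>R\<^esub> A \<cdot>\<^bsub>S\<^esub> (Eps F \<otimes>\<^bsub>S\<^esub> Id S (FO F A)) = lunit S (FO F A)) \<and>
     (\<forall>A\<in>Ob R. FA F (runit R A) \<cdot>\<^bsub>S\<^esub> Mu F A \<one>\<^bsub>R\<^esub> \<cdot>\<^bsub>S\<^esub> (Id S (FO F A) \<otimes>\<^bsub>S\<^esub> Eps F) = runit S (FO F A)) \<and>
     (\<forall>A\<in>Ob R. \<forall>B\<in>Ob R.
        FA F (braid R A B) \<cdot>\<^bsub>S\<^esub> Mu F A B = Mu F B A \<cdot>\<^bsub>S\<^esub> braid S (FO F A) (FO F B))"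

definition is_rig_map ::
  "('i, 'j) category set \<Rightarrow> ('o, 'a, 'm) monoidal_data_scheme \<Rightarrow> ('p, 'b, 'n) monoidal_data_scheme \<Rightarrow>
   ('o, 'a, 'p, 'b, 'k) monoidal_functor_data_scheme \<Rightarrow> bool" where
  "is_rig_map \<A> R S F \<longleftrightarrow> strong_symmetric_monoidal R S F \<and> cocontinuous \<A> R S F"

text \<open>The components of a transformation are only meaningful on the objects of the source;
  extensionality makes equality of functions agree with equality of transformations.\<close>

definition monoidal_transformation ::
  "('o, 'a, 'm) monoidal_data_scheme \<Rightarrow> ('p, 'b, 'n) monoidal_data_scheme \<Rightarrow>
   ('o, 'a, 'p, 'b, 'k) monoidal_functor_data_scheme \<Rightarrow>
   ('o, 'a, 'p, 'b, 'l) monoidal_functor_data_scheme \<Rightarrow> ('o \<Rightarrow> 'b) \<Rightarrow> bool" where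
  "monoidal_transformation R S F G \<theta> \<longleftrightarrow> \<theta> \<in> extensional (Ob R) \<and>
     (\<forall>A\<in>Ob R. \<theta> A \<in> hom S (FO F A) (FO G A)) \<and>
     (\<forall>A B. \<forall>f\<in>hom R A B. \<theta> B \<cdot>\<^bsub>S\<^esub> FA F f = FA G f \<cdot>\<^bsub>S\<^esub> \<theta> A) \<and>
     (\<forall>A\<in>Ob R. \<forall>B\<in>Ob R. \<theta> (A \<odot>\<^bsub>R\<^esub> B) \<cdot>\<^bsub>S\<^esub> Mu F A B = Mu G A B \<cdot>\<^bsub>S\<^esub> (\<theta> A \<otimes>\<^bsub>S\<^esub> \<theta> B)) \<and>
     \<theta> \<one>\<^bsub>R\<^esub> \<cdot>\<^bsub>S\<^esub> Eps F = Eps G"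

text \<open>\<open>D\<close> with \<open>\<eta> : X \<rightarrow> Ob D\<close> is the free rig on the set \<open>X\<close>: for every rig \<open>R\<close>, restriction along
  \<open>\<eta>\<close> is an equivalence (essentially surjective, full and faithful) from the category of rig maps
  \<open>D \<rightarrow> R\<close> and monoidal transformations to the category of functors from the discrete category \<open>X\<close>
  to \<open>R\<close>. The types \<open>'o\<close> and \<open>'a\<close> play the role of the universe of objects and arrows over which
  \<open>R\<close> ranges, and in which \<open>D\<close> lies.\<close>

definition is_free_rig ::
  "('i, 'j) category set \<Rightarrow> ('o, 'a) monoidal_data \<Rightarrow> 'x set \<Rightarrow> ('x \<Rightarrow> 'o) \<Rightarrow> bool" where
  "is_free_rig \<A> D X \<eta> \<longleftrightarrow> is_rig \<A> D \<and> (\<forall>x\<in>X. \<eta> x \<in> Ob D) \<and>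
     (\<forall>R :: ('o, 'a) monoidal_data. is_rig \<A> R \<longrightarrow>
       (\<forall>B. (\<forall>x\<in>X. B x \<in> Ob R) \<longrightarrow>
          (\<exists>F :: ('o, 'a, 'o, 'a) monoidal_functor_data.
             is_rig_map \<A> D R F \<and> (\<forall>x\<in>X. isomorphic R (FO F (\<eta> x)) (B x)))) \<and>
       (\<forall>(F :: ('o, 'a, 'o, 'a) monoidal_functor_data) (G :: ('o, 'a, 'o, 'a) monoidal_functor_data) f.
          is_rig_map \<A> D R F \<and> is_rig_map \<A> D R G \<and>
          (\<forall>x\<in>X. f x \<in> hom R (FO F (\<eta> x)) (FO G (\<eta> x))) \<longrightarrow>
          (\<exists>!\<theta>. monoidal_transformation D R F G \<theta> \<and> (\<forall>x\<in>X. \<theta> (\<eta> x) = f x))))"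

section \<open>Derivations and differential rigs\<close>

text \<open>\<open>LStr R C : R \<odot> \<partial>C \<rightarrow> \<partial>(R \<odot> C)\<close> and \<open>RStr C R : \<partial>C \<odot> R \<rightarrow> \<partial>(C \<odot> R)\<close>.\<close>

record ('o, 'a) derivation_data = "('o, 'a, 'o, 'a) functor_data" +
  LStr :: "'o \<Rightarrow> 'o \<Rightarrow> 'a"
  RStr :: "'o \<Rightarrow> 'o \<Rightarrow> 'a"

definition is_left_strength ::
  "('o, 'a, 'm) monoidal_data_scheme \<Rightarrow> ('o, 'a, 'k) derivation_data_scheme \<Rightarrow> bool" where
  "is_left_strength R d \<longleftrightarrow>
     (\<forall>A\<in>Ob R. \<forall>B\<in>Ob R. LStr d A B \<in> hom R (A \<odot>\<^bsub>R\<^esub> FO d B) (FO d (A \<odot>\<^bsub>R\<^esub> B))) \<and>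
     (\<forall>A A' B B'. \<forall>f\<in>hom R A A'. \<forall>g\<in>hom R B B'.
        FA d (f \<otimes>\<^bsub>R\<^esub> g) \<cdot>\<^bsub>R\<^esub> LStr d A B = LStr d A' B' \<cdot>\<^bsub>R\<^esub> (f \<otimes>\<^bsub>R\<^esub> FA d g)) \<and>
     (\<forall>B\<in>Ob R. FA d (lunit R B) \<cdot>\<^bsub>R\<^esub> LStr d \<one>\<^bsub>R\<^esub> B = lunit R (FO d B)) \<and>
     (\<forall>A\<in>Ob R. \<forall>A'\<in>Ob R. \<forall>B\<in>Ob R.
        FA d (assoc R A A' B) \<cdot>\<^bsub>R\<^esub> LStr d (A \<odot>\<^bsub>R\<^esub> A') B =
        LStr d A (A' \<odot>\<^bsub>R\<^esub> B) \<cdot>\<^bsub>R\<^esub> (Id R A \<otimes>\<^bsub>R\<^esub> LStr d A' B) \<cdot>\<^bsub>R\<^esub> assoc R A A' (FO d B))"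

definition is_right_strength ::
  "('o, 'a, 'm) monoidal_data_scheme \<Rightarrow> ('o, 'a, 'k) derivation_data_scheme \<Rightarrow> bool" where
  "is_right_strength R d \<longleftrightarrow>
     (\<forall>A\<in>Ob R. \<forall>B\<in>Ob R. RStr d A B \<in> hom R (FO d A \<odot>\<^bsub>R\<^esub> B) (FO d (A \<odot>\<^bsub>R\<^esub> B))) \<and>
     (\<forall>A A' B B'. \<forall>f\<in>hom R A A'. \<forall>g\<in>hom R B B'.
        FA d (f \<otimes>\<^bsub>R\<^esub> g) \<cdot>\<^bsub>R\<^esub> RStr d A B = RStr d A' B' \<cdot>\<^bsub>R\<^esub> (FA d f \<otimes>\<^bsub>R\<^esub> g)) \<and>
     (\<forall>A\<in>Ob R. FA d (runit R A) \<cdot>\<^bsub>R\<^esub> RStr d A \<one>\<^bsub>R\<^esub> = runit R (FO d A)) \<and>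
     (\<forall>A\<in>Ob R. \<forall>B\<in>Ob R. \<forall>B'\<in>Ob R.
        FA d (assoc R A B B') \<cdot>\<^bsub>R\<^esub> RStr d (A \<odot>\<^bsub>R\<^esub> B) B' \<cdot>\<^bsub>R\<^esub> (RStr d A B \<otimes>\<^bsub>R\<^esub> Id R B') =
        RStr d A (B \<odot>\<^bsub>R\<^esub> B') \<cdot>\<^bsub>R\<^esub> assoc R (FO d A) B B')"

text \<open>Compatibility of the two strengths: the bimodule axiom and, \<open>R\<close> being symmetric, the
  requirement that the symmetry exchanges the left and the right strength. The latter does not
  follow from the bimodule axiom, and is what makes \<open>(id, \<partial>)\<close> a symmetric monoidal functor
  to \<open>R[\<epsilon>]\<close>.\<close>

definition strengths_compatible ::
  "('o, 'a, 'm) monoidal_data_scheme \<Rightarrow> ('o, 'a, 'k) derivation_data_scheme \<Rightarrow> bool" where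
  "strengths_compatible R d \<longleftrightarrow>
     (\<forall>A\<in>Ob R. \<forall>B\<in>Ob R. \<forall>D\<in>Ob R.
        FA d (assoc R A B D) \<cdot>\<^bsub>R\<^esub> RStr d (A \<odot>\<^bsub>R\<^esub> B) D \<cdot>\<^bsub>R\<^esub> (LStr d A B \<otimes>\<^bsub>R\<^esub> Id R D) =
        LStr d A (B \<odot>\<^bsub>R\<^esub> D) \<cdot>\<^bsub>R\<^esub> (Id R A \<otimes>\<^bsub>R\<^esub> RStr d B D) \<cdot>\<^bsub>R\<^esub> assoc R A (FO d B) D) \<and>
     (\<forall>A\<in>Ob R. \<forall>B\<in>Ob R.
        FA d (braid R A B) \<cdot>\<^bsub>R\<^esub> LStr d A B = RStr d B A \<cdot>\<^bsub>R\<^esub> braid R A (FO d B))"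

definition leibnizator ::
  "('o, 'a, 'm) monoidal_data_scheme \<Rightarrow> ('o, 'a, 'k) derivation_data_scheme \<Rightarrow> 'o \<Rightarrow> 'o \<Rightarrow> 'a" where
  "leibnizator R d A B = copair R (RStr d A B) (LStr d A B)"

definition is_derivation ::
  "('i, 'j) category set \<Rightarrow> ('o, 'a, 'm) monoidal_data_scheme \<Rightarrow>
   ('o, 'a, 'k) derivation_data_scheme \<Rightarrow> bool" where
  "is_derivation \<A> R d \<longleftrightarrow> cocontinuous \<A> R R d \<and>
     is_left_strength R d \<and> is_right_strength R d \<and> strengths_compatible R d \<and>
     (\<forall>A\<in>Ob R. \<forall>B\<in>Ob R. leibnizator R d A B \<in>
        isos R (coprod R (FO d A \<odot>\<^bsub>R\<^esub> B) (A \<odot>\<^bsub>R\<^esub> FO d B)) (FO d (A \<odot>\<^bsub>R\<^esub> B))) \<and>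
     from_initial R (initial_obj R) (FO d \<one>\<^bsub>R\<^esub>) \<in> isos R (initial_obj R) (FO d \<one>\<^bsub>R\<^esub>)"

definition is_differential_rig ::
  "('i, 'j) category set \<Rightarrow> ('o, 'a, 'm) monoidal_data_scheme \<Rightarrow>
   ('o, 'a, 'k) derivation_data_scheme \<Rightarrow> bool" where
  "is_differential_rig \<A> R d \<longleftrightarrow> is_rig \<A> R \<and> is_derivation \<A> R d"

text \<open>The equation \<open>\<partial>' \<circ> F = F \<circ> \<partial>\<close> is read 2-categorically: a morphism consists of a rig map \<open>F\<close>
  and an invertible natural transformation \<open>\<phi> : F \<circ> \<partial> \<Rightarrow> \<partial>' \<circ> F\<close> respecting both strengths.\<close>

definition is_differential_map ::
  "('i, 'j) category set \<Rightarrow>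
   ('o, 'a, 'm) monoidal_data_scheme \<Rightarrow> ('o, 'a, 'k) derivation_data_scheme \<Rightarrow>
   ('p, 'b, 'n) monoidal_data_scheme \<Rightarrow> ('p, 'b, 'l) derivation_data_scheme \<Rightarrow>
   ('o, 'a, 'p, 'b, 'q) monoidal_functor_data_scheme \<Rightarrow> ('o \<Rightarrow> 'b) \<Rightarrow> bool" where
  "is_differential_map \<A> R d S d' F \<phi> \<longleftrightarrow> is_rig_map \<A> R S F \<and>
     (\<forall>A\<in>Ob R. \<phi> A \<in> isos S (FO F (FO d A)) (FO d' (FO F A))) \<and>
     (\<forall>A B. \<forall>f\<in>hom R A B. \<phi> B \<cdot>\<^bsub>S\<^esub> FA F (FA d f) = FA d' (FA F f) \<cdot>\<^bsub>S\<^esub> \<phi> A) \<and>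
     (\<forall>A\<in>Ob R. \<forall>B\<in>Ob R.
        \<phi> (A \<odot>\<^bsub>R\<^esub> B) \<cdot>\<^bsub>S\<^esub> FA F (LStr d A B) \<cdot>\<^bsub>S\<^esub> Mu F A (FO d B) =
        FA d' (Mu F A B) \<cdot>\<^bsub>S\<^esub> LStr d' (FO F A) (FO F B) \<cdot>\<^bsub>S\<^esub> (Id S (FO F A) \<otimes>\<^bsub>S\<^esub> \<phi> B)) \<and>
     (\<forall>A\<in>Ob R. \<forall>B\<in>Ob R.
        \<phi> (A \<odot>\<^bsub>R\<^esub> B) \<cdot>\<^bsub>S\<^esub> FA F (RStr d A B) \<cdot>\<^bsub>S\<^esub> Mu F (FO d A) B =
        FA d' (Mu F A B) \<cdot>\<^bsub>S\<^esub> RStr d' (FO F A) (FO F B) \<cdot>\<^bsub>S\<^esub> (\<phi> A \<otimes>\<^bsub>S\<^esub> Id S (FO F B)))"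

definition is_differential_2cell ::
  "('o, 'a, 'm) monoidal_data_scheme \<Rightarrow> ('o, 'a, 'k) derivation_data_scheme \<Rightarrow>
   ('p, 'b, 'n) monoidal_data_scheme \<Rightarrow> ('p, 'b, 'l) derivation_data_scheme \<Rightarrow>
   ('o, 'a, 'p, 'b, 'q) monoidal_functor_data_scheme \<Rightarrow> ('o \<Rightarrow> 'b) \<Rightarrow>
   ('o, 'a, 'p, 'b, 'r) monoidal_functor_data_scheme \<Rightarrow> ('o \<Rightarrow> 'b) \<Rightarrow> ('o \<Rightarrow> 'b) \<Rightarrow> bool" where
  "is_differential_2cell R d S d' F \<phi> G \<psi> \<theta> \<longleftrightarrow> monoidal_transformation R S F G \<theta> \<and>
     (\<forall>A\<in>Ob R. \<psi> A \<cdot>\<^bsub>S\<^esub> \<theta> (FO d A) = FA d' (\<theta> A) \<cdot>\<^bsub>S\<^esub> \<phi> A)"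

text \<open>For every differential rig \<open>(S, \<partial>')\<close> and every object \<open>A\<close> of \<open>S\<close> there is a morphism
  \<open>(F, \<phi>)\<close> with an isomorphism \<open>\<alpha> : F Y \<cong> A\<close>, and any two such are isomorphic by a
  unique isomorphism compatible with the chosen identifications with \<open>A\<close>.\<close>

definition is_free_differential_rig_on ::
  "('i, 'j) category set \<Rightarrow> ('o, 'a) monoidal_data \<Rightarrow> ('o, 'a) derivation_data \<Rightarrow> 'o \<Rightarrow> bool" where
  "is_free_differential_rig_on \<A> D d Y \<longleftrightarrow> is_differential_rig \<A> D d \<and> Y \<in> Ob D \<and>
     (\<forall>(S :: ('o, 'a) monoidal_data) (d' :: ('o, 'a) derivation_data).
        is_differential_rig \<A> S d' \<longrightarrow> (\<forall>A\<in>Ob S.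
          \<exists>(F :: ('o, 'a, 'o, 'a) monoidal_functor_data) \<phi> \<alpha>.
            is_differential_map \<A> D d S d' F \<phi> \<and> \<alpha> \<in> isos S (FO F Y) A \<and>
            (\<forall>(G :: ('o, 'a, 'o, 'a) monoidal_functor_data) \<psi> \<beta>.
               is_differential_map \<A> D d S d' G \<psi> \<and> \<beta> \<in> isos S (FO G Y) A \<longrightarrow>
               (\<exists>!\<theta>. is_differential_2cell D d S d' F \<phi> G \<psi> \<theta> \<and>
                     (\<forall>X\<in>Ob D. \<theta> X \<in> isos S (FO F X) (FO G X)) \<and>
                     \<beta> \<cdot>\<^bsub>S\<^esub> \<theta> Y = \<alpha>))))"

section \<open>The rig of dual numbers\<close>

definition coprod_arrow :: "('o, 'a, 'm) category_scheme \<Rightarrow> 'a \<Rightarrow> 'a \<Rightarrow> 'a" where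
  "coprod_arrow C f g = copair C (inj1 C (Cod C f) (Cod C g) \<cdot>\<^bsub>C\<^esub> f) (inj2 C (Cod C f) (Cod C g) \<cdot>\<^bsub>C\<^esub> g)"

text \<open>The canonical map \<open>A \<odot> Z + B \<odot> Z \<rightarrow> (A + B) \<odot> Z\<close>, invertible in a rig.\<close>

definition distributor :: "('o, 'a, 'm) monoidal_data_scheme \<Rightarrow> 'o \<Rightarrow> 'o \<Rightarrow> 'o \<Rightarrow> 'a" where
  "distributor R A B Z = copair R (inj1 R A B \<otimes>\<^bsub>R\<^esub> Id R Z) (inj2 R A B \<otimes>\<^bsub>R\<^esub> Id R Z)"

text \<open>\<open>R[\<epsilon>]\<close> on the category \<open>R \<times> R\<close>. The second component of
  \<open>(A, M) \<boxtimes> (B, N)\<close> is \<open>A \<odot> N + M \<odot> B\<close>, so the second component of the associator at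
  \<open>(A, M), (B, N), (D, P)\<close> is the canonical map
  \<open>(A \<odot> B) \<odot> P + (A \<odot> N + M \<odot> B) \<odot> D \<rightarrow> A \<odot> (B \<odot> P + N \<odot> D) + M \<odot> (B \<odot> D)\<close>.
  In the unitors, \<open>0 \<odot> A\<close> and \<open>A \<odot> 0\<close> are initial.\<close>

definition dual_rig :: "('o, 'a, 'm) monoidal_data_scheme \<Rightarrow> ('o \<times> 'o, 'a \<times> 'a) monoidal_data" where
  "dual_rig R = \<lparr>
     Ob = Ob R \<times> Ob R,
     Ar = Ar R \<times> Ar R,
     Dom = map_prod (Dom R) (Dom R),
     Cod = map_prod (Cod R) (Cod R),
     Id = map_prod (Id R) (Id R),
     Cmp = (\<lambda>(g, n) (f, m). (g \<cdot>\<^bsub>R\<^esub> f, n \<cdot>\<^bsub>R\<^esub> m)),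
     TO = (\<lambda>(A, M) (B, N). (A \<odot>\<^bsub>R\<^esub> B, coprod R (A \<odot>\<^bsub>R\<^esub> N) (M \<odot>\<^bsub>R\<^esub> B))),
     TA = (\<lambda>(f, m) (g, n). (f \<otimes>\<^bsub>R\<^esub> g, coprod_arrow R (f \<otimes>\<^bsub>R\<^esub> n) (m \<otimes>\<^bsub>R\<^esub> g))),
     Unit = (\<one>\<^bsub>R\<^esub>, initial_obj R),
     assoc = (\<lambda>(A, M) (B, N) (D, P). (assoc R A B D,
       let X = A \<odot>\<^bsub>R\<^esub> coprod R (B \<odot>\<^bsub>R\<^esub> P) (N \<odot>\<^bsub>R\<^esub> D); X' = M \<odot>\<^bsub>R\<^esub> (B \<odot>\<^bsub>R\<^esub> D) in
       copair R
         (inj1 R X X' \<cdot>\<^bsub>R\<^esub> (Id R A \<otimes>\<^bsub>R\<^esub> inj1 R (B \<odot>\<^bsub>R\<^esub> P) (N \<odot>\<^bsub>R\<^esub> D)) \<cdot>\<^bsub>R\<^esub> assoc R A B P)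
         (copair R
            (inj1 R X X' \<cdot>\<^bsub>R\<^esub> (Id R A \<otimes>\<^bsub>R\<^esub> inj2 R (B \<odot>\<^bsub>R\<^esub> P) (N \<odot>\<^bsub>R\<^esub> D)) \<cdot>\<^bsub>R\<^esub> assoc R A N D)
            (inj2 R X X' \<cdot>\<^bsub>R\<^esub> assoc R M B D)
          \<cdot>\<^bsub>R\<^esub> inv_arrow R (distributor R (A \<odot>\<^bsub>R\<^esub> N) (M \<odot>\<^bsub>R\<^esub> B) D)))),
     lunit = (\<lambda>(A, M). (lunit R A, copair R (lunit R M) (from_initial R (initial_obj R \<odot>\<^bsub>R\<^esub> A) M))),
     runit = (\<lambda>(A, M). (runit R A, copair R (from_initial R (A \<odot>\<^bsub>R\<^esub> initial_obj R) M) (runit R M))),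
     braid = (\<lambda>(A, M) (B, N). (braid R A B,
       copair R
         (inj2 R (B \<odot>\<^bsub>R\<^esub> M) (N \<odot>\<^bsub>R\<^esub> A) \<cdot>\<^bsub>R\<^esub> braid R A N)
         (inj1 R (B \<odot>\<^bsub>R\<^esub> M) (N \<odot>\<^bsub>R\<^esub> A) \<cdot>\<^bsub>R\<^esub> braid R M B))) \<rparr>"

text \<open>The functor \<open>(id, \<partial>) : R \<rightarrow> R[\<epsilon>]\<close> corresponding to a derivation \<open>\<partial>\<close>. The second component of
  its multiplication is the leibnizator with the two summands in the order used in \<open>R[\<epsilon>]\<close>.\<close>

definition dual_map ::
  "('o, 'a, 'm) monoidal_data_scheme \<Rightarrow> ('o, 'a, 'k) derivation_data_scheme \<Rightarrow>
   ('o, 'a, 'o \<times> 'o, 'a \<times> 'a) monoidal_functor_data" where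
  "dual_map R d = \<lparr>
     FO = (\<lambda>A. (A, FO d A)),
     FA = (\<lambda>f. (f, FA d f)),
     Mu = (\<lambda>A B. (Id R (A \<odot>\<^bsub>R\<^esub> B), copair R (LStr d A B) (RStr d A B))),
     Eps = (Id R \<one>\<^bsub>R\<^esub>, from_initial R (initial_obj R) (FO d \<one>\<^bsub>R\<^esub>)) \<rparr>"

text \<open>The derivation determined by \<open>\<partial>(Y\<^sup>(\<^sup>i\<^sup>)) = Y\<^sup>(\<^sup>i\<^sup>+\<^sup>1\<^sup>)\<close>. Maps out of a free rig are determined by
  their values on generators only up to isomorphism, so the values are prescribed up to
  isomorphism.\<close>

definition is_shift_derivation ::
  "('i, 'j) category set \<Rightarrow> ('o, 'a) monoidal_data \<Rightarrow> (nat \<Rightarrow> 'o) \<Rightarrow> ('o, 'a) derivation_data \<Rightarrow> bool" where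
  "is_shift_derivation \<A> D Y d \<longleftrightarrow> is_derivation \<A> D d \<and>
     is_rig_map \<A> D (dual_rig D) (dual_map D d) \<and>
     (\<forall>i. isomorphic (dual_rig D) (FO (dual_map D d) (Y i)) (Y i, Y (Suc i)))"

end

theory Submission
  imports Defs
begin

text \<open>Derivations on \<open>R\<close> are the sections of the projection \<open>R[\<epsilon>] \<rightarrow> R\<close>. Hence the rig map
  \<open>D \<rightarrow> D[\<epsilon>]\<close> given by the freeness of \<open>D\<close> on \<open>Y i \<mapsto> (Y i, Y (Suc i))\<close>, whose first component is
  isomorphic to the identity because it fixes the generators, yields the shift derivation. For a
  differential rig \<open>(S, \<partial>')\<close> and a rig map \<open>F : D \<rightarrow> S\<close>, both \<open>(F, F \<circ> \<partial>)\<close> and \<open>(F, \<partial>' \<circ> F)\<close> are rig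
  maps \<open>D \<rightarrow> S[\<epsilon>]\<close>, and a structure of a differential map on \<open>F\<close> is an isomorphism between them
  with first component the identity. Such an isomorphism is determined by its values on the
  generators, and exists if \<open>F\<close> sends \<open>Y i\<close> to the \<open>i\<close>-th derivative of \<open>A\<close>. In the same way, being a
  2-cell of differential maps is an equality of transformations between rig maps to
  \<open>S[\<epsilon>]\<close>, which can be tested on generators.\<close>

section \<open>Arrows, isomorphisms and coproducts\<close>

text \<open>Two obstacles shape the development. Freeness of \<open>D\<close> quantifies over rigs
  on the types \<open>'o\<close> and \<open>'a\<close>, whereas \<open>dual_rig S\<close> lives on
  \<open>'o \<times> 'o\<close> and \<open>'a \<times> 'a\<close>. A doctrine has discrete shapes of
  every finite size, and the shapes in the theorem are built over these same types, so both types
  are infinite and in bijection with their squares; pulling \<open>dual_rig S\<close> back along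
  such bijections brings it under the universal property. Secondly, a derivation needs the identity
  as first component, while freeness yields rig maps up to isomorphism only. Hence derivations are
  generalised to derivations relative to a monoidal functor through which objects act: the acting
  functor can be exchanged for an isomorphic one, and derivations followed or preceded by a rig map
  become instances. Equations in the dual numbers are tested on the summands of the second
  component, where each coherence axiom turns into several copies of the same axiom of the base,
  apart from initial summands where a unit occurs.\<close>

context category
begin

lemma Dom_Ob [simp]: "f \<in> Ar C \<Longrightarrow> Dom C f \<in> Ob C"
  and Cod_Ob [simp]: "f \<in> Ar C \<Longrightarrow> Cod C f \<in> Ob C"
  by (rule dom_Ob cod_Ob, assumption)+

lemma Id_Ar [simp]: "A \<in> Ob C \<Longrightarrow> Id C A \<in> Ar C"
  and Dom_Id [simp]: "A \<in> Ob C \<Longrightarrow> Dom C (Id C A) = A"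
  and Cod_Id [simp]: "A \<in> Ob C \<Longrightarrow> Cod C (Id C A) = A"
  using Id_hom[of A] by (simp_all add: hom_def)

lemma Cmp_Ar [simp]: "\<lbrakk>f \<in> Ar C; g \<in> Ar C; Dom C g = Cod C f\<rbrakk> \<Longrightarrow> g \<cdot> f \<in> Ar C"
  and Dom_Cmp [simp]: "\<lbrakk>f \<in> Ar C; g \<in> Ar C; Dom C g = Cod C f\<rbrakk> \<Longrightarrow> Dom C (g \<cdot> f) = Dom C f"
  and Cod_Cmp [simp]: "\<lbrakk>f \<in> Ar C; g \<in> Ar C; Dom C g = Cod C f\<rbrakk> \<Longrightarrow> Cod C (g \<cdot> f) = Cod C g"
  using Cmp_hom[of f "Dom C f" "Cod C f" g "Cod C g"] by (simp_all add: hom_def)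

lemma Cmp_Id [simp]: "f \<in> Ar C \<Longrightarrow> Dom C f = A \<Longrightarrow> f \<cdot> Id C A = f"
  and Id_Cmp [simp]: "f \<in> Ar C \<Longrightarrow> Cod C f = A \<Longrightarrow> Id C A \<cdot> f = f"
  using Cmp_Id_right[of f A "Cod C f"] Cmp_Id_left[of f "Dom C f" A] by (simp_all add: hom_def)

lemma Cmp_Cmp [simp]: "\<lbrakk>f \<in> Ar C; g \<in> Ar C; h \<in> Ar C; Dom C g = Cod C f; Dom C h = Cod C g\<rbrakk> \<Longrightarrow>
    (h \<cdot> g) \<cdot> f = h \<cdot> (g \<cdot> f)"
  using Cmp_assoc[of f "Dom C f" "Cod C f" g "Cod C g" h "Cod C h"] by (simp add: hom_def)

text \<open>The simplifier nests composites to the right, so in front of a further arrow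
  \<open>k\<close> the composite \<open>g \<cdot> f\<close> is no longer a subterm. Applied as
  \<open>[THEN reassoc]\<close>, this turns an equation into the rule that fires there too.\<close>

lemma reassoc: "\<lbrakk>g \<cdot> f = h; f \<in> Ar C; g \<in> Ar C; Dom C g = Cod C f; k \<in> Ar C;
    Dom C f = Cod C k\<rbrakk> \<Longrightarrow> g \<cdot> (f \<cdot> k) = h \<cdot> k"
  using Cmp_Cmp[of k f g] by simp

lemma reassoc3: "\<lbrakk>g \<cdot> (f \<cdot> e) = h; e \<in> Ar C; f \<in> Ar C; g \<in> Ar C; Dom C g = Cod C f;
    Dom C f = Cod C e; k \<in> Ar C; Dom C e = Cod C k\<rbrakk> \<Longrightarrow> g \<cdot> (f \<cdot> (e \<cdot> k)) = h \<cdot> k"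
  using Cmp_Cmp[of k "f \<cdot> e" g] by simp

text \<open>\<open>isos C A B\<close> bundles invertibility with the endpoints; separating them
  leaves the endpoints to rewriting with \<open>Dom\<close> and \<open>Cod\<close>.\<close>

definition iso where
  "iso f \<longleftrightarrow> f \<in> Ar C \<and> (\<exists>g. inverse_arrows C f g)"

lemma isos_iff: "f \<in> isos C A B \<longleftrightarrow> iso f \<and> Dom C f = A \<and> Cod C f = B"
  by (auto simp: isos_def iso_def hom_def)

lemma inverse_arrows_iff: "inverse_arrows C f g \<longleftrightarrow> f \<in> Ar C \<and> g \<in> Ar C \<and>
    Dom C g = Cod C f \<and> Cod C g = Dom C f \<and> g \<cdot> f = Id C (Dom C f) \<and> f \<cdot> g = Id C (Cod C f)"
  by (auto simp: inverse_arrows_def hom_def)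

lemma inverse_arrows_unique: "inverse_arrows C f g \<Longrightarrow> inverse_arrows C f h \<Longrightarrow> g = h"
  unfolding inverse_arrows_iff using Cmp_Cmp[of g f h] Cmp_Id[of h] Id_Cmp[of g] by metis

lemma inverse_arrows_inv: "iso f \<Longrightarrow> inverse_arrows C f (inv_arrow C f)"
  unfolding iso_def inv_arrow_def by (rule theI') (blast intro: inverse_arrows_unique)

lemma isoI: "\<lbrakk>f \<in> Ar C; g \<in> Ar C; Dom C g = Cod C f; Cod C g = Dom C f;
    g \<cdot> f = Id C (Dom C f); f \<cdot> g = Id C (Cod C f)\<rbrakk> \<Longrightarrow> iso f"
  unfolding iso_def inverse_arrows_iff by blast

lemma iso_Ar: "iso f \<Longrightarrow> f \<in> Ar C"
  by (simp add: iso_def)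

lemma inv_Ar [simp]: "iso f \<Longrightarrow> inv_arrow C f \<in> Ar C"
  and Dom_inv [simp]: "iso f \<Longrightarrow> Dom C (inv_arrow C f) = Cod C f"
  and Cod_inv [simp]: "iso f \<Longrightarrow> Cod C (inv_arrow C f) = Dom C f"
  and inv_Cmp [simp]: "iso f \<Longrightarrow> inv_arrow C f \<cdot> f = Id C (Dom C f)"
  and Cmp_inv [simp]: "iso f \<Longrightarrow> f \<cdot> inv_arrow C f = Id C (Cod C f)"
  using inverse_arrows_inv[of f] by (simp_all add: inverse_arrows_iff)

lemma inv_Cmp' [simp]: "\<lbrakk>iso f; k \<in> Ar C; Cod C k = Dom C f\<rbrakk> \<Longrightarrow> inv_arrow C f \<cdot> (f \<cdot> k) = k"
  and Cmp_inv' [simp]: "\<lbrakk>iso f; k \<in> Ar C; Cod C k = Cod C f\<rbrakk> \<Longrightarrow> f \<cdot> (inv_arrow C f \<cdot> k) = k"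
  by (subst reassoc[OF inv_Cmp] reassoc[OF Cmp_inv]; simp add: iso_Ar)+

lemma iso_inv [simp]: "iso f \<Longrightarrow> iso (inv_arrow C f)"
  by (rule isoI[where g = f]) (auto simp: iso_Ar)

lemma iso_Id [simp]: "A \<in> Ob C \<Longrightarrow> iso (Id C A)"
  by (rule isoI[where g = "Id C A"]) auto

lemma iso_Cmp [simp]: "\<lbrakk>iso f; iso g; Dom C g = Cod C f\<rbrakk> \<Longrightarrow> iso (g \<cdot> f)"
  by (rule isoI[where g = "inv_arrow C f \<cdot> inv_arrow C g"]) (auto simp: iso_Ar)

lemma iso_epi: "\<lbrakk>f \<cdot> e = g \<cdot> e; iso e; f \<in> Ar C; g \<in> Ar C; Dom C f = Cod C e;
    Dom C g = Cod C e\<rbrakk> \<Longrightarrow> f = g"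
  by (drule arg_cong[where f = "\<lambda>x. x \<cdot> inv_arrow C e"]) (simp add: iso_Ar)

lemma iso_mono: "\<lbrakk>e \<cdot> f = e \<cdot> g; iso e; f \<in> Ar C; g \<in> Ar C; Cod C f = Dom C e;
    Cod C g = Dom C e\<rbrakk> \<Longrightarrow> f = g"
  by (drule arg_cong[where f = "\<lambda>x. inv_arrow C e \<cdot> x"]) simp

lemma initial_Ob: "is_initial C Z \<Longrightarrow> Z \<in> Ob C"
  by (simp add: is_initial_def)

lemma initial_eq: "\<lbrakk>is_initial C Z; f \<in> Ar C; g \<in> Ar C; Dom C f = Z; Dom C g = Z;
    Cod C f = Cod C g\<rbrakk> \<Longrightarrow> f = g"
  unfolding is_initial_def hom_def using Cod_Ob[of g] by blast

lemma from_initial_hom: "is_initial C Z \<Longrightarrow> X \<in> Ob C \<Longrightarrow> from_initial C Z X \<in> hom C Z X"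
  unfolding from_initial_def is_initial_def by (rule theI') blast

lemma from_initial_Ar [simp]: "is_initial C Z \<Longrightarrow> X \<in> Ob C \<Longrightarrow> from_initial C Z X \<in> Ar C"
  and Dom_from_initial [simp]: "is_initial C Z \<Longrightarrow> X \<in> Ob C \<Longrightarrow> Dom C (from_initial C Z X) = Z"
  and Cod_from_initial [simp]: "is_initial C Z \<Longrightarrow> X \<in> Ob C \<Longrightarrow> Cod C (from_initial C Z X) = X"
  using from_initial_hom[of Z X] by (simp_all add: hom_def)

lemma initial_iso: "is_initial C Z \<Longrightarrow> is_initial C Z' \<Longrightarrow> iso (from_initial C Z Z')"
  by (rule isoI[where g = "from_initial C Z' Z"]; (rule initial_eq)?) (auto simp: initial_Ob)

lemma iso_from_initial:
  assumes "is_initial C Z" "iso f" "Dom C f = Z" shows "is_initial C (Cod C f)"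
  unfolding is_initial_def
proof (intro conjI ballI ex1I)
  fix X assume X: "X \<in> Ob C"
  let ?h = "from_initial C Z X \<cdot> inv_arrow C f"
  show "?h \<in> hom C (Cod C f) X"
    using assms X by (simp add: hom_def iso_Ar)
  fix h assume h: "h \<in> hom C (Cod C f) X"
  have "h \<cdot> f = from_initial C Z X"
    using assms X h by (intro initial_eq[of Z]) (auto simp: hom_def iso_Ar)
  hence "(h \<cdot> f) \<cdot> inv_arrow C f = ?h" by simp
  thus "h = ?h" using assms X h by (simp add: hom_def iso_Ar)
qed (use assms in \<open>simp add: iso_Ar\<close>)

lemma coproduct_Ar:
  assumes "is_coproduct C A B (P, i, j)"
  shows "P \<in> Ob C" "i \<in> Ar C" "Dom C i = A" "Cod C i = P" "j \<in> Ar C" "Dom C j = B" "Cod C j = P"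
  using assms by (simp_all add: is_coproduct_def hom_def)

text \<open>Joint epicness of the injections, for an arbitrary coproduct and not only the chosen
  one: it is also applied to coproduct cocones that have been tensored with an object.\<close>

lemma coproduct_eq:
  assumes P: "is_coproduct C A B (P, i, j)" and eq: "h \<cdot> i = k \<cdot> i" "h \<cdot> j = k \<cdot> j"
    and h: "h \<in> Ar C" "k \<in> Ar C" "Dom C h = P" "Dom C k = P" "Cod C h = Cod C k"
  shows "h = k"
proof -
  note 1 = coproduct_Ar[OF P]
  have "k \<cdot> i \<in> hom C A (Cod C k)" "k \<cdot> j \<in> hom C B (Cod C k)"
    using 1 h by (simp_all add: hom_def)
  hence "\<exists>!m. m \<in> hom C P (Cod C k) \<and> m \<cdot> i = k \<cdot> i \<and> m \<cdot> j = k \<cdot> j"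
    using P unfolding is_coproduct_def by blast
  moreover have "h \<in> hom C P (Cod C k)" "k \<in> hom C P (Cod C k)" using h by (simp_all add: hom_def)
  ultimately show ?thesis using eq by blast
qed

lemma coproduct_ex:
  assumes "is_coproduct C A B (P, i, j)" "f \<in> Ar C" "g \<in> Ar C" "Dom C f = A" "Dom C g = B" "Cod C f = Cod C g"
  obtains h where "h \<in> Ar C" "Dom C h = P" "Cod C h = Cod C f" "h \<cdot> i = f" "h \<cdot> j = g"
proof -
  have "\<exists>!h. h \<in> hom C P (Cod C f) \<and> h \<cdot> i = f \<and> h \<cdot> j = g"
  proof -
    have "f \<in> hom C A (Cod C f)" "g \<in> hom C B (Cod C f)" using assms(2-) by (simp_all add: hom_def)
    thus ?thesis using assms(1) unfolding is_coproduct_def by blast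
  qed
  thus thesis using that unfolding hom_def mem_Collect_eq by metis
qed

lemma is_coproductI:
  assumes "P \<in> Ob C" "i \<in> Ar C" "j \<in> Ar C" "Dom C i = A" "Dom C j = B" "Cod C i = P" "Cod C j = P"
    and "\<And>f g. f \<in> Ar C \<Longrightarrow> g \<in> Ar C \<Longrightarrow> Dom C f = A \<Longrightarrow> Dom C g = B \<Longrightarrow> Cod C f = Cod C g \<Longrightarrow>
      \<exists>h. h \<in> Ar C \<and> Dom C h = P \<and> Cod C h = Cod C f \<and> h \<cdot> i = f \<and> h \<cdot> j = g"
    and "\<And>h k. h \<in> Ar C \<Longrightarrow> k \<in> Ar C \<Longrightarrow> Dom C h = P \<Longrightarrow> Dom C k = P \<Longrightarrow> Cod C h = Cod C k \<Longrightarrow>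
      h \<cdot> i = k \<cdot> i \<Longrightarrow> h \<cdot> j = k \<cdot> j \<Longrightarrow> h = k"
  shows "is_coproduct C A B (P, i, j)"
proof -
  have "\<exists>!h. h \<in> hom C P X \<and> h \<cdot> i = f \<and> h \<cdot> j = g" if fg: "f \<in> hom C A X" "g \<in> hom C B X" for X f g
  proof (rule ex_ex1I)
    show "\<exists>h. h \<in> hom C P X \<and> h \<cdot> i = f \<and> h \<cdot> j = g"
      using assms(8)[of f g] fg unfolding hom_def mem_Collect_eq by metis
    show "h = k" if "h \<in> hom C P X \<and> h \<cdot> i = f \<and> h \<cdot> j = g" "k \<in> hom C P X \<and> k \<cdot> i = f \<and> k \<cdot> j = g" for h k
      using assms(9)[of h k] that unfolding hom_def mem_Collect_eq by metis
  qed
  thus ?thesis using assms(1-7) by (simp add: is_coproduct_def hom_def)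
qed

end

text \<open>The coherence of the dual numbers involves only an initial object and binary coproducts,
  so this finite fragment is isolated from the doctrine.\<close>

locale cocartesian_category = category C for C :: "('o, 'a, 'm) category_scheme" (structure) +
  assumes ex_initial: "\<exists>Z. is_initial C Z"
    and ex_coproduct: "A \<in> Ob C \<Longrightarrow> B \<in> Ob C \<Longrightarrow> \<exists>p. is_coproduct C A B p"
begin

lemma initial_obj [simp]: "is_initial C (initial_obj C)"
  unfolding initial_obj_def using ex_initial by (rule someI_ex)

lemma initial_obj_Ob [simp]: "initial_obj C \<in> Ob C"
  by (rule initial_Ob) simp

lemma coprod: "A \<in> Ob C \<Longrightarrow> B \<in> Ob C \<Longrightarrow> is_coproduct C A B (coprod C A B, inj1 C A B, inj2 C A B)"
  unfolding coprod_def inj1_def inj2_def using someI_ex[OF ex_coproduct] by simp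

lemma
  assumes "A \<in> Ob C" "B \<in> Ob C"
  shows coprod_Ob [simp]: "coprod C A B \<in> Ob C"
    and inj1_Ar [simp]: "inj1 C A B \<in> Ar C" and inj2_Ar [simp]: "inj2 C A B \<in> Ar C"
    and Dom_inj1 [simp]: "Dom C (inj1 C A B) = A" and Dom_inj2 [simp]: "Dom C (inj2 C A B) = B"
    and Cod_inj1 [simp]: "Cod C (inj1 C A B) = coprod C A B" and Cod_inj2 [simp]: "Cod C (inj2 C A B) = coprod C A B"
  using coproduct_Ar[OF coprod[OF assms]] by simp_all

lemma copair:
  assumes "f \<in> Ar C" "g \<in> Ar C" "Cod C f = Cod C g"
  shows "copair C f g \<in> hom C (coprod C (Dom C f) (Dom C g)) (Cod C f) \<and>
    copair C f g \<cdot> inj1 C (Dom C f) (Dom C g) = f \<and> copair C f g \<cdot> inj2 C (Dom C f) (Dom C g) = g"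
proof -
  have "f \<in> hom C (Dom C f) (Cod C f)" "g \<in> hom C (Dom C g) (Cod C f)"
    using assms by (simp_all add: hom_def)
  hence "\<exists>!h. h \<in> hom C (coprod C (Dom C f) (Dom C g)) (Cod C f) \<and>
      h \<cdot> inj1 C (Dom C f) (Dom C g) = f \<and> h \<cdot> inj2 C (Dom C f) (Dom C g) = g"
    using coprod[of "Dom C f" "Dom C g"] assms unfolding is_coproduct_def by simp
  thus ?thesis unfolding copair_def by (rule theI')
qed

lemma
  assumes "f \<in> Ar C" "g \<in> Ar C" "Cod C f = Cod C g"
  shows copair_Ar [simp]: "copair C f g \<in> Ar C"
    and Dom_copair [simp]: "Dom C (copair C f g) = coprod C (Dom C f) (Dom C g)"
    and Cod_copair [simp]: "Cod C (copair C f g) = Cod C g"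
    and copair_inj1 [simp]: "Dom C f = A \<Longrightarrow> Dom C g = B \<Longrightarrow> copair C f g \<cdot> inj1 C A B = f"
    and copair_inj2 [simp]: "Dom C f = A \<Longrightarrow> Dom C g = B \<Longrightarrow> copair C f g \<cdot> inj2 C A B = g"
  using copair[OF assms] assms by (auto simp: hom_def)

lemma
  assumes "f \<in> Ar C" "g \<in> Ar C" "Cod C f = Cod C g" "Dom C f = A" "Dom C g = B" "k \<in> Ar C"
  shows copair_inj1' [simp]: "Cod C k = A \<Longrightarrow> copair C f g \<cdot> (inj1 C A B \<cdot> k) = f \<cdot> k"
    and copair_inj2' [simp]: "Cod C k = B \<Longrightarrow> copair C f g \<cdot> (inj2 C A B \<cdot> k) = g \<cdot> k"
  using assms by (auto intro!: reassoc)

lemma coprod_eq: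
  "\<lbrakk>h \<cdot> inj1 C A B = k \<cdot> inj1 C A B; h \<cdot> inj2 C A B = k \<cdot> inj2 C A B; A \<in> Ob C; B \<in> Ob C;
    h \<in> Ar C; k \<in> Ar C; Dom C h = coprod C A B; Dom C k = coprod C A B; Cod C h = Cod C k\<rbrakk> \<Longrightarrow> h = k"
  by (rule coproduct_eq[OF coprod])

lemma
  assumes "f \<in> Ar C" "g \<in> Ar C"
  shows coprod_arrow_Ar [simp]: "coprod_arrow C f g \<in> Ar C"
    and Dom_coprod_arrow [simp]: "Dom C (coprod_arrow C f g) = coprod C (Dom C f) (Dom C g)"
    and Cod_coprod_arrow [simp]: "Cod C (coprod_arrow C f g) = coprod C (Cod C f) (Cod C g)"
    and coprod_arrow_inj1 [simp]: "Dom C f = A \<Longrightarrow> Dom C g = B \<Longrightarrow>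
      coprod_arrow C f g \<cdot> inj1 C A B = inj1 C (Cod C f) (Cod C g) \<cdot> f"
    and coprod_arrow_inj2 [simp]: "Dom C f = A \<Longrightarrow> Dom C g = B \<Longrightarrow>
      coprod_arrow C f g \<cdot> inj2 C A B = inj2 C (Cod C f) (Cod C g) \<cdot> g"
  using assms unfolding coprod_arrow_def by auto

lemma
  assumes "f \<in> Ar C" "g \<in> Ar C" "Dom C f = A" "Dom C g = B" "k \<in> Ar C"
  shows coprod_arrow_inj1' [simp]: "Cod C k = A \<Longrightarrow>
      coprod_arrow C f g \<cdot> (inj1 C A B \<cdot> k) = inj1 C (Cod C f) (Cod C g) \<cdot> (f \<cdot> k)"
    and coprod_arrow_inj2' [simp]: "Cod C k = B \<Longrightarrow>
      coprod_arrow C f g \<cdot> (inj2 C A B \<cdot> k) = inj2 C (Cod C f) (Cod C g) \<cdot> (g \<cdot> k)"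
  using assms unfolding coprod_arrow_def by auto

lemma coprod_arrow_Id [simp]: "A \<in> Ob C \<Longrightarrow> B \<in> Ob C \<Longrightarrow> coprod_arrow C (Id C A) (Id C B) = Id C (coprod C A B)"
  by (rule coprod_eq[of _ A B]) auto

lemma coprod_arrow_Cmp: "\<lbrakk>f \<in> Ar C; g \<in> Ar C; f' \<in> Ar C; g' \<in> Ar C; Dom C f' = Cod C f;
    Dom C g' = Cod C g\<rbrakk> \<Longrightarrow> coprod_arrow C (f' \<cdot> f) (g' \<cdot> g) = coprod_arrow C f' g' \<cdot> coprod_arrow C f g"
  by (rule coprod_eq[of _ "Dom C f" "Dom C g"]) auto

lemma iso_coprod_arrow: "iso f \<Longrightarrow> iso g \<Longrightarrow> iso (coprod_arrow C f g)"
  by (rule isoI[where g = "coprod_arrow C (inv_arrow C f) (inv_arrow C g)"])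
    (auto simp: iso_Ar coprod_arrow_Cmp[symmetric])

text \<open>Two coproducts of the same objects are isomorphic, here the chosen one and
  \<open>P\<close>. This makes the distributors invertible, and later the Leibniz map after a
  functor that preserves coproducts but not their choice.\<close>

lemma coproduct_copair_iso:
  assumes "is_coproduct C A B (P, i, j)" shows "iso (copair C i j)"
proof -
  note 1 = coproduct_Ar[OF assms]
  have AB: "A \<in> Ob C" "B \<in> Ob C" using 1 by auto
  obtain h where h: "h \<in> Ar C" "Dom C h = P" "Cod C h = Cod C (inj1 C A B)" "h \<cdot> i = inj1 C A B" "h \<cdot> j = inj2 C A B"
    by (rule coproduct_ex[OF assms, of "inj1 C A B" "inj2 C A B"]) (use AB in auto)
  show ?thesis
  proof (rule isoI[where g = h])
    show "h \<cdot> copair C i j = Id C (Dom C (copair C i j))"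
      by (rule coprod_eq[of _ A B]) (use 1 h AB in auto)
    show "copair C i j \<cdot> h = Id C (Cod C (copair C i j))"
      by (rule coproduct_eq[OF assms]) (use 1 h AB in auto)
  qed (use 1 h AB in auto)
qed

end

section \<open>Distributive symmetric monoidal categories\<close>

context symmetric_monoidal_category
begin

lemma tensor_Ob [simp]: "A \<in> Ob R \<Longrightarrow> B \<in> Ob R \<Longrightarrow> A \<odot> B \<in> Ob R"
  by (rule TO_Ob)

lemma one_Ob [simp]: "\<one> \<in> Ob R"
  by (rule Unit_Ob)

lemma tensor_Ar [simp]: "f \<in> Ar R \<Longrightarrow> g \<in> Ar R \<Longrightarrow> f \<otimes> g \<in> Ar R"
  and Dom_tensor [simp]: "f \<in> Ar R \<Longrightarrow> g \<in> Ar R \<Longrightarrow> Dom R (f \<otimes> g) = Dom R f \<odot> Dom R g"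
  and Cod_tensor [simp]: "f \<in> Ar R \<Longrightarrow> g \<in> Ar R \<Longrightarrow> Cod R (f \<otimes> g) = Cod R f \<odot> Cod R g"
  using TA_hom[of f "Dom R f" "Cod R f" g "Dom R g" "Cod R g"] by (simp_all add: hom_def)

lemma tensor_Id [simp]: "A \<in> Ob R \<Longrightarrow> B \<in> Ob R \<Longrightarrow> Id R A \<otimes> Id R B = Id R (A \<odot> B)"
  by (rule TA_Id)

lemma interchange: "\<lbrakk>f \<in> Ar R; g \<in> Ar R; f' \<in> Ar R; g' \<in> Ar R; Dom R f' = Cod R f;
    Dom R g' = Cod R g\<rbrakk> \<Longrightarrow> (f' \<otimes> g') \<cdot> (f \<otimes> g) = (f' \<cdot> f) \<otimes> (g' \<cdot> g)"
  using TA_Cmp[of f "Dom R f" "Cod R f" f' "Cod R f'" g "Dom R g" "Cod R g" g' "Cod R g'"]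
  by (simp add: hom_def)

lemmas interchange' = interchange[THEN reassoc]

lemma whisker_left: "\<lbrakk>f \<in> Ar R; g \<in> Ar R; Dom R g = Cod R f; A \<in> Ob R\<rbrakk> \<Longrightarrow>
    Id R A \<otimes> (g \<cdot> f) = (Id R A \<otimes> g) \<cdot> (Id R A \<otimes> f)"
  and whisker_right: "\<lbrakk>f \<in> Ar R; g \<in> Ar R; Dom R g = Cod R f; A \<in> Ob R\<rbrakk> \<Longrightarrow>
    (g \<cdot> f) \<otimes> Id R A = (g \<otimes> Id R A) \<cdot> (f \<otimes> Id R A)"
  by (simp_all add: interchange)

lemma iso_tensor [simp]: "iso f \<Longrightarrow> iso g \<Longrightarrow> iso (f \<otimes> g)"
  by (rule isoI[where g = "inv_arrow R f \<otimes> inv_arrow R g"]) (auto simp: iso_Ar interchange)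

lemma iso_assoc [simp]: "\<lbrakk>A \<in> Ob R; B \<in> Ob R; D \<in> Ob R\<rbrakk> \<Longrightarrow> iso (assoc R A B D)"
  and Dom_assoc [simp]: "\<lbrakk>A \<in> Ob R; B \<in> Ob R; D \<in> Ob R\<rbrakk> \<Longrightarrow> Dom R (assoc R A B D) = (A \<odot> B) \<odot> D"
  and Cod_assoc [simp]: "\<lbrakk>A \<in> Ob R; B \<in> Ob R; D \<in> Ob R\<rbrakk> \<Longrightarrow> Cod R (assoc R A B D) = A \<odot> (B \<odot> D)"
  using assoc_iso[of A B D] by (auto simp: isos_iff)

lemma iso_lunit [simp]: "A \<in> Ob R \<Longrightarrow> iso (lunit R A)"
  and Dom_lunit [simp]: "A \<in> Ob R \<Longrightarrow> Dom R (lunit R A) = \<one> \<odot> A"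
  and Cod_lunit [simp]: "A \<in> Ob R \<Longrightarrow> Cod R (lunit R A) = A"
  using lunit_iso[of A] by (auto simp: isos_iff)

lemma iso_runit [simp]: "A \<in> Ob R \<Longrightarrow> iso (runit R A)"
  and Dom_runit [simp]: "A \<in> Ob R \<Longrightarrow> Dom R (runit R A) = A \<odot> \<one>"
  and Cod_runit [simp]: "A \<in> Ob R \<Longrightarrow> Cod R (runit R A) = A"
  using runit_iso[of A] by (auto simp: isos_iff)

lemma braid_Ar [simp]: "A \<in> Ob R \<Longrightarrow> B \<in> Ob R \<Longrightarrow> braid R A B \<in> Ar R"
  and Dom_braid [simp]: "A \<in> Ob R \<Longrightarrow> B \<in> Ob R \<Longrightarrow> Dom R (braid R A B) = A \<odot> B"
  and Cod_braid [simp]: "A \<in> Ob R \<Longrightarrow> B \<in> Ob R \<Longrightarrow> Cod R (braid R A B) = B \<odot> A"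
  using braid_hom[of A B] by (auto simp: hom_def)

lemma coherence_Ar [simp]:
  "\<lbrakk>A \<in> Ob R; B \<in> Ob R; D \<in> Ob R\<rbrakk> \<Longrightarrow> assoc R A B D \<in> Ar R"
  "A \<in> Ob R \<Longrightarrow> lunit R A \<in> Ar R"
  "A \<in> Ob R \<Longrightarrow> runit R A \<in> Ar R"
  by (auto intro: iso_Ar)

lemma braid_braid_Id [simp]: "A \<in> Ob R \<Longrightarrow> B \<in> Ob R \<Longrightarrow> braid R A B \<cdot> braid R B A = Id R (B \<odot> A)"
  by (rule braid_braid)

lemma braid_braid_Id' [simp]: "\<lbrakk>A \<in> Ob R; B \<in> Ob R; k \<in> Ar R; Cod R k = B \<odot> A\<rbrakk> \<Longrightarrow>
    braid R A B \<cdot> (braid R B A \<cdot> k) = k"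
  by (subst reassoc[OF braid_braid_Id]) auto

text \<open>The codomains enter through premises such as \<open>Cod R f = A\<close>. The left-hand
  side is then a pattern in the free variables \<open>A\<close>, \<open>B\<close>, \<open>D\<close>,
  which still matches after \<open>Cod\<close> has been evaluated.\<close>

lemma assoc_nat: "\<lbrakk>f \<in> Ar R; g \<in> Ar R; h \<in> Ar R; Cod R f = A; Cod R g = B; Cod R h = D\<rbrakk> \<Longrightarrow>
    assoc R A B D \<cdot> ((f \<otimes> g) \<otimes> h) = (f \<otimes> (g \<otimes> h)) \<cdot> assoc R (Dom R f) (Dom R g) (Dom R h)"
  using assoc_natural[of f "Dom R f" A g "Dom R g" B h "Dom R h" D] by (simp add: hom_def)

text \<open>\<open>tensor_Id\<close> rewrites \<open>Id R A \<otimes> Id R B\<close> to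
  \<open>Id R (A \<odot> B)\<close> and so hides the pattern of \<open>assoc_nat\<close>; this
  instance restores it.\<close>

lemma assoc_nat_Id: "\<lbrakk>A \<in> Ob R; B \<in> Ob R; h \<in> Ar R; Cod R h = D\<rbrakk> \<Longrightarrow>
    assoc R A B D \<cdot> (Id R (A \<odot> B) \<otimes> h) = (Id R A \<otimes> (Id R B \<otimes> h)) \<cdot> assoc R A B (Dom R h)"
  using assoc_nat[of "Id R A" "Id R B" h A B D] by simp

lemma lunit_nat: "f \<in> Ar R \<Longrightarrow> Cod R f = A \<Longrightarrow> lunit R A \<cdot> (Id R \<one> \<otimes> f) = f \<cdot> lunit R (Dom R f)"
  using lunit_natural[of f "Dom R f" A] by (simp add: hom_def)

lemma runit_nat: "f \<in> Ar R \<Longrightarrow> Cod R f = A \<Longrightarrow> runit R A \<cdot> (f \<otimes> Id R \<one>) = f \<cdot> runit R (Dom R f)"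
  using runit_natural[of f "Dom R f" A] by (simp add: hom_def)

lemma braid_nat: "\<lbrakk>f \<in> Ar R; g \<in> Ar R; Cod R f = A; Cod R g = B\<rbrakk> \<Longrightarrow>
    braid R A B \<cdot> (f \<otimes> g) = (g \<otimes> f) \<cdot> braid R (Dom R f) (Dom R g)"
  using braid_natural[of f "Dom R f" A g "Dom R g" B] by (simp add: hom_def)

lemmas assoc_nat' = assoc_nat[THEN reassoc]
lemmas assoc_nat_Id' = assoc_nat_Id[THEN reassoc]
lemmas braid_nat' = braid_nat[THEN reassoc]

lemma pentagon_eq: "\<lbrakk>A \<in> Ob R; B \<in> Ob R; D \<in> Ob R; E \<in> Ob R\<rbrakk> \<Longrightarrow>
    (Id R A \<otimes> assoc R B D E) \<cdot> (assoc R A (B \<odot> D) E \<cdot> (assoc R A B D \<otimes> Id R E)) =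
    assoc R A B (D \<odot> E) \<cdot> assoc R (A \<odot> B) D E"
  by (subst pentagon) auto

lemma hexagon_eq: "\<lbrakk>A \<in> Ob R; B \<in> Ob R; D \<in> Ob R\<rbrakk> \<Longrightarrow>
    assoc R B D A \<cdot> (braid R A (B \<odot> D) \<cdot> assoc R A B D) =
    (Id R B \<otimes> braid R A D) \<cdot> (assoc R B A D \<cdot> (braid R A B \<otimes> Id R D))"
  using hexagon[of A B D] by auto

end

text \<open>The finite shadow of \<open>is_rig\<close>. Preservation is assumed for every coproduct
  cocone instead of the chosen one, so that it can be iterated for sums that are tensored
  twice.\<close>

locale distributive_category =
  symmetric_monoidal_category R + cocartesian_category R for R :: "('o, 'a, 'm) monoidal_data_scheme" (structure) +
  assumes left_coproduct: "X \<in> Ob R \<Longrightarrow> is_coproduct R A B (P, i, j) \<Longrightarrow>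
      is_coproduct R (X \<odot> A) (X \<odot> B) (X \<odot> P, Id R X \<otimes> i, Id R X \<otimes> j)"
    and right_coproduct: "X \<in> Ob R \<Longrightarrow> is_coproduct R A B (P, i, j) \<Longrightarrow>
      is_coproduct R (A \<odot> X) (B \<odot> X) (P \<odot> X, i \<otimes> Id R X, j \<otimes> Id R X)"
    and left_initial [simp]: "X \<in> Ob R \<Longrightarrow> is_initial R Z \<Longrightarrow> is_initial R (X \<odot> Z)"
    and right_initial [simp]: "X \<in> Ob R \<Longrightarrow> is_initial R Z \<Longrightarrow> is_initial R (Z \<odot> X)"

context symmetric_monoidal_category
begin

text \<open>Like \<open>reassoc\<close>, a transformer of equations: a rule for a composite becomes
  the rule for the composite tensored with an identity.\<close>

lemma tensor_right_eq: "\<lbrakk>g \<cdot> f = h; f \<in> Ar R; g \<in> Ar R; Dom R g = Cod R f; A \<in> Ob R\<rbrakk> \<Longrightarrow>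
    (g \<otimes> Id R A) \<cdot> (f \<otimes> Id R A) = h \<otimes> Id R A"
  and tensor_left_eq: "\<lbrakk>g \<cdot> f = h; f \<in> Ar R; g \<in> Ar R; Dom R g = Cod R f; A \<in> Ob R\<rbrakk> \<Longrightarrow>
    (Id R A \<otimes> g) \<cdot> (Id R A \<otimes> f) = Id R A \<otimes> h"
  by (auto simp: interchange)

lemma tensor_right_eq3: "\<lbrakk>g \<cdot> (f \<cdot> e) = h; e \<in> Ar R; f \<in> Ar R; g \<in> Ar R; Dom R g = Cod R f;
    Dom R f = Cod R e; A \<in> Ob R\<rbrakk> \<Longrightarrow>
    (g \<otimes> Id R A) \<cdot> ((f \<otimes> Id R A) \<cdot> (e \<otimes> Id R A)) = h \<otimes> Id R A"
  and tensor_left_eq3: "\<lbrakk>g \<cdot> (f \<cdot> e) = h; e \<in> Ar R; f \<in> Ar R; g \<in> Ar R; Dom R g = Cod R f;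
    Dom R f = Cod R e; A \<in> Ob R\<rbrakk> \<Longrightarrow>
    (Id R A \<otimes> g) \<cdot> ((Id R A \<otimes> f) \<cdot> (Id R A \<otimes> e)) = Id R A \<otimes> h"
  by (auto simp: interchange)

end

context distributive_category
begin

text \<open>The source of the associator of \<open>dual_rig\<close> has a sum as left tensor factor,
  which is why \<open>distributor\<close> is inverted there. Its target has a sum as right tensor
  factor, so the inverse of the associator needs this mirror image.\<close>

definition left_distributor where
  "left_distributor Z A B = copair R (Id R Z \<otimes> inj1 R A B) (Id R Z \<otimes> inj2 R A B)"

context
  fixes A B Z assumes ob: "A \<in> Ob R" "B \<in> Ob R" "Z \<in> Ob R"
begin

lemma distributor_Ar [simp]: "distributor R A B Z \<in> Ar R"
  and Dom_distributor [simp]: "Dom R (distributor R A B Z) = coprod R (A \<odot> Z) (B \<odot> Z)"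
  and Cod_distributor [simp]: "Cod R (distributor R A B Z) = coprod R A B \<odot> Z"
  and distributor_iso [simp]: "iso (distributor R A B Z)"
  using coproduct_copair_iso[OF right_coproduct[OF ob(3) coprod[OF ob(1,2)]]] ob
  unfolding distributor_def by auto

lemma inv_distributor_inj1 [simp]: "inv_arrow R (distributor R A B Z) \<cdot> (inj1 R A B \<otimes> Id R Z) = inj1 R (A \<odot> Z) (B \<odot> Z)"
  and inv_distributor_inj2 [simp]: "inv_arrow R (distributor R A B Z) \<cdot> (inj2 R A B \<otimes> Id R Z) = inj2 R (A \<odot> Z) (B \<odot> Z)"
  by (rule iso_mono[where e = "distributor R A B Z"]; simp add: ob; simp add: distributor_def ob)+

lemma left_distributor_Ar [simp]: "left_distributor Z A B \<in> Ar R"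
  and Dom_left_distributor [simp]: "Dom R (left_distributor Z A B) = coprod R (Z \<odot> A) (Z \<odot> B)"
  and Cod_left_distributor [simp]: "Cod R (left_distributor Z A B) = Z \<odot> coprod R A B"
  and left_distributor_iso [simp]: "iso (left_distributor Z A B)"
  using coproduct_copair_iso[OF left_coproduct[OF ob(3) coprod[OF ob(1,2)]]] ob
  unfolding left_distributor_def by auto

lemma inv_left_distributor_inj1 [simp]: "inv_arrow R (left_distributor Z A B) \<cdot> (Id R Z \<otimes> inj1 R A B) = inj1 R (Z \<odot> A) (Z \<odot> B)"
  and inv_left_distributor_inj2 [simp]: "inv_arrow R (left_distributor Z A B) \<cdot> (Id R Z \<otimes> inj2 R A B) = inj2 R (Z \<odot> A) (Z \<odot> B)"
  by (rule iso_mono[where e = "left_distributor Z A B"]; simp add: ob; simp add: left_distributor_def ob)+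

end

lemmas inv_distributor_inj' [simp] = inv_distributor_inj1[THEN reassoc] inv_distributor_inj2[THEN reassoc]
  inv_left_distributor_inj1[THEN reassoc] inv_left_distributor_inj2[THEN reassoc]

lemmas coprod_right_eq = coproduct_eq[OF right_coproduct[OF _ coprod[of A B]], of Z] for A B Z
lemmas coprod_left_eq = coproduct_eq[OF left_coproduct[OF _ coprod[of A B]], of Z] for Z A B
lemmas coprod_right_right_eq = coproduct_eq[OF right_coproduct[OF _ right_coproduct[OF _ coprod[of A B]]], of W Z] for A B Z W

lemma coprod_arrow_tensor_inj:
  assumes "f \<in> Ar R" "g \<in> Ar R" "h \<in> Ar R" "Dom R f = A" "Dom R g = B" "Dom R h = Z"
  shows "(coprod_arrow R f g \<otimes> h) \<cdot> (inj1 R A B \<otimes> Id R Z) = (inj1 R (Cod R f) (Cod R g) \<otimes> Id R (Cod R h)) \<cdot> (f \<otimes> h)"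
    and "(coprod_arrow R f g \<otimes> h) \<cdot> (inj2 R A B \<otimes> Id R Z) = (inj2 R (Cod R f) (Cod R g) \<otimes> Id R (Cod R h)) \<cdot> (g \<otimes> h)"
    and "(h \<otimes> coprod_arrow R f g) \<cdot> (Id R Z \<otimes> inj1 R A B) = (Id R (Cod R h) \<otimes> inj1 R (Cod R f) (Cod R g)) \<cdot> (h \<otimes> f)"
    and "(h \<otimes> coprod_arrow R f g) \<cdot> (Id R Z \<otimes> inj2 R A B) = (Id R (Cod R h) \<otimes> inj2 R (Cod R f) (Cod R g)) \<cdot> (h \<otimes> g)"
  using assms by (auto simp: interchange)

lemmas coprod_arrow_tensor_inj' = coprod_arrow_tensor_inj[THEN reassoc]

section \<open>Structure maps of the dual numbers: the second components\<close>

definition assoc2 where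
  "assoc2 A M B N D P = snd (assoc (dual_rig R) (A, M) (B, N) (D, P))"

text \<open>The source is a sum of three triple products, in each of which exactly one factor
  (\<open>P\<close>, \<open>N\<close> or \<open>M\<close>) is a second component. Each summand is
  carried to its counterpart by an associator of \<open>R\<close>; the last three clauses record
  this and replace the nested \<open>copair\<close> in the calculations below.\<close>

lemma assoc2:
  assumes "A \<in> Ob R" "B \<in> Ob R" "D \<in> Ob R" "M \<in> Ob R" "N \<in> Ob R" "P \<in> Ob R"
  shows assoc2_Ar: "assoc2 A M B N D P \<in> Ar R"
    and Dom_assoc2: "Dom R (assoc2 A M B N D P) = coprod R ((A \<odot> B) \<odot> P) (coprod R (A \<odot> N) (M \<odot> B) \<odot> D)"
    and Cod_assoc2: "Cod R (assoc2 A M B N D P) = coprod R (A \<odot> coprod R (B \<odot> P) (N \<odot> D)) (M \<odot> (B \<odot> D))"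
    and assoc2_1: "assoc2 A M B N D P \<cdot> inj1 R ((A \<odot> B) \<odot> P) (coprod R (A \<odot> N) (M \<odot> B) \<odot> D) =
      inj1 R (A \<odot> coprod R (B \<odot> P) (N \<odot> D)) (M \<odot> (B \<odot> D)) \<cdot>
        ((Id R A \<otimes> inj1 R (B \<odot> P) (N \<odot> D)) \<cdot> assoc R A B P)"
    and assoc2_2: "assoc2 A M B N D P \<cdot> (inj2 R ((A \<odot> B) \<odot> P) (coprod R (A \<odot> N) (M \<odot> B) \<odot> D) \<cdot>
        (inj1 R (A \<odot> N) (M \<odot> B) \<otimes> Id R D)) =
      inj1 R (A \<odot> coprod R (B \<odot> P) (N \<odot> D)) (M \<odot> (B \<odot> D)) \<cdot>
        ((Id R A \<otimes> inj2 R (B \<odot> P) (N \<odot> D)) \<cdot> assoc R A N D)"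
    and assoc2_3: "assoc2 A M B N D P \<cdot> (inj2 R ((A \<odot> B) \<odot> P) (coprod R (A \<odot> N) (M \<odot> B) \<odot> D) \<cdot>
        (inj2 R (A \<odot> N) (M \<odot> B) \<otimes> Id R D)) =
      inj2 R (A \<odot> coprod R (B \<odot> P) (N \<odot> D)) (M \<odot> (B \<odot> D)) \<cdot> assoc R M B D"
  using assms by (simp_all add: assoc2_def dual_rig_def Let_def)

lemmas assoc2_simps = assoc2 assoc2_1[THEN reassoc] assoc2_2[THEN reassoc3] assoc2_3[THEN reassoc3]
lemmas assoc2_right0 = assoc2_1[THEN tensor_right_eq] assoc2_2[THEN tensor_right_eq3] assoc2_3[THEN tensor_right_eq3]
lemmas assoc2_left0 = assoc2_1[THEN tensor_left_eq] assoc2_2[THEN tensor_left_eq3] assoc2_3[THEN tensor_left_eq3]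
lemmas assoc2_right = assoc2_right0 assoc2_right0(1)[THEN reassoc] assoc2_right0(2,3)[THEN reassoc3]
lemmas assoc2_left = assoc2_left0 assoc2_left0(1)[THEN reassoc] assoc2_left0(2,3)[THEN reassoc3]

lemma assoc2_iso:
  assumes ob: "A \<in> Ob R" "B \<in> Ob R" "D \<in> Ob R" "M \<in> Ob R" "N \<in> Ob R" "P \<in> Ob R"
  shows "iso (assoc2 A M B N D P)"
proof -
  let ?L = "(A \<odot> B) \<odot> P" and ?C = "coprod R (A \<odot> N) (M \<odot> B)"
  let ?r = "inj2 R ?L (?C \<odot> D)"
  \<comment> \<open>\<open>?g\<close> undoes the associators summand by summand; the sum in the
    right tensor factor of the target must first be split by the inverse of the left
    distributor.\<close>
  let ?g = "copair R (copair R (inj1 R ?L (?C \<odot> D) \<cdot> inv_arrow R (assoc R A B P))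
      (?r \<cdot> ((inj1 R (A \<odot> N) (M \<odot> B) \<otimes> Id R D) \<cdot> inv_arrow R (assoc R A N D)))
      \<cdot> inv_arrow R (left_distributor A (B \<odot> P) (N \<odot> D)))
    (?r \<cdot> ((inj2 R (A \<odot> N) (M \<odot> B) \<otimes> Id R D) \<cdot> inv_arrow R (assoc R M B D)))"
  show ?thesis
  proof (rule isoI[where g = ?g])
    show "?g \<cdot> assoc2 A M B N D P = Id R (Dom R (assoc2 A M B N D P))"
      apply (rule coprod_eq[of _ ?L "?C \<odot> D"])
              apply (use ob in \<open>simp_all add: assoc2_simps\<close>)
      apply (rule coprod_right_eq[where A = "A \<odot> N" and B = "M \<odot> B"])
               apply (use ob in \<open>simp_all add: assoc2_simps\<close>)
      done
    show "assoc2 A M B N D P \<cdot> ?g = Id R (Cod R (assoc2 A M B N D P))"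
      apply (rule coprod_eq[of _ "A \<odot> coprod R (B \<odot> P) (N \<odot> D)" "M \<odot> (B \<odot> D)"])
              apply (use ob in \<open>simp_all add: assoc2_simps\<close>)
      apply (rule coprod_left_eq[where A = "B \<odot> P" and B = "N \<odot> D"])
               apply (use ob in \<open>simp_all add: assoc2_simps\<close>)
      done
  qed (use ob in \<open>simp_all add: assoc2_simps\<close>)
qed

lemma assoc2_natural:
  assumes "f \<in> Ar R" "m \<in> Ar R" "g \<in> Ar R" "n \<in> Ar R" "h \<in> Ar R" "p \<in> Ar R"
  shows "assoc2 (Cod R f) (Cod R m) (Cod R g) (Cod R n) (Cod R h) (Cod R p) \<cdot>
      coprod_arrow R ((f \<otimes> g) \<otimes> p) (coprod_arrow R (f \<otimes> n) (m \<otimes> g) \<otimes> h) =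
    coprod_arrow R (f \<otimes> coprod_arrow R (g \<otimes> p) (n \<otimes> h)) (m \<otimes> (g \<otimes> h)) \<cdot>
      assoc2 (Dom R f) (Dom R m) (Dom R g) (Dom R n) (Dom R h) (Dom R p)"
  apply (rule coprod_eq[of _ "(Dom R f \<odot> Dom R g) \<odot> Dom R p" "coprod R (Dom R f \<odot> Dom R n) (Dom R m \<odot> Dom R g) \<odot> Dom R h"])
          apply (use assms in \<open>simp_all add: assoc2_simps coprod_arrow_tensor_inj coprod_arrow_tensor_inj' assoc_nat assoc_nat'\<close>)
  apply (rule coprod_right_eq[where A = "Dom R f \<odot> Dom R n" and B = "Dom R m \<odot> Dom R g"])
           apply (use assms in \<open>simp_all add: assoc2_simps coprod_arrow_tensor_inj coprod_arrow_tensor_inj' assoc_nat assoc_nat'\<close>)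
  done

lemmas pentagon_simps = assoc2_simps assoc2_left assoc2_right whisker_left whisker_right
  assoc_nat assoc_nat' assoc_nat_Id assoc_nat_Id' pentagon_eq

text \<open>The source is a sum of four quadruple products, in which the second component is the
  last, third, second or first factor. On each of them both sides reduce to the pentagon of
  \<open>R\<close>; the summands are reached by splitting a sum three times, each time under one
  more tensor factor.\<close>

lemma assoc2_pentagon:
  assumes "A \<in> Ob R" "B \<in> Ob R" "D \<in> Ob R" "E \<in> Ob R" "M \<in> Ob R" "N \<in> Ob R" "P \<in> Ob R" "Q \<in> Ob R"
  shows "assoc2 A M B N (D \<odot> E) (coprod R (D \<odot> Q) (P \<odot> E)) \<cdot>
      assoc2 (A \<odot> B) (coprod R (A \<odot> N) (M \<odot> B)) D P E Q =
    coprod_arrow R (Id R A \<otimes> assoc2 B N D P E Q) (Id R M \<otimes> assoc R B D E) \<cdot>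
     (assoc2 A M (B \<odot> D) (coprod R (B \<odot> P) (N \<odot> D)) E Q \<cdot>
      coprod_arrow R (assoc R A B D \<otimes> Id R Q) (assoc2 A M B N D P \<otimes> Id R E))"
  apply (rule coprod_eq[of _ "((A \<odot> B) \<odot> D) \<odot> Q" "coprod R ((A \<odot> B) \<odot> P) (coprod R (A \<odot> N) (M \<odot> B) \<odot> D) \<odot> E"])
          apply (use assms in \<open>simp_all add: pentagon_simps\<close>)
  apply (rule coprod_right_eq[where A = "(A \<odot> B) \<odot> P" and B = "coprod R (A \<odot> N) (M \<odot> B) \<odot> D"])
           apply (use assms in \<open>simp_all add: pentagon_simps\<close>)
  apply (rule coprod_right_right_eq[where A = "A \<odot> N" and B = "M \<odot> B"])
            apply (use assms in \<open>simp_all add: pentagon_simps\<close>)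
  done

definition braid2 where
  "braid2 A M B N = snd (braid (dual_rig R) (A, M) (B, N))"

definition lunit2 where
  "lunit2 A M = snd (lunit (dual_rig R) (A, M))"

definition runit2 where
  "runit2 A M = snd (runit (dual_rig R) (A, M))"

lemma braid2:
  assumes "A \<in> Ob R" "B \<in> Ob R" "M \<in> Ob R" "N \<in> Ob R"
  shows "braid2 A M B N \<in> Ar R"
    and "Dom R (braid2 A M B N) = coprod R (A \<odot> N) (M \<odot> B)"
    and "Cod R (braid2 A M B N) = coprod R (B \<odot> M) (N \<odot> A)"
    and braid2_1: "braid2 A M B N \<cdot> inj1 R (A \<odot> N) (M \<odot> B) = inj2 R (B \<odot> M) (N \<odot> A) \<cdot> braid R A N"
    and braid2_2: "braid2 A M B N \<cdot> inj2 R (A \<odot> N) (M \<odot> B) = inj1 R (B \<odot> M) (N \<odot> A) \<cdot> braid R M B"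
  using assms by (simp_all add: braid2_def dual_rig_def)

lemmas braid2_simps = braid2 braid2_1[THEN reassoc] braid2_2[THEN reassoc]
lemmas braid2_tensor0 = braid2_1[THEN tensor_right_eq] braid2_2[THEN tensor_right_eq]
  braid2_1[THEN tensor_left_eq] braid2_2[THEN tensor_left_eq]
lemmas braid2_tensor = braid2_tensor0 braid2_tensor0[THEN reassoc]

lemma lunit2:
  assumes "A \<in> Ob R" "M \<in> Ob R"
  shows "lunit2 A M \<in> Ar R"
    and "Dom R (lunit2 A M) = coprod R (\<one> \<odot> M) (initial_obj R \<odot> A)"
    and "Cod R (lunit2 A M) = M"
    and lunit2_1: "lunit2 A M \<cdot> inj1 R (\<one> \<odot> M) (initial_obj R \<odot> A) = lunit R M"
    and lunit2_2: "lunit2 A M \<cdot> inj2 R (\<one> \<odot> M) (initial_obj R \<odot> A) = from_initial R (initial_obj R \<odot> A) M"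
  using assms by (simp_all add: lunit2_def dual_rig_def)

lemma runit2:
  assumes "A \<in> Ob R" "M \<in> Ob R"
  shows "runit2 A M \<in> Ar R"
    and "Dom R (runit2 A M) = coprod R (A \<odot> initial_obj R) (M \<odot> \<one>)"
    and "Cod R (runit2 A M) = M"
    and runit2_1: "runit2 A M \<cdot> inj1 R (A \<odot> initial_obj R) (M \<odot> \<one>) = from_initial R (A \<odot> initial_obj R) M"
    and runit2_2: "runit2 A M \<cdot> inj2 R (A \<odot> initial_obj R) (M \<odot> \<one>) = runit R M"
  using assms by (simp_all add: runit2_def dual_rig_def)

lemmas unit2_simps = lunit2 runit2 lunit2_1[THEN reassoc] lunit2_2[THEN reassoc] runit2_1[THEN reassoc] runit2_2[THEN reassoc]
lemmas unit2_tensor0 = lunit2_1[THEN tensor_left_eq] runit2_2[THEN tensor_right_eq]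
lemmas unit2_tensor = unit2_tensor0 unit2_tensor0[THEN reassoc]

text \<open>The summand \<open>initial_obj R \<odot> A\<close> is initial, so the injection of the
  other summand is already invertible, and \<open>lunit R M\<close> does the rest.\<close>

lemma lunit2_iso:
  assumes "A \<in> Ob R" "M \<in> Ob R" shows "iso (lunit2 A M)"
proof (rule isoI[where g = "inj1 R (\<one> \<odot> M) (initial_obj R \<odot> A) \<cdot> inv_arrow R (lunit R M)"])
  show "inj1 R (\<one> \<odot> M) (initial_obj R \<odot> A) \<cdot> inv_arrow R (lunit R M) \<cdot> lunit2 A M = Id R (Dom R (lunit2 A M))"
    apply (rule coprod_eq[of _ "\<one> \<odot> M" "initial_obj R \<odot> A"])
            apply (use assms in \<open>simp_all add: unit2_simps\<close>)
    apply (rule initial_eq[of "initial_obj R \<odot> A"])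
    apply (use assms in simp_all)
    done
qed (use assms in \<open>simp_all add: unit2_simps\<close>)

lemma runit2_iso:
  assumes "A \<in> Ob R" "M \<in> Ob R" shows "iso (runit2 A M)"
proof (rule isoI[where g = "inj2 R (A \<odot> initial_obj R) (M \<odot> \<one>) \<cdot> inv_arrow R (runit R M)"])
  show "inj2 R (A \<odot> initial_obj R) (M \<odot> \<one>) \<cdot> inv_arrow R (runit R M) \<cdot> runit2 A M = Id R (Dom R (runit2 A M))"
    apply (rule coprod_eq[of _ "A \<odot> initial_obj R" "M \<odot> \<one>"])
            apply (use assms in \<open>simp_all add: unit2_simps\<close>)
    apply (rule initial_eq[of "A \<odot> initial_obj R"])
    apply (use assms in simp_all)
    done
qed (use assms in \<open>simp_all add: unit2_simps\<close>)

lemma lunit2_natural: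
  assumes "f \<in> Ar R" "m \<in> Ar R"
  shows "lunit2 (Cod R f) (Cod R m) \<cdot> coprod_arrow R (Id R \<one> \<otimes> m) (Id R (initial_obj R) \<otimes> f) =
    m \<cdot> lunit2 (Dom R f) (Dom R m)"
  apply (rule coprod_eq[of _ "\<one> \<odot> Dom R m" "initial_obj R \<odot> Dom R f"])
          apply (use assms in \<open>simp_all add: unit2_simps lunit_nat\<close>)
  apply (rule initial_eq[of "initial_obj R \<odot> Dom R f"])
       apply (use assms in simp_all)
  done

lemma runit2_natural:
  assumes "f \<in> Ar R" "m \<in> Ar R"
  shows "runit2 (Cod R f) (Cod R m) \<cdot> coprod_arrow R (f \<otimes> Id R (initial_obj R)) (m \<otimes> Id R \<one>) =
    m \<cdot> runit2 (Dom R f) (Dom R m)"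
  apply (rule coprod_eq[of _ "Dom R f \<odot> initial_obj R" "Dom R m \<odot> \<one>"])
          apply (use assms in \<open>simp_all add: unit2_simps runit_nat\<close>)
  apply (rule initial_eq[of "Dom R f \<odot> initial_obj R"])
       apply (use assms in simp_all)
  done

lemma braid2_natural:
  assumes "f \<in> Ar R" "m \<in> Ar R" "g \<in> Ar R" "n \<in> Ar R"
  shows "braid2 (Cod R f) (Cod R m) (Cod R g) (Cod R n) \<cdot> coprod_arrow R (f \<otimes> n) (m \<otimes> g) =
    coprod_arrow R (g \<otimes> m) (n \<otimes> f) \<cdot> braid2 (Dom R f) (Dom R m) (Dom R g) (Dom R n)"
  by (rule coprod_eq[of _ "Dom R f \<odot> Dom R n" "Dom R m \<odot> Dom R g"])
    (use assms in \<open>simp_all add: braid2_simps braid_nat braid_nat'\<close>)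

lemma braid2_braid2:
  assumes "A \<in> Ob R" "B \<in> Ob R" "M \<in> Ob R" "N \<in> Ob R"
  shows "braid2 B N A M \<cdot> braid2 A M B N = Id R (coprod R (A \<odot> N) (M \<odot> B))"
  by (rule coprod_eq[of _ "A \<odot> N" "M \<odot> B"]) (use assms in \<open>simp_all add: braid2_simps\<close>)

text \<open>Of the three summands the outer two give the triangle of \<open>R\<close>; the middle
  one, \<open>(A \<odot> initial_obj R) \<odot> B\<close>, is initial and carries at most one arrow
  to any object.\<close>

lemma triangle2:
  assumes "A \<in> Ob R" "B \<in> Ob R" "M \<in> Ob R" "N \<in> Ob R"
  shows "coprod_arrow R (Id R A \<otimes> lunit2 B N) (Id R M \<otimes> lunit R B) \<cdot> assoc2 A M \<one> (initial_obj R) B N =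
    coprod_arrow R (runit R A \<otimes> Id R N) (runit2 A M \<otimes> Id R B)"
  apply (rule coprod_eq[of _ "(A \<odot> \<one>) \<odot> N" "coprod R (A \<odot> initial_obj R) (M \<odot> \<one>) \<odot> B"])
          apply (use assms in \<open>simp_all add: assoc2_simps unit2_simps unit2_tensor triangle\<close>)
  apply (rule coprod_right_eq[where A = "A \<odot> initial_obj R" and B = "M \<odot> \<one>"])
           apply (use assms in \<open>simp_all add: assoc2_simps unit2_simps unit2_tensor triangle\<close>)
  apply (rule initial_eq[of "(A \<odot> initial_obj R) \<odot> B"])
       apply (use assms in \<open>simp_all add: assoc2_simps unit2_simps unit2_tensor triangle\<close>)
  done

text \<open>On each of the three summands of the source this is the hexagon of \<open>R\<close>,
  with one of the objects replaced by its second component.\<close>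

lemma hexagon2:
  assumes "A \<in> Ob R" "B \<in> Ob R" "D \<in> Ob R" "M \<in> Ob R" "N \<in> Ob R" "P \<in> Ob R"
  shows "assoc2 B N D P A M \<cdot> (braid2 A M (B \<odot> D) (coprod R (B \<odot> P) (N \<odot> D)) \<cdot> assoc2 A M B N D P) =
    coprod_arrow R (Id R B \<otimes> braid2 A M D P) (Id R N \<otimes> braid R A D) \<cdot>
      (assoc2 B N A M D P \<cdot> coprod_arrow R (braid R A B \<otimes> Id R P) (braid2 A M B N \<otimes> Id R D))"
  apply (rule coprod_eq[of _ "(A \<odot> B) \<odot> P" "coprod R (A \<odot> N) (M \<odot> B) \<odot> D"])
          apply (use assms in \<open>simp_all add: assoc2_simps braid2_simps braid2_tensor braid_nat braid_nat'
            whisker_left whisker_right hexagon_eq\<close>)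
  apply (rule coprod_right_eq[where A = "A \<odot> N" and B = "M \<odot> B"])
           apply (use assms in \<open>simp_all add: assoc2_simps braid2_simps braid2_tensor braid_nat braid_nat'
            whisker_left whisker_right hexagon_eq\<close>)
  done

end

lemma dual_rig_simps [simp]:
  "Ob (dual_rig R) = Ob R \<times> Ob R"
  "Ar (dual_rig R) = Ar R \<times> Ar R"
  "Dom (dual_rig R) (f, m) = (Dom R f, Dom R m)"
  "Cod (dual_rig R) (f, m) = (Cod R f, Cod R m)"
  "Id (dual_rig R) (A, M) = (Id R A, Id R M)"
  "Cmp (dual_rig R) (g, n) (f, m) = (g \<cdot>\<^bsub>R\<^esub> f, n \<cdot>\<^bsub>R\<^esub> m)"
  "TO (dual_rig R) (A, M) (B, N) = (A \<odot>\<^bsub>R\<^esub> B, coprod R (A \<odot>\<^bsub>R\<^esub> N) (M \<odot>\<^bsub>R\<^esub> B))"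
  "TA (dual_rig R) (f, m) (g, n) = (f \<otimes>\<^bsub>R\<^esub> g, coprod_arrow R (f \<otimes>\<^bsub>R\<^esub> n) (m \<otimes>\<^bsub>R\<^esub> g))"
  "Unit (dual_rig R) = (\<one>\<^bsub>R\<^esub>, initial_obj R)"
  by (simp_all add: dual_rig_def)

lemma hom_dual_rig: "(f, m) \<in> hom (dual_rig R) (A, M) (B, N) \<longleftrightarrow> f \<in> hom R A B \<and> m \<in> hom R M N"
  by (auto simp: hom_def)

context distributive_category
begin

lemma dual_rig_coherence [simp]:
  "assoc (dual_rig R) (A, M) (B, N) (D, P) = (assoc R A B D, assoc2 A M B N D P)"
  "braid (dual_rig R) (A, M) (B, N) = (braid R A B, braid2 A M B N)"
  "lunit (dual_rig R) (A, M) = (lunit R A, lunit2 A M)"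
  "runit (dual_rig R) (A, M) = (runit R A, runit2 A M)"
  by (simp_all add: assoc2_def braid2_def lunit2_def runit2_def)
     (simp_all add: dual_rig_def)

lemma inverse_arrows_dual_rig: "inverse_arrows (dual_rig R) (f, m) (g, n) \<longleftrightarrow>
    inverse_arrows R f g \<and> inverse_arrows R m n"
  by (auto simp: inverse_arrows_def hom_dual_rig)

lemma isos_dual_rig: "(f, m) \<in> isos (dual_rig R) (A, M) (B, N) \<longleftrightarrow> f \<in> isos R A B \<and> m \<in> isos R M N"
  by (auto simp: isos_def hom_dual_rig inverse_arrows_dual_rig)

lemma category_dual_rig: "category (dual_rig R)"
  by unfold_locales (auto simp: hom_def)

lemma symmetric_monoidal_dual_rig: "symmetric_monoidal_category (dual_rig R)"
proof -
  interpret E: category "dual_rig R" by (rule category_dual_rig)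
  show ?thesis
    \<comment> \<open>One goal for each axiom of \<open>symmetric_monoidal_category\<close>, in the
      order of the locale: the first component is the axiom of \<open>R\<close>, the second is
      covered by the lemmas on \<open>assoc2\<close>, \<open>lunit2\<close>, \<open>runit2\<close>
      and \<open>braid2\<close>.\<close>
    apply unfold_locales
                     apply (auto simp: hom_dual_rig)[1]
                    apply (auto simp: hom_dual_rig hom_def)[1]
                   apply (auto)[1]
                  apply (auto simp: hom_dual_rig hom_def coprod_arrow_Cmp[symmetric] interchange)[1]
                 apply (auto)[1]
                apply (auto simp: isos_dual_rig isos_iff assoc2_simps assoc2_iso)[1]
               apply (auto simp: hom_dual_rig hom_def assoc_nat assoc2_natural)[1]
              apply (auto simp: isos_dual_rig isos_iff unit2_simps lunit2_iso)[1]
             apply (auto simp: hom_dual_rig hom_def lunit_nat lunit2_natural)[1]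
            apply (auto simp: isos_dual_rig isos_iff unit2_simps runit2_iso)[1]
           apply (auto simp: hom_dual_rig hom_def runit_nat runit2_natural)[1]
          apply (auto simp: hom_dual_rig hom_def braid2_simps)[1]
         apply (auto simp: hom_dual_rig hom_def braid_nat braid2_natural)[1]
        apply (auto simp: braid2_braid2)[1]
       apply (auto simp: assoc2_pentagon pentagon_eq assoc2_simps)[1]
      apply (auto simp: triangle triangle2)[1]
     apply (auto simp: hexagon_eq hexagon2 assoc2_simps braid2_simps)[1]
    done
qed

end

section \<open>Functors and colimits\<close>

definition comp_functor where
  "comp_functor G F = \<lparr>FO = \<lambda>x. FO G (FO F x), FA = \<lambda>u. FA G (FA F u)\<rparr>"

lemma comp_functor_simps [simp]: "FO (comp_functor G F) x = FO G (FO F x)"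
  "FA (comp_functor G F) u = FA G (FA F u)"
  by (simp_all add: comp_functor_def)

lemma functor_Ob: "is_functor C C' F \<Longrightarrow> A \<in> Ob C \<Longrightarrow> FO F A \<in> Ob C'"
  by (simp add: is_functor_def)

lemma functor_hom: "is_functor C C' F \<Longrightarrow> f \<in> hom C A B \<Longrightarrow> FA F f \<in> hom C' (FO F A) (FO F B)"
  by (simp add: is_functor_def)

lemma functor_Id: "is_functor C C' F \<Longrightarrow> A \<in> Ob C \<Longrightarrow> FA F (Id C A) = Id C' (FO F A)"
  by (simp add: is_functor_def)

lemma functor_Cmp: "\<lbrakk>is_functor C C' F; f \<in> hom C A B; g \<in> hom C B D\<rbrakk> \<Longrightarrow>
    FA F (g \<cdot>\<^bsub>C\<^esub> f) = FA F g \<cdot>\<^bsub>C'\<^esub> FA F f"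
  by (simp add: is_functor_def)

lemma functor_comp: "is_functor C C' F \<Longrightarrow> is_functor C' C'' G \<Longrightarrow> is_functor C C'' (comp_functor G F)"
  unfolding is_functor_def comp_functor_simps by metis

lemma functor_cong: "FO F = FO G \<Longrightarrow> FA F = FA G \<Longrightarrow> is_functor C C' F \<longleftrightarrow> is_functor C C' G"
  by (simp add: is_functor_def)

lemma cocontinuous_iff: "cocontinuous \<A> C C' F \<longleftrightarrow> is_functor C C' F \<and>
     (\<forall>J\<in>\<A>. \<forall>D :: ('i, 'j, 'o, 'a) functor_data. \<forall>L c.
        is_functor J C D \<longrightarrow> is_colimit J C D L c \<longrightarrow>
        is_colimit J C' (comp_functor F D) (FO F L) (\<lambda>x. FA F (c x)))"
  for \<A> :: "('i, 'j) category set"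
  unfolding cocontinuous_def comp_functor_def by blast

lemma cocontinuous_colimit:
  fixes D :: "('i, 'j, 'o, 'a) functor_data"
  shows "\<lbrakk>cocontinuous \<A> C C' F; J \<in> \<A>; is_functor J C D; is_colimit J C D L c\<rbrakk> \<Longrightarrow>
    is_colimit J C' (comp_functor F D) (FO F L) (\<lambda>x. FA F (c x))"
  unfolding cocontinuous_iff by blast

lemma cocontinuous_functor: "cocontinuous \<A> C C' F \<Longrightarrow> is_functor C C' F"
  by (simp add: cocontinuous_def)

text \<open>Cocontinuity depends on \<open>FO\<close> and \<open>FA\<close> alone, so it passes
  between records with different further fields, such as monoidal or derivation data.\<close>

lemma cocontinuous_cong: "\<lbrakk>FO F = FO G; FA F = FA G; cocontinuous \<A> C C' F\<rbrakk> \<Longrightarrow> cocontinuous \<A> C C' G"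
  by (simp add: cocontinuous_def functor_cong[of F G])

lemma comp_functor_assoc: "comp_functor (comp_functor H G) F = comp_functor H (comp_functor G F)"
  by (simp add: comp_functor_def)

lemma cocontinuous_comp: "cocontinuous \<A> C C' F \<Longrightarrow> cocontinuous \<A> C' C'' G \<Longrightarrow>
    cocontinuous \<A> C C'' (comp_functor G F)"
  unfolding cocontinuous_iff comp_functor_assoc comp_functor_simps by (meson functor_comp)

lemma discrete_Ar:
  assumes "discrete_category J" "u \<in> Ar J" shows "Dom J u \<in> Ob J \<and> Cod J u = Dom J u \<and> u = Id J (Dom J u)"
proof -
  interpret J: category J using assms by (simp add: discrete_category_def)
  obtain x where "x \<in> Ob J" "u = Id J x" using assms by (auto simp: discrete_category_def)
  thus ?thesis by simp
qed

context category
begin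

lemma is_functorI:
  assumes "category B" "\<And>A. A \<in> Ob B \<Longrightarrow> FO F A \<in> Ob C"
    and "\<And>f. f \<in> Ar B \<Longrightarrow> FA F f \<in> hom C (FO F (Dom B f)) (FO F (Cod B f))"
    and "\<And>A. A \<in> Ob B \<Longrightarrow> FA F (Id B A) = Id C (FO F A)"
    and "\<And>f g. f \<in> Ar B \<Longrightarrow> g \<in> Ar B \<Longrightarrow> Dom B g = Cod B f \<Longrightarrow> FA F (g \<cdot>\<^bsub>B\<^esub> f) = FA F g \<cdot> FA F f"
  shows "is_functor B C F"
  using assms(2-) by (auto simp: is_functor_def hom_def)

lemma colimit_cocone_hom: "is_colimit J C D L c \<Longrightarrow> x \<in> Ob J \<Longrightarrow> c x \<in> hom C (FO D x) L"
  by (simp add: is_colimit_def is_cocone_def)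

lemma colimit_eq:
  assumes c: "is_colimit J C D L c" and D: "is_functor J C D" and J: "category J"
    and h: "h \<in> hom C L X" "k \<in> hom C L X" "\<And>x. x \<in> Ob J \<Longrightarrow> h \<cdot> c x = k \<cdot> c x"
  shows "h = k"
proof -
  interpret J: category J by fact
  have "is_cocone J C D X (\<lambda>x. k \<cdot> c x)"
    unfolding is_cocone_def
  proof (intro conjI ballI)
    fix x assume "x \<in> Ob J" thus "k \<cdot> c x \<in> hom C (FO D x) X"
      using colimit_cocone_hom[OF c, of x] h by (intro Cmp_hom)
  next
    fix u assume u: "u \<in> Ar J"
    have "c (Cod J u) \<cdot> FA D u = c (Dom J u)" using c u by (simp add: is_colimit_def is_cocone_def)
    thus "k \<cdot> c (Cod J u) \<cdot> FA D u = k \<cdot> c (Dom J u)"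
      using colimit_cocone_hom[OF c, of "Cod J u"] h functor_hom[OF D, of u "Dom J u" "Cod J u"] u
      by (simp add: hom_def)
  qed (use h in \<open>auto simp: hom_def\<close>)
  hence "\<exists>!m. m \<in> hom C L X \<and> (\<forall>x\<in>Ob J. m \<cdot> c x = k \<cdot> c x)"
    using c unfolding is_colimit_def by blast
  thus ?thesis using h by blast
qed

text \<open>Every arrow of a discrete shape is an identity, so the commutation condition of a cocone
  is automatic.\<close>

lemma discrete_cocone:
  assumes J: "discrete_category J" and D: "is_functor J C D"
  shows "is_cocone J C D L c \<longleftrightarrow> L \<in> Ob C \<and> (\<forall>x\<in>Ob J. c x \<in> hom C (FO D x) L)"
proof -
  have "c (Cod J u) \<cdot> FA D u = c (Dom J u)"
    if c: "\<forall>x\<in>Ob J. c x \<in> hom C (FO D x) L" and u: "u \<in> Ar J" for u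
  proof -
    from discrete_Ar[OF J u] have x: "Dom J u \<in> Ob J" "Cod J u = Dom J u" "u = Id J (Dom J u)" by auto
    have "FA D u = Id C (FO D (Dom J u))" using functor_Id[OF D x(1)] x(3) by simp
    thus ?thesis using c x(1,2) by (simp add: hom_def)
  qed
  thus ?thesis by (auto simp: is_cocone_def)
qed

lemma colimit_empty:
  assumes J: "discrete_category J" and D: "is_functor J C D" and "Ob J = {}"
  shows "is_colimit J C D L c \<longleftrightarrow> is_initial C L"
  using assms(3) by (simp add: is_colimit_def is_initial_def discrete_cocone[OF J D] Ball_def)

lemma colimit_pair:
  assumes J: "discrete_category J" and D: "is_functor J C D" and xy: "Ob J = {x, y}" "x \<noteq> y"
  shows "is_colimit J C D L c \<longleftrightarrow> is_coproduct C (FO D x) (FO D y) (L, c x, c y)"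
proof
  assume L: "is_colimit J C D L c"
  have "\<exists>!h. h \<in> hom C L X \<and> h \<cdot> c x = f \<and> h \<cdot> c y = g"
    if fg: "f \<in> hom C (FO D x) X" "g \<in> hom C (FO D y) X" for X f g
  proof -
    have "X \<in> Ob C" using fg by (auto simp: hom_def)
    hence "is_cocone J C D X (\<lambda>z. if z = x then f else g)"
      using fg xy by (simp add: discrete_cocone[OF J D])
    hence "\<exists>!h. h \<in> hom C L X \<and> (\<forall>z\<in>Ob J. h \<cdot> c z = (if z = x then f else g))"
      using L unfolding is_colimit_def by blast
    thus ?thesis using xy by auto
  qed
  thus "is_coproduct C (FO D x) (FO D y) (L, c x, c y)"
    using L xy by (simp add: is_coproduct_def is_colimit_def discrete_cocone[OF J D])
next
  assume L: "is_coproduct C (FO D x) (FO D y) (L, c x, c y)"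
  show "is_colimit J C D L c"
    unfolding is_colimit_def
  proof (intro conjI allI impI)
    fix X d assume "is_cocone J C D X d"
    hence "d x \<in> hom C (FO D x) X" "d y \<in> hom C (FO D y) X"
      using xy by (simp_all add: discrete_cocone[OF J D])
    hence "\<exists>!h. h \<in> hom C L X \<and> h \<cdot> c x = d x \<and> h \<cdot> c y = d y"
      using L unfolding is_coproduct_def by blast
    thus "\<exists>!h. h \<in> hom C L X \<and> (\<forall>z\<in>Ob J. h \<cdot> c z = d z)" using xy by simp
  qed (use L xy in \<open>simp add: is_coproduct_def discrete_cocone[OF J D]\<close>)
qed

lemma discrete_functor:
  assumes J: "discrete_category J" and "\<And>x. x \<in> Ob J \<Longrightarrow> B x \<in> Ob C"
  shows "is_functor J C \<lparr>FO = B, FA = \<lambda>u. Id C (B (Dom J u))\<rparr>"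
proof -
  interpret J: category J using J by (simp add: discrete_category_def)
  have *: "Cod J u = Dom J u" if "u \<in> Ar J" for u using discrete_Ar[OF J that] by simp
  show ?thesis by (rule is_functorI) (use assms J.category_axioms in \<open>auto simp: * hom_def\<close>)
qed

end

section \<open>Finite coproducts supplied by an additive doctrine\<close>

lemma doctrine_empty:
  assumes "additive_doctrine \<A>" obtains J where "J \<in> \<A>" "discrete_category J" "Ob J = {}"
proof -
  obtain J where "J \<in> \<A>" "discrete_category J" "finite (Ob J)" "card (Ob J) = 0"
    using assms unfolding additive_doctrine_def by blast
  thus thesis using that by auto
qed

lemma doctrine_pair:
  assumes "additive_doctrine \<A>" obtains J x y where "J \<in> \<A>" "discrete_category J" "Ob J = {x, y}" "x \<noteq> y"
proof -
  obtain J where "J \<in> \<A>" "discrete_category J" "finite (Ob J)" "card (Ob J) = 2"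
    using assms unfolding additive_doctrine_def by blast
  thus thesis using that by (auto simp: card_2_iff)
qed

lemma cocartesian_has_colimits:
  assumes \<A>: "additive_doctrine \<A>" and C: "category C" "has_colimits \<A> C"
  shows "cocartesian_category C"
proof -
  interpret category C by fact
  show ?thesis
  proof
    obtain J where J: "J \<in> \<A>" "discrete_category J" "Ob J = {}" by (rule doctrine_empty[OF \<A>])
    \<comment> \<open>The shape has neither objects nor arrows, so any values of the diagram will
      do.\<close>
    have D: "is_functor J C \<lparr>FO = \<lambda>_. undefined, FA = \<lambda>u. Id C undefined\<rparr>"
      using discrete_functor[OF J(2), of "\<lambda>_. undefined"] J(3) by simp
    then obtain L c where "is_colimit J C \<lparr>FO = \<lambda>_. undefined, FA = \<lambda>u. Id C undefined\<rparr> L c"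
      using C(2) J(1) unfolding has_colimits_def by blast
    thus "\<exists>Z. is_initial C Z" using colimit_empty[OF J(2) D J(3)] by auto
  next
    fix A B assume AB: "A \<in> Ob C" "B \<in> Ob C"
    obtain J x y where J: "J \<in> \<A>" "discrete_category J" "Ob J = {x, y}" "x \<noteq> y" by (rule doctrine_pair[OF \<A>])
    have D: "is_functor J C \<lparr>FO = \<lambda>z. if z = x then A else B, FA = \<lambda>u. Id C (if Dom J u = x then A else B)\<rparr>"
      using discrete_functor[OF J(2), of "\<lambda>z. if z = x then A else B"] AB by simp
    then obtain L c where "is_colimit J C \<lparr>FO = \<lambda>z. if z = x then A else B, FA = \<lambda>u. Id C (if Dom J u = x then A else B)\<rparr> L c"
      using C(2) J(1) unfolding has_colimits_def by blast
    thus "\<exists>p. is_coproduct C A B p" using colimit_pair[OF J(2) D J(3,4)] J(4) by auto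
  qed
qed

lemma cocontinuous_initial:
  assumes \<A>: "additive_doctrine \<A>" and C: "category C" "category C'" and F: "cocontinuous \<A> C C' F"
    and Z: "is_initial C Z"
  shows "is_initial C' (FO F Z)"
proof -
  interpret C: category C by fact
  interpret C': category C' by fact
  obtain J where J: "J \<in> \<A>" "discrete_category J" "Ob J = {}" by (rule doctrine_empty[OF \<A>])
  have D: "is_functor J C \<lparr>FO = \<lambda>_. undefined, FA = \<lambda>u. Id C undefined\<rparr>" (is "is_functor J C ?D")
    using C.discrete_functor[OF J(2), of "\<lambda>_. undefined"] J(3) by simp
  have "is_colimit J C ?D Z (\<lambda>_. undefined)" using C.colimit_empty[OF J(2) D J(3)] Z by simp
  from cocontinuous_colimit[OF F J(1) D this]
  show ?thesis
    using C'.colimit_empty[OF J(2) functor_comp[OF D cocontinuous_functor[OF F]] J(3)] by simp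
qed

lemma cocontinuous_coproduct:
  assumes \<A>: "additive_doctrine \<A>" and C: "category C" "category C'" and F: "cocontinuous \<A> C C' F"
    and P: "is_coproduct C A B (P, i, j)"
  shows "is_coproduct C' (FO F A) (FO F B) (FO F P, FA F i, FA F j)"
proof -
  interpret C: category C by fact
  interpret C': category C' by fact
  obtain J x y where J: "J \<in> \<A>" "discrete_category J" "Ob J = {x, y}" "x \<noteq> y" by (rule doctrine_pair[OF \<A>])
  have AB: "A \<in> Ob C" "B \<in> Ob C" using C.coproduct_Ar[OF P] by auto
  have D: "is_functor J C \<lparr>FO = \<lambda>z. if z = x then A else B, FA = \<lambda>u. Id C (if Dom J u = x then A else B)\<rparr>"
    (is "is_functor J C ?D")
    using C.discrete_functor[OF J(2), of "\<lambda>z. if z = x then A else B"] AB by simp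
  have "is_colimit J C ?D P (\<lambda>z. if z = x then i else j)"
    using C.colimit_pair[OF J(2) D J(3,4)] P J(4) by simp
  from cocontinuous_colimit[OF F J(1) D this]
  show ?thesis
    using C'.colimit_pair[OF J(2) functor_comp[OF D cocontinuous_functor[OF F]] J(3,4)] J(4) by simp
qed

lemma rig_symmetric_monoidal: "is_rig \<A> R \<Longrightarrow> symmetric_monoidal_category R"
  by (simp add: is_rig_def)

text \<open>Tensoring with a fixed object preserves the colimits of the doctrine, among whose shapes
  are discrete ones with no object and with two objects.\<close>

lemma rig_distributive:
  assumes \<A>: "additive_doctrine \<A>" and R: "is_rig \<A> R"
  shows "distributive_category R"
proof -
  interpret symmetric_monoidal_category R using R by (rule rig_symmetric_monoidal)
  interpret cocartesian_category R
    by (rule cocartesian_has_colimits[OF \<A>]) (use R category_axioms in \<open>auto simp: is_rig_def\<close>)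
  have l: "cocontinuous \<A> R R \<lparr>FO = \<lambda>A. X \<odot>\<^bsub>R\<^esub> A, FA = \<lambda>f. Id R X \<otimes>\<^bsub>R\<^esub> f\<rparr>"
    and r: "cocontinuous \<A> R R \<lparr>FO = \<lambda>A. A \<odot>\<^bsub>R\<^esub> X, FA = \<lambda>f. f \<otimes>\<^bsub>R\<^esub> Id R X\<rparr>" if "X \<in> Ob R" for X
    using R that by (simp_all add: is_rig_def)
  note co = cocontinuous_coproduct[OF \<A> category_axioms category_axioms]
  note i = cocontinuous_initial[OF \<A> category_axioms category_axioms]
  show ?thesis
    by unfold_locales (use co[OF l] co[OF r] i[OF l] i[OF r] in simp_all)
qed

section \<open>Dual numbers form a rig\<close>

definition fst_functor where
  "fst_functor F = \<lparr>FO = \<lambda>x. fst (FO F x), FA = \<lambda>u. fst (FA F u)\<rparr>"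

definition snd_functor where
  "snd_functor F = \<lparr>FO = \<lambda>x. snd (FO F x), FA = \<lambda>u. snd (FA F u)\<rparr>"

definition sum_functor where
  "sum_functor R F G = \<lparr>FO = \<lambda>x. coprod R (FO F x) (FO G x), FA = \<lambda>u. coprod_arrow R (FA F u) (FA G u)\<rparr>"

lemma component_functor_simps [simp]:
  "FO (fst_functor F) x = fst (FO F x)" "FA (fst_functor F) u = fst (FA F u)"
  "FO (snd_functor F) x = snd (FO F x)" "FA (snd_functor F) u = snd (FA F u)"
  by (simp_all add: fst_functor_def snd_functor_def)

lemma sum_functor_simps [simp]:
  "FO (sum_functor R F G) x = coprod R (FO F x) (FO G x)"
  "FA (sum_functor R F G) u = coprod_arrow R (FA F u) (FA G u)"
  by (simp_all add: sum_functor_def)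

lemma hom_dual_rig_iff: "f \<in> hom (dual_rig R) X Y \<longleftrightarrow> fst f \<in> hom R (fst X) (fst Y) \<and> snd f \<in> hom R (snd X) (snd Y)"
  by (cases f; cases X; cases Y) (simp add: hom_dual_rig)

lemma Cmp_dual_rig: "Cmp (dual_rig R) g f = (fst g \<cdot>\<^bsub>R\<^esub> fst f, snd g \<cdot>\<^bsub>R\<^esub> snd f)"
  by (cases f; cases g) simp

lemma Id_dual_rig: "Id (dual_rig R) X = (Id R (fst X), Id R (snd X))"
  by (cases X) simp

lemma functor_dual_rig: "is_functor C (dual_rig R) F \<longleftrightarrow> is_functor C R (fst_functor F) \<and> is_functor C R (snd_functor F)"
  by (auto simp: is_functor_def hom_dual_rig_iff Cmp_dual_rig Id_dual_rig mem_Times_iff prod_eq_iff)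

lemma cocone_dual_rig: "is_cocone J (dual_rig R) D L c \<longleftrightarrow>
    is_cocone J R (fst_functor D) (fst L) (\<lambda>x. fst (c x)) \<and> is_cocone J R (snd_functor D) (snd L) (\<lambda>x. snd (c x))"
  by (auto simp: is_cocone_def hom_dual_rig_iff Cmp_dual_rig mem_Times_iff prod_eq_iff)

lemma ex1_prod: "(\<exists>!p. P (fst p) \<and> Q (snd p)) \<longleftrightarrow> (\<exists>!a. P a) \<and> (\<exists>!b. Q b)"
  by (auto simp: Ex1_def prod_eq_iff)

text \<open>A cocone in a product category is a pair of independent cocones; this is the
  corresponding exchange of quantifiers.\<close>

lemma all_components:
  "(\<forall>X d. P (fst X) (\<lambda>x. fst (d x)) (snd X) (\<lambda>x. snd (d x))) \<longleftrightarrow> (\<forall>X d Y e. P X d Y e)"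
proof (intro iffI allI)
  fix X d Y e assume "\<forall>X d. P (fst X) (\<lambda>x. fst (d x)) (snd X) (\<lambda>x. snd (d x))"
  from this[rule_format, of "(X, Y)" "\<lambda>x. (d x, e x)"] show "P X d Y e" by simp
qed simp

lemma colimit_dual_rig:
  "is_colimit J (dual_rig R) D L c \<longleftrightarrow>
    is_colimit J R (fst_functor D) (fst L) (\<lambda>x. fst (c x)) \<and> is_colimit J R (snd_functor D) (snd L) (\<lambda>x. snd (c x))"
proof -
  let ?c = "\<lambda>D. is_cocone J R D" and ?u = "\<lambda>L c X d h. h \<in> hom R L X \<and> (\<forall>x\<in>Ob J. h \<cdot>\<^bsub>R\<^esub> c x = d x)"
  have 1: "(\<exists>!h. h \<in> hom (dual_rig R) L X \<and> (\<forall>x\<in>Ob J. Cmp (dual_rig R) h (c x) = d x)) \<longleftrightarrow>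
      (\<exists>!h. ?u (fst L) (\<lambda>x. fst (c x)) (fst X) (\<lambda>x. fst (d x)) h) \<and>
      (\<exists>!h. ?u (snd L) (\<lambda>x. snd (c x)) (snd X) (\<lambda>x. snd (d x)) h)" for X d
    unfolding ex1_prod[symmetric] hom_dual_rig_iff Cmp_dual_rig prod_eq_iff fst_conv snd_conv
    by (rule arg_cong[where f = Ex1]) blast
  show ?thesis
    unfolding is_colimit_def 1 cocone_dual_rig
      all_components[where P = "\<lambda>X d Y e. ?c (fst_functor D) X d \<and> ?c (snd_functor D) Y e \<longrightarrow>
        (\<exists>!h. ?u (fst L) (\<lambda>x. fst (c x)) X d h) \<and> (\<exists>!h. ?u (snd L) (\<lambda>x. snd (c x)) Y e h)"]
    \<comment> \<open>To extract the universal property of one component, the other component is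
      instantiated with its own colimit cocone, so that the joint premise holds.\<close>
    by blast
qed

lemma doctrine_category: "additive_doctrine \<A> \<Longrightarrow> J \<in> \<A> \<Longrightarrow> category J"
  by (simp add: additive_doctrine_def)

lemma component_comp_functor [simp]:
  "comp_functor (fst_functor F) D = fst_functor (comp_functor F D)"
  "comp_functor (snd_functor F) D = snd_functor (comp_functor F D)"
  by (simp_all add: comp_functor_def fst_functor_def snd_functor_def)

lemma cocontinuous_dual_rig: "cocontinuous \<A> C (dual_rig R) F \<longleftrightarrow>
    cocontinuous \<A> C R (fst_functor F) \<and> cocontinuous \<A> C R (snd_functor F)"
  unfolding cocontinuous_iff functor_dual_rig colimit_dual_rig by auto

definition fst_proj where "fst_proj = \<lparr>FO = fst, FA = fst\<rparr>"
definition snd_proj where "snd_proj = \<lparr>FO = snd, FA = snd\<rparr>"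

lemma proj_simps [simp]: "FO fst_proj = fst" "FA fst_proj = fst" "FO snd_proj = snd" "FA snd_proj = snd"
  by (simp_all add: fst_proj_def snd_proj_def)

lemma comp_proj [simp]: "comp_functor fst_proj D = fst_functor D" "comp_functor snd_proj D = snd_functor D"
  by (simp_all add: comp_functor_def fst_functor_def snd_functor_def fst_proj_def snd_proj_def)

lemma functor_proj: "is_functor (dual_rig R) R fst_proj" "is_functor (dual_rig R) R snd_proj"
  by (auto simp: is_functor_def hom_dual_rig)

lemma cocontinuous_proj: "cocontinuous \<A> (dual_rig R) R fst_proj" "cocontinuous \<A> (dual_rig R) R snd_proj"
  unfolding cocontinuous_iff by (auto simp del: split_paired_All simp: functor_proj colimit_dual_rig)

context cocartesian_category
begin

text \<open>Colimits commute with binary coproducts: restriction along the injections splits a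
  cocone under the pointwise sum into cocones under \<open>F\<close> and \<open>G\<close>. It is
  needed because the second component of the product of dual numbers is a sum of two
  functors.\<close>

lemma colimit_sum:
  assumes J: "category J" and D: "is_functor J B D" and F: "is_functor B C F" and G: "is_functor B C G"
    and c: "\<And>x. x \<in> Ob J \<Longrightarrow> c x \<in> hom B (FO D x) L"
    and cF: "is_colimit J C (comp_functor F D) (FO F L) (\<lambda>x. FA F (c x))"
    and cG: "is_colimit J C (comp_functor G D) (FO G L) (\<lambda>x. FA G (c x))"
  shows "is_colimit J C (comp_functor (sum_functor C F G) D) (FO (sum_functor C F G) L)
    (\<lambda>x. FA (sum_functor C F G) (c x))"
proof -
  interpret J: category J by fact
  have F1: "FA F (c x) \<in> Ar C" "Dom C (FA F (c x)) = FO F (FO D x)" "Cod C (FA F (c x)) = FO F L"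
    and G1: "FA G (c x) \<in> Ar C" "Dom C (FA G (c x)) = FO G (FO D x)" "Cod C (FA G (c x)) = FO G L"
    if "x \<in> Ob J" for x
    using functor_hom[OF F c[OF that]] functor_hom[OF G c[OF that]] by (simp_all add: hom_def)
  have F2: "FA F (FA D u) \<in> Ar C" "Dom C (FA F (FA D u)) = FO F (FO D (Dom J u))"
      "Cod C (FA F (FA D u)) = FO F (FO D (Cod J u))"
    and G2: "FA G (FA D u) \<in> Ar C" "Dom C (FA G (FA D u)) = FO G (FO D (Dom J u))"
      "Cod C (FA G (FA D u)) = FO G (FO D (Cod J u))"
    if u: "u \<in> Ar J" for u
    using functor_hom[OF F functor_hom[OF D, of u "Dom J u" "Cod J u"]]
      functor_hom[OF G functor_hom[OF D, of u "Dom J u" "Cod J u"]] u by (simp_all add: hom_def)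
  have L: "FO F L \<in> Ob C" "FO G L \<in> Ob C"
    using cF cG by (auto simp: is_colimit_def is_cocone_def)
  have ob: "FO F (FO D x) \<in> Ob C" "FO G (FO D x) \<in> Ob C" if "x \<in> Ob J" for x
    using functor_Ob[OF F] functor_Ob[OF G] functor_Ob[OF D that] by auto
  have n: "FA F (c (Cod J u)) \<cdot> FA F (FA D u) = FA F (c (Dom J u))"
    "FA G (c (Cod J u)) \<cdot> FA G (FA D u) = FA G (c (Dom J u))" if "u \<in> Ar J" for u
    using cF cG that by (simp_all add: is_colimit_def is_cocone_def)
  show ?thesis
    unfolding is_colimit_def
  proof (intro conjI allI impI)
    show "is_cocone J C (comp_functor (sum_functor C F G) D) (FO (sum_functor C F G) L)
        (\<lambda>x. FA (sum_functor C F G) (c x))"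
      unfolding is_cocone_def
      by (auto simp: L hom_def F1 G1 F2 G2 n coprod_arrow_Cmp[symmetric])
    fix X d assume d: "is_cocone J C (comp_functor (sum_functor C F G) D) X d"
    have d1: "d x \<in> Ar C" "Dom C (d x) = coprod C (FO F (FO D x)) (FO G (FO D x))" "Cod C (d x) = X"
      if "x \<in> Ob J" for x
      using d that by (auto simp: is_cocone_def hom_def)
    have d2: "d (Dom J u) = d (Cod J u) \<cdot> coprod_arrow C (FA F (FA D u)) (FA G (FA D u))"
      if "u \<in> Ar J" for u
      using d that by (auto simp: is_cocone_def hom_def)
    have X: "X \<in> Ob C" using d by (simp add: is_cocone_def)
    let ?dF = "\<lambda>x. d x \<cdot> inj1 C (FO F (FO D x)) (FO G (FO D x))"
    let ?dG = "\<lambda>x. d x \<cdot> inj2 C (FO F (FO D x)) (FO G (FO D x))"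
    have "is_cocone J C (comp_functor F D) X ?dF" "is_cocone J C (comp_functor G D) X ?dG"
      unfolding is_cocone_def by (auto simp: X hom_def d1 d2 F2 G2 ob)
    then obtain p q where p: "p \<in> hom C (FO F L) X" "\<forall>x\<in>Ob J. p \<cdot> FA F (c x) = ?dF x"
      and q: "q \<in> hom C (FO G L) X" "\<forall>x\<in>Ob J. q \<cdot> FA G (c x) = ?dG x"
      using cF cG unfolding is_colimit_def by meson
    note pq = p(1)[unfolded hom_def, simplified] q(1)[unfolded hom_def, simplified]
    show "\<exists>!h. h \<in> hom C (FO (sum_functor C F G) L) X \<and>
        (\<forall>x\<in>Ob J. h \<cdot> FA (sum_functor C F G) (c x) = d x)"
    proof (rule ex_ex1I)
      have "copair C p q \<cdot> coprod_arrow C (FA F (c x)) (FA G (c x)) = d x" if x: "x \<in> Ob J" for x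
        by (rule coprod_eq[of _ "FO F (FO D x)" "FO G (FO D x)"])
          (use x p(2) q(2) pq in \<open>simp_all add: F1 G1 ob d1\<close>)
      moreover have "copair C p q \<in> hom C (coprod C (FO F L) (FO G L)) X"
        using pq by (auto simp: hom_def)
      ultimately show "\<exists>h. h \<in> hom C (FO (sum_functor C F G) L) X \<and>
          (\<forall>x\<in>Ob J. h \<cdot> FA (sum_functor C F G) (c x) = d x)" by auto
    next
      fix h k
      assume h: "h \<in> hom C (FO (sum_functor C F G) L) X \<and> (\<forall>x\<in>Ob J. h \<cdot> FA (sum_functor C F G) (c x) = d x)"
      assume k: "k \<in> hom C (FO (sum_functor C F G) L) X \<and> (\<forall>x\<in>Ob J. k \<cdot> FA (sum_functor C F G) (c x) = d x)"
      have hk: "h \<in> Ar C" "Dom C h = coprod C (FO F L) (FO G L)" "Cod C h = X"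
        "k \<in> Ar C" "Dom C k = coprod C (FO F L) (FO G L)" "Cod C k = X"
        using h k by (auto simp: hom_def)
      have e: "h \<cdot> (coprod_arrow C (FA F (c x)) (FA G (c x))) = k \<cdot> (coprod_arrow C (FA F (c x)) (FA G (c x)))"
        if "x \<in> Ob J" for x using h k that by simp
      \<comment> \<open>Precomposing with the injections separates the equation on sums into one for
        \<open>F\<close> and one for \<open>G\<close>; arrows out of each of the two colimits are
        then compared separately.\<close>
      have e1: "h \<cdot> (inj1 C (FO F L) (FO G L) \<cdot> FA F (c x)) = k \<cdot> (inj1 C (FO F L) (FO G L) \<cdot> FA F (c x))"
        and e2: "h \<cdot> (inj2 C (FO F L) (FO G L) \<cdot> FA G (c x)) = k \<cdot> (inj2 C (FO F L) (FO G L) \<cdot> FA G (c x))"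
        if x: "x \<in> Ob J" for x
        using arg_cong[OF e[OF x], of "\<lambda>m. m \<cdot> inj1 C (FO F (FO D x)) (FO G (FO D x))"]
          arg_cong[OF e[OF x], of "\<lambda>m. m \<cdot> inj2 C (FO F (FO D x)) (FO G (FO D x))"] x
        by (simp_all add: F1 G1 ob hk L)
      show "h = k"
      proof (rule coprod_eq[of _ "FO F L" "FO G L"])
        show "h \<cdot> inj1 C (FO F L) (FO G L) = k \<cdot> inj1 C (FO F L) (FO G L)"
          by (rule colimit_eq[OF cF functor_comp[OF D F] J, where X = X])
            (auto simp: hom_def hk L F1 e1)
        show "h \<cdot> inj2 C (FO F L) (FO G L) = k \<cdot> inj2 C (FO F L) (FO G L)"
          by (rule colimit_eq[OF cG functor_comp[OF D G] J, where X = X])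
            (auto simp: hom_def hk L G1 e2)
      qed (auto simp: hk L)
    qed
  qed
qed

lemma functor_sum:
  assumes "category B" and F: "is_functor B C F" and G: "is_functor B C G"
  shows "is_functor B C (sum_functor C F G)"
proof (rule is_functorI)
  interpret B: category B by fact
  have F1: "FA F u \<in> Ar C" "Dom C (FA F u) = FO F (Dom B u)" "Cod C (FA F u) = FO F (Cod B u)"
    and G1: "FA G u \<in> Ar C" "Dom C (FA G u) = FO G (Dom B u)" "Cod C (FA G u) = FO G (Cod B u)"
    if "u \<in> Ar B" for u
    using functor_hom[OF F, of u "Dom B u" "Cod B u"] functor_hom[OF G, of u "Dom B u" "Cod B u"] that
    by (simp_all add: hom_def)
  show "FA (sum_functor C F G) f \<in> hom C (FO (sum_functor C F G) (Dom B f)) (FO (sum_functor C F G) (Cod B f))"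
    if "f \<in> Ar B" for f using that by (simp add: hom_def F1 G1)
  show "FA (sum_functor C F G) (Cmp B g f) = FA (sum_functor C F G) g \<cdot> FA (sum_functor C F G) f"
    if "f \<in> Ar B" "g \<in> Ar B" "Dom B g = Cod B f" for f g
    using that functor_Cmp[OF F, of f "Dom B f" "Cod B f" g] functor_Cmp[OF G, of f "Dom B f" "Cod B f" g]
    by (simp add: hom_def F1 G1 coprod_arrow_Cmp)
qed (use assms in \<open>auto simp: functor_Ob functor_Id\<close>)

lemma cocontinuous_sum:
  fixes \<A> :: "('i, 'j) category set" and B :: "('p, 'q, 'r) category_scheme"
  assumes \<A>: "additive_doctrine \<A>" and B: "category B" and F: "cocontinuous \<A> B C F" and G: "cocontinuous \<A> B C G"
  shows "cocontinuous \<A> B C (sum_functor C F G)"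
  unfolding cocontinuous_iff
proof (intro conjI ballI allI impI)
  show "is_functor B C (sum_functor C F G)"
    using B F G by (intro functor_sum cocontinuous_functor)
  fix J and D :: "('i, 'j, 'p, 'q) functor_data" and L c
  assume *: "J \<in> \<A>" "is_functor J B D" "is_colimit J B D L c"
  show "is_colimit J C (comp_functor (sum_functor C F G) D) (FO (sum_functor C F G) L)
      (\<lambda>x. FA (sum_functor C F G) (c x))"
    by (rule colimit_sum[OF doctrine_category[OF \<A> *(1)] *(2) cocontinuous_functor[OF F] cocontinuous_functor[OF G]
          category.colimit_cocone_hom[OF B *(3)] cocontinuous_colimit[OF F *] cocontinuous_colimit[OF G *]])
qed

end

lemma rig_dual_rig:
  fixes \<A> :: "('i, 'j) category set" and R :: "('o, 'a, 'm) monoidal_data_scheme"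
  assumes \<A>: "additive_doctrine \<A>" and R: "is_rig \<A> R"
  shows "is_rig \<A> (dual_rig R)"
proof -
  interpret distributive_category R by (rule rig_distributive[OF \<A> R])
  interpret E: symmetric_monoidal_category "dual_rig R" by (rule symmetric_monoidal_dual_rig)
  have l: "cocontinuous \<A> R R \<lparr>FO = \<lambda>A. X \<odot>\<^bsub>R\<^esub> A, FA = \<lambda>f. Id R X \<otimes>\<^bsub>R\<^esub> f\<rparr>"
    and r: "cocontinuous \<A> R R \<lparr>FO = \<lambda>A. A \<odot>\<^bsub>R\<^esub> X, FA = \<lambda>f. f \<otimes>\<^bsub>R\<^esub> Id R X\<rparr>" if "X \<in> Ob R" for X
    using R that by (simp_all add: is_rig_def)
  note l1 = cocontinuous_comp[OF cocontinuous_proj(1) l]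
  note l2 = cocontinuous_comp[OF cocontinuous_proj(2) l]
  note r1 = cocontinuous_comp[OF cocontinuous_proj(1) r]
  note r2 = cocontinuous_comp[OF cocontinuous_proj(2) r]
  note s = cocontinuous_sum[OF \<A> E.category_axioms]
  have "has_colimits \<A> (dual_rig R)"
    unfolding has_colimits_def
  proof (intro ballI allI impI)
    fix J and D :: "('i, 'j, 'o \<times> 'o, 'a \<times> 'a) functor_data"
    assume J: "J \<in> \<A>" and D: "is_functor J (dual_rig R) D"
    obtain L c M d where "is_colimit J R (fst_functor D) L c" "is_colimit J R (snd_functor D) M d"
      using R J D unfolding is_rig_def has_colimits_def functor_dual_rig by meson
    hence "is_colimit J (dual_rig R) D (L, M) (\<lambda>x. (c x, d x))"
      by (simp add: colimit_dual_rig)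
    thus "\<exists>L c. is_colimit J (dual_rig R) D L c" by blast
  qed
  moreover have "cocontinuous \<A> (dual_rig R) (dual_rig R)
      \<lparr>FO = \<lambda>Y. X \<odot>\<^bsub>dual_rig R\<^esub> Y, FA = \<lambda>f. Id (dual_rig R) X \<otimes>\<^bsub>dual_rig R\<^esub> f\<rparr>"
    and "cocontinuous \<A> (dual_rig R) (dual_rig R)
      \<lparr>FO = \<lambda>Y. Y \<odot>\<^bsub>dual_rig R\<^esub> X, FA = \<lambda>f. f \<otimes>\<^bsub>dual_rig R\<^esub> Id (dual_rig R) X\<rparr>"
    if ob: "X \<in> Ob (dual_rig R)" for X
  proof -
    obtain A M where X: "X = (A, M)" "A \<in> Ob R" "M \<in> Ob R" using ob by (cases X) auto
    show "cocontinuous \<A> (dual_rig R) (dual_rig R)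
      \<lparr>FO = \<lambda>Y. X \<odot>\<^bsub>dual_rig R\<^esub> Y, FA = \<lambda>f. Id (dual_rig R) X \<otimes>\<^bsub>dual_rig R\<^esub> f\<rparr>"
      \<comment> \<open>For \<open>X = (A, M)\<close> the second component of the product of
        \<open>X\<close> and \<open>Y\<close> is the sum of \<open>A \<odot> snd Y\<close> and
        \<open>M \<odot> fst Y\<close>: projections followed by tensoring in
        \<open>R\<close>.\<close>
      unfolding cocontinuous_dual_rig
      by (intro conjI cocontinuous_cong[OF _ _ l1[of A]] cocontinuous_cong[OF _ _ s[OF l2[of A] l1[of M]]])
        (auto simp: X fun_eq_iff)
    show "cocontinuous \<A> (dual_rig R) (dual_rig R)
      \<lparr>FO = \<lambda>Y. Y \<odot>\<^bsub>dual_rig R\<^esub> X, FA = \<lambda>f. f \<otimes>\<^bsub>dual_rig R\<^esub> Id (dual_rig R) X\<rparr>"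
      \<comment> \<open>With \<open>X\<close> on the right the summands are
        \<open>fst Y \<odot> M\<close> and \<open>snd Y \<odot> A\<close>, so the first projection
        now comes first.\<close>
      unfolding cocontinuous_dual_rig
      by (intro conjI cocontinuous_cong[OF _ _ r1[of A]] cocontinuous_cong[OF _ _ s[OF r1[of M] r2[of A]]])
        (auto simp: X fun_eq_iff)
  qed
  ultimately show ?thesis
    using E.symmetric_monoidal_category_axioms by (simp add: is_rig_def)
qed

section \<open>Transport of rigs along bijections\<close>

text \<open>In the locale \<open>transport\<close>, \<open>p\<close> and \<open>q\<close> are
  bijections of whole types, so the structure transported through \<open>inv p\<close> and
  \<open>inv q\<close> obeys the same laws without side conditions on carriers.\<close>

definition pull_rig :: "('o \<Rightarrow> 'p) \<Rightarrow> ('a \<Rightarrow> 'b) \<Rightarrow> ('p, 'b, 'm) monoidal_data_scheme \<Rightarrow> ('o, 'a) monoidal_data" where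
  "pull_rig p q R = \<lparr>
     Ob = p -` Ob R,
     Ar = q -` Ar R,
     Dom = \<lambda>f. inv p (Dom R (q f)),
     Cod = \<lambda>f. inv p (Cod R (q f)),
     Id = \<lambda>A. inv q (Id R (p A)),
     Cmp = \<lambda>g f. inv q (q g \<cdot>\<^bsub>R\<^esub> q f),
     TO = \<lambda>A B. inv p (p A \<odot>\<^bsub>R\<^esub> p B),
     TA = \<lambda>f g. inv q (q f \<otimes>\<^bsub>R\<^esub> q g),
     Unit = inv p \<one>\<^bsub>R\<^esub>,
     assoc = \<lambda>A B D. inv q (assoc R (p A) (p B) (p D)),
     lunit = \<lambda>A. inv q (lunit R (p A)),
     runit = \<lambda>A. inv q (runit R (p A)),
     braid = \<lambda>A B. inv q (braid R (p A) (p B)) \<rparr>"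

definition map_monoidal ::
  "('p \<Rightarrow> 'r) \<Rightarrow> ('b \<Rightarrow> 'c) \<Rightarrow> ('o, 'a, 'p, 'b, 'k) monoidal_functor_data_scheme \<Rightarrow> ('o, 'a, 'r, 'c) monoidal_functor_data" where
  "map_monoidal p q F = \<lparr>FO = \<lambda>A. p (FO F A), FA = \<lambda>f. q (FA F f), Mu = \<lambda>A B. q (Mu F A B), Eps = q (Eps F)\<rparr>"

lemma map_monoidal_simps [simp]:
  "FO (map_monoidal p q F) A = p (FO F A)" "FA (map_monoidal p q F) f = q (FA F f)"
  "Mu (map_monoidal p q F) A B = q (Mu F A B)" "Eps (map_monoidal p q F) = q (Eps F)"
  by (simp_all add: map_monoidal_def)

locale transport =
  fixes p :: "'o \<Rightarrow> 'p" and q :: "'a \<Rightarrow> 'b" and R :: "('p, 'b, 'm) monoidal_data_scheme"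
  assumes p: "bij p" and q: "bij q"
begin

abbreviation "R' \<equiv> pull_rig p q R"
abbreviation "out \<equiv> \<lparr>FO = p, FA = q\<rparr>"

lemma p_inv [simp]: "p (inv p x) = x" and q_inv [simp]: "q (inv q y) = y"
  using p q by (simp_all add: bij_is_surj surj_f_inv_f)

lemma inv_p_eq [simp]: "inv p x = y \<longleftrightarrow> x = p y"
  using p by (metis bij_inv_eq_iff)

text \<open>Unfolding this terminates because the two equations live at different types. It moves
  each law of \<open>R'\<close> to \<open>R\<close>, where \<open>pull_simps\<close> evaluates
  it.\<close>

lemma q_eq: "f = g \<longleftrightarrow> q f = q g"
  using q by (metis bij_is_inj injD)

lemma ex1_q: "(\<exists>!h. P (q h)) \<longleftrightarrow> (\<exists>!h. P h)"
  by (metis q_inv q_eq)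

lemma pull_Ob: "A \<in> Ob R' \<longleftrightarrow> p A \<in> Ob R"
  and pull_hom: "f \<in> hom R' A B \<longleftrightarrow> q f \<in> hom R (p A) (p B)"
  and pull_Ar: "f \<in> Ar R' \<longleftrightarrow> q f \<in> Ar R"
  and pull_Dom: "p (Dom R' f) = Dom R (q f)"
  and pull_Cod: "p (Cod R' f) = Cod R (q f)"
  and pull_Id: "q (Id R' A) = Id R (p A)"
  and pull_Cmp: "q (Cmp R' g f) = q g \<cdot>\<^bsub>R\<^esub> q f"
  and pull_TO: "p (TO R' A B) = p A \<odot>\<^bsub>R\<^esub> p B"
  and pull_TA: "q (TA R' f g) = q f \<otimes>\<^bsub>R\<^esub> q g"
  and pull_Unit: "p (Unit R') = \<one>\<^bsub>R\<^esub>"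
  and pull_assoc: "q (assoc R' A B D) = assoc R (p A) (p B) (p D)"
  and pull_lunit: "q (lunit R' A) = lunit R (p A)"
  and pull_runit: "q (runit R' A) = runit R (p A)"
  and pull_braid: "q (braid R' A B) = braid R (p A) (p B)"
  by (simp_all add: pull_rig_def hom_def)

lemma pull_inverse: "inverse_arrows R' f g \<longleftrightarrow> inverse_arrows R (q f) (q g)"
  by (simp add: inverse_arrows_def pull_hom pull_Dom pull_Cod q_eq[of "Cmp R' f' g'" for f' g'] pull_Cmp pull_Id)

lemma pull_isos: "f \<in> isos R' A B \<longleftrightarrow> q f \<in> isos R (p A) (p B)"
proof -
  have "(\<exists>g. inverse_arrows R' f g) \<longleftrightarrow> (\<exists>g. inverse_arrows R (q f) g)"
    unfolding pull_inverse by (metis q_inv)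
  thus ?thesis unfolding isos_def mem_Collect_eq pull_hom by blast
qed

lemmas pull_simps = pull_Ob pull_hom pull_Ar pull_Dom pull_Cod pull_Id pull_Cmp pull_TO pull_TA pull_Unit
  pull_assoc pull_lunit pull_runit pull_braid pull_isos

lemma symmetric_monoidal_pull:
  assumes "symmetric_monoidal_category R" shows "symmetric_monoidal_category R'"
proof -
  interpret R: symmetric_monoidal_category R by fact
  show ?thesis
    by unfold_locales
      ((unfold q_eq)?, (unfold pull_simps)?,
       (rule R.dom_Ob R.cod_Ob R.Id_hom R.Cmp_hom R.Cmp_Id_right R.Cmp_Id_left R.Cmp_assoc
         R.TO_Ob R.TA_hom R.TA_Id R.TA_Cmp R.Unit_Ob R.assoc_iso R.assoc_natural R.lunit_iso R.lunit_natural
         R.runit_iso R.runit_natural R.braid_hom R.braid_natural R.braid_braid R.pentagon R.triangle R.hexagon;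
        assumption))+
qed

lemma pull_functor: "is_functor C R' F \<longleftrightarrow> is_functor C R (comp_functor out F)"
  by (simp add: is_functor_def pull_simps q_eq)

lemma pull_cocone: "is_cocone J R' F L c \<longleftrightarrow> is_cocone J R (comp_functor out F) (p L) (\<lambda>x. q (c x))"
  by (simp add: is_cocone_def pull_simps q_eq)

lemma pull_colimit: "is_colimit J R' F L c \<longleftrightarrow> is_colimit J R (comp_functor out F) (p L) (\<lambda>x. q (c x))"
proof -
  have 1: "(\<exists>!h. h \<in> hom R' L X \<and> (\<forall>x\<in>Ob J. Cmp R' h (c x) = d x)) \<longleftrightarrow>
      (\<exists>!h. h \<in> hom R (p L) (p X) \<and> (\<forall>x\<in>Ob J. Cmp R h (q (c x)) = q (d x)))" for X d
    unfolding pull_hom q_eq pull_Cmp by (rule ex1_q)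
  have 2: "(\<forall>X d. P (p X) (\<lambda>x. q (d x))) \<longleftrightarrow> (\<forall>X d. P X d)" for P :: "'p \<Rightarrow> ('x \<Rightarrow> 'b) \<Rightarrow> bool"
  proof (intro iffI allI)
    fix X d assume "\<forall>X d. P (p X) (\<lambda>x. q (d x))"
    from this[rule_format, of "inv p X" "\<lambda>x. inv q (d x)"] show "P X d" by simp
  qed simp
  show ?thesis unfolding is_colimit_def pull_cocone 1
    using 2[of "\<lambda>X d. is_cocone J R (comp_functor out F) X d \<longrightarrow>
      (\<exists>!h. h \<in> hom R (p L) X \<and> (\<forall>x\<in>Ob J. Cmp R h (q (c x)) = d x))"] by simp
qed

lemma functor_out: "is_functor R' R out"
  by (simp add: is_functor_def pull_simps)

lemma cocontinuous_out: "cocontinuous \<A> R' R out"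
  unfolding cocontinuous_iff by (simp add: functor_out pull_colimit)

lemma cocontinuous_pull: "cocontinuous \<A> C R' F \<longleftrightarrow> cocontinuous \<A> C R (comp_functor out F)"
  unfolding cocontinuous_iff by (simp add: pull_functor pull_colimit comp_functor_assoc)

lemma rig_pull:
  fixes \<A> :: "('i, 'j) category set"
  assumes R: "is_rig \<A> R" shows "is_rig \<A> R'"
proof -
  have l: "cocontinuous \<A> R R \<lparr>FO = \<lambda>A. X \<odot>\<^bsub>R\<^esub> A, FA = \<lambda>f. Id R X \<otimes>\<^bsub>R\<^esub> f\<rparr>"
    and r: "cocontinuous \<A> R R \<lparr>FO = \<lambda>A. A \<odot>\<^bsub>R\<^esub> X, FA = \<lambda>f. f \<otimes>\<^bsub>R\<^esub> Id R X\<rparr>" if "X \<in> Ob R" for X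
    using R that by (simp_all add: is_rig_def)
  have c: "has_colimits \<A> R'"
    unfolding has_colimits_def
  proof (intro ballI allI impI)
    fix J and D :: "('i, 'j, 'o, 'a) functor_data"
    assume J: "J \<in> \<A>" and D: "is_functor J R' D"
    obtain L c where "is_colimit J R (comp_functor out D) L c"
      using R J D unfolding is_rig_def has_colimits_def pull_functor by meson
    hence "is_colimit J R' D (inv p L) (\<lambda>x. inv q (c x))" by (simp add: pull_colimit)
    thus "\<exists>L c. is_colimit J R' D L c" by blast
  qed
  have "cocontinuous \<A> R' R' \<lparr>FO = \<lambda>A. X \<odot>\<^bsub>R'\<^esub> A, FA = \<lambda>f. Id R' X \<otimes>\<^bsub>R'\<^esub> f\<rparr>"
    and "cocontinuous \<A> R' R' \<lparr>FO = \<lambda>A. A \<odot>\<^bsub>R'\<^esub> X, FA = \<lambda>f. f \<otimes>\<^bsub>R'\<^esub> Id R' X\<rparr>" if X: "X \<in> Ob R'" for X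
    unfolding cocontinuous_pull using X
    by (rule_tac [1] cocontinuous_cong[OF _ _ cocontinuous_comp[OF cocontinuous_out l[of "p X"]]],
        rule_tac [4] cocontinuous_cong[OF _ _ cocontinuous_comp[OF cocontinuous_out r[of "p X"]]])
      (simp_all add: fun_eq_iff pull_simps)
  thus ?thesis using R c symmetric_monoidal_pull by (simp add: is_rig_def)
qed

lemma rig_map_pull: "is_rig_map \<A> D R' F \<longleftrightarrow> is_rig_map \<A> D R (map_monoidal p q F)"
proof -
  have "cocontinuous \<A> D R' F \<longleftrightarrow> cocontinuous \<A> D R (map_monoidal p q F)"
    unfolding cocontinuous_pull
    by (rule iffI; erule cocontinuous_cong[rotated 2]) (simp_all add: fun_eq_iff)
  moreover have "strong_symmetric_monoidal D R' F \<longleftrightarrow> strong_symmetric_monoidal D R (map_monoidal p q F)"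
    by (simp add: strong_symmetric_monoidal_def is_functor_def pull_simps q_eq)
  ultimately show ?thesis by (simp add: is_rig_map_def)
qed

lemma isomorphic_pull: "isomorphic R' A B \<longleftrightarrow> isomorphic R (p A) (p B)"
proof
  assume "isomorphic R (p A) (p B)"
  then obtain f where "f \<in> isos R (p A) (p B)" by (auto simp: isomorphic_def)
  hence "inv q f \<in> isos R' A B" by (simp add: pull_isos)
  thus "isomorphic R' A B" by (auto simp: isomorphic_def)
qed (auto simp: isomorphic_def pull_isos)

end

text \<open>A naturality square evaluates a transformation at a domain and a codomain, where
  restriction to objects is invisible.\<close>

lemma (in category) ball_hom_restrict:
  "(\<forall>A B. \<forall>f\<in>hom C A B. P f (restrict \<eta> (Ob C) A) (restrict \<eta> (Ob C) B)) \<longleftrightarrow>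
    (\<forall>A B. \<forall>f\<in>hom C A B. P f (\<eta> A) (\<eta> B))"
  by (auto simp: hom_def)

context transport
begin

text \<open>\<open>q\<close> need not send \<open>undefined\<close> to \<open>undefined\<close>, so
  composing with it can destroy extensionality; hence the restrictions on both sides.\<close>

lemma transformation_pull:
  assumes D: "symmetric_monoidal_category D"
  shows "monoidal_transformation D R' F G (restrict \<theta> (Ob D)) \<longleftrightarrow>
    monoidal_transformation D R (map_monoidal p q F) (map_monoidal p q G) (restrict (\<lambda>A. q (\<theta> A)) (Ob D))"
proof -
  interpret D: symmetric_monoidal_category D by fact
  show ?thesis
    unfolding monoidal_transformation_def D.ball_hom_restrict[where \<eta> = \<theta> and P = "\<lambda>f x y. y \<cdot>\<^bsub>R'\<^esub> FA F f = FA G f \<cdot>\<^bsub>R'\<^esub> x"]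
      D.ball_hom_restrict[where P = "\<lambda>f x y. y \<cdot>\<^bsub>R\<^esub> FA (map_monoidal p q F) f = FA (map_monoidal p q G) f \<cdot>\<^bsub>R\<^esub> x"]
    by (simp add: pull_simps q_eq)
qed

end

text \<open>The universal property of a free rig extends to rigs over larger types, as long as these are
  in bijection with the types of the universe.\<close>

locale free_rig = transport p q R
  for p :: "'o \<Rightarrow> 'p" and q :: "'a \<Rightarrow> 'b" and R :: "('p, 'b, 'm) monoidal_data_scheme" +
  fixes \<A> :: "('i, 'j) category set" and D :: "('o, 'a) monoidal_data" and X :: "'x set" and \<eta> :: "'x \<Rightarrow> 'o"
  assumes free: "is_free_rig \<A> D X \<eta>" and R: "is_rig \<A> R"
begin

lemma symD: "symmetric_monoidal_category D"
  using free by (simp add: is_free_rig_def is_rig_def)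

lemma generator_Ob: "x \<in> X \<Longrightarrow> \<eta> x \<in> Ob D"
  using free by (simp add: is_free_rig_def)

lemma map_inv: "map_monoidal p q (map_monoidal (inv p) (inv q) F) = F"
  for F :: "('o, 'a, 'p, 'b) monoidal_functor_data"
  by (simp add: map_monoidal_def)

lemma universal_ex:
  fixes S :: "('o, 'a) monoidal_data"
  assumes S: "is_rig \<A> S" and B: "\<And>x. x \<in> X \<Longrightarrow> B x \<in> Ob S"
  obtains F :: "('o, 'a, 'o, 'a) monoidal_functor_data"
  where "is_rig_map \<A> D S F" "\<forall>x\<in>X. isomorphic S (FO F (\<eta> x)) (B x)"
proof -
  note free[unfolded is_free_rig_def, THEN conjunct2, THEN conjunct2, THEN spec[of _ S], THEN mp, OF S,
      THEN conjunct1, THEN spec[of _ B]]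
  thus thesis using B that by blast
qed

lemma ex_rig_map:
  assumes "\<And>x. x \<in> X \<Longrightarrow> B x \<in> Ob R"
  obtains F :: "('o, 'a, 'p, 'b) monoidal_functor_data"
  where "is_rig_map \<A> D R F" "\<forall>x\<in>X. isomorphic R (FO F (\<eta> x)) (B x)"
proof -
  have B: "\<And>x. x \<in> X \<Longrightarrow> inv p (B x) \<in> Ob R'" using assms by (simp add: pull_Ob)
  obtain F :: "('o, 'a, 'o, 'a) monoidal_functor_data"
    where "is_rig_map \<A> D R' F" "\<forall>x\<in>X. isomorphic R' (FO F (\<eta> x)) (inv p (B x))"
    by (rule universal_ex[OF rig_pull[OF R] B]) blast
  thus thesis using that[of "map_monoidal p q F"] by (simp add: rig_map_pull isomorphic_pull)
qed

lemma universal: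
  fixes S :: "('o, 'a) monoidal_data" and F G :: "('o, 'a, 'o, 'a) monoidal_functor_data"
  assumes "is_rig \<A> S" "is_rig_map \<A> D S F" "is_rig_map \<A> D S G" "\<And>x. x \<in> X \<Longrightarrow> f x \<in> hom S (FO F (\<eta> x)) (FO G (\<eta> x))"
  shows "\<exists>!\<theta>. monoidal_transformation D S F G \<theta> \<and> (\<forall>x\<in>X. \<theta> (\<eta> x) = f x)"
  by (rule free[unfolded is_free_rig_def, THEN conjunct2, THEN conjunct2, THEN spec[of _ S], THEN mp, OF assms(1),
      THEN conjunct2, THEN spec[of _ F], THEN spec[of _ G], THEN spec[of _ f], THEN mp]) (use assms in blast)

lemma pull_transformation_unique:
  fixes F G :: "('o, 'a, 'p, 'b) monoidal_functor_data"
  assumes "is_rig_map \<A> D R F" "is_rig_map \<A> D R G" "\<And>x. x \<in> X \<Longrightarrow> f x \<in> hom R (FO F (\<eta> x)) (FO G (\<eta> x))"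
  shows "\<exists>!\<theta>. monoidal_transformation D R' (map_monoidal (inv p) (inv q) F) (map_monoidal (inv p) (inv q) G) \<theta> \<and>
    (\<forall>x\<in>X. \<theta> (\<eta> x) = inv q (f x))"
  by (rule universal[OF rig_pull[OF R]]) (simp_all add: rig_map_pull map_inv pull_hom assms)

lemma ex_transformation:
  fixes F G :: "('o, 'a, 'p, 'b) monoidal_functor_data"
  assumes "is_rig_map \<A> D R F" "is_rig_map \<A> D R G" "\<And>x. x \<in> X \<Longrightarrow> f x \<in> hom R (FO F (\<eta> x)) (FO G (\<eta> x))"
  obtains \<theta> where "monoidal_transformation D R F G \<theta>" "\<And>x. x \<in> X \<Longrightarrow> \<theta> (\<eta> x) = f x"
proof -
  obtain \<theta> where \<theta>: "monoidal_transformation D R' (map_monoidal (inv p) (inv q) F) (map_monoidal (inv p) (inv q) G) \<theta>"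
    "\<forall>x\<in>X. \<theta> (\<eta> x) = inv q (f x)"
    using ex1_implies_ex[OF pull_transformation_unique[OF assms]] by blast
  have "restrict \<theta> (Ob D) = \<theta>"
    using \<theta>(1) unfolding monoidal_transformation_def by (blast intro: extensional_restrict)
  hence "monoidal_transformation D R F G (restrict (\<lambda>A. q (\<theta> A)) (Ob D))"
    using \<theta>(1) transformation_pull[OF symD, of "map_monoidal (inv p) (inv q) F" "map_monoidal (inv p) (inv q) G" \<theta>]
    by (simp add: map_inv)
  thus thesis using that \<theta>(2) by (simp add: generator_Ob)
qed

text \<open>After composition with \<open>inv q\<close> both transformations extend the same data on
  generators, so they coincide on the objects of \<open>D\<close>; outside these, both are
  \<open>undefined\<close> by extensionality.\<close>

lemma transformation_unique:
  fixes F G :: "('o, 'a, 'p, 'b) monoidal_functor_data"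
  assumes FG: "is_rig_map \<A> D R F" "is_rig_map \<A> D R G"
    and \<theta>: "monoidal_transformation D R F G \<theta>" and \<theta>': "monoidal_transformation D R F G \<theta>'"
    and eq: "\<And>x. x \<in> X \<Longrightarrow> \<theta> (\<eta> x) = \<theta>' (\<eta> x)"
  shows "\<theta> = \<theta>'"
proof -
  have *: "monoidal_transformation D R' (map_monoidal (inv p) (inv q) F) (map_monoidal (inv p) (inv q) G)
      (restrict (\<lambda>A. inv q (\<theta> A)) (Ob D))" if "monoidal_transformation D R F G \<theta>" for \<theta>
  proof -
    have "restrict \<theta> (Ob D) = \<theta>"
      using that unfolding monoidal_transformation_def by (blast intro: extensional_restrict)
    thus ?thesis using that by (simp add: transformation_pull[OF symD] map_inv)
  qed
  let ?t = "\<lambda>\<theta>. restrict (\<lambda>A. inv q (\<theta> A)) (Ob D)"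
  have "\<exists>!\<zeta>. monoidal_transformation D R' (map_monoidal (inv p) (inv q) F) (map_monoidal (inv p) (inv q) G) \<zeta> \<and>
      (\<forall>x\<in>X. \<zeta> (\<eta> x) = inv q (\<theta> (\<eta> x)))"
    by (rule pull_transformation_unique[OF FG])
      (use \<theta> generator_Ob in \<open>simp add: monoidal_transformation_def\<close>)
  then obtain \<zeta> where u: "\<And>y. monoidal_transformation D R' (map_monoidal (inv p) (inv q) F) (map_monoidal (inv p) (inv q) G) y \<Longrightarrow>
      (\<forall>x\<in>X. y (\<eta> x) = inv q (\<theta> (\<eta> x))) \<Longrightarrow> y = \<zeta>"
    by (elim ex1E) blast
  have "?t \<theta> = \<zeta>" by (rule u) (simp_all add: *[OF \<theta>] generator_Ob)
  moreover have "?t \<theta>' = \<zeta>" by (rule u) (simp_all add: *[OF \<theta>'] eq generator_Ob)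
  ultimately have "?t \<theta> = ?t \<theta>'" by simp
  hence "q (inv q (\<theta> A)) = q (inv q (\<theta>' A))" if "A \<in> Ob D" for A
    using that by (metis restrict_apply')
  thus ?thesis
    using \<theta> \<theta>' by (intro extensionalityI[of _ "Ob D"]) (auto simp: monoidal_transformation_def)
qed

end

section \<open>Derivations relative to a monoidal functor\<close>

locale monoidal_functor = D: symmetric_monoidal_category D + S: symmetric_monoidal_category S
  for D :: "('o, 'a, 'm) monoidal_data_scheme" and S :: "('p, 'b, 'n) monoidal_data_scheme" (structure) +
  fixes F :: "('o, 'a, 'p, 'b, 'k) monoidal_functor_data_scheme"
  assumes strong: "strong_symmetric_monoidal D S F"
begin

lemma F_functor: "is_functor D S F"
  using strong by (simp add: strong_symmetric_monoidal_def)

lemma F_Ob [simp]: "A \<in> Ob D \<Longrightarrow> FO F A \<in> Ob S"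
  by (rule functor_Ob[OF F_functor])

lemma F_Ar [simp]: "f \<in> Ar D \<Longrightarrow> FA F f \<in> Ar S"
  and Dom_F [simp]: "f \<in> Ar D \<Longrightarrow> Dom S (FA F f) = FO F (Dom D f)"
  and Cod_F [simp]: "f \<in> Ar D \<Longrightarrow> Cod S (FA F f) = FO F (Cod D f)"
  using functor_hom[OF F_functor, of f "Dom D f" "Cod D f"] by (simp_all add: hom_def)

lemma F_Id [simp]: "A \<in> Ob D \<Longrightarrow> FA F (Id D A) = Id S (FO F A)"
  by (rule functor_Id[OF F_functor])

lemma F_Cmp [simp]: "\<lbrakk>f \<in> Ar D; g \<in> Ar D; Dom D g = Cod D f\<rbrakk> \<Longrightarrow>
    FA F (g \<cdot>\<^bsub>D\<^esub> f) = FA F g \<cdot> FA F f"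
  using functor_Cmp[OF F_functor, of f "Dom D f" "Cod D f" g "Cod D g"] by (simp add: hom_def)

lemma iso_F [simp]: "D.iso f \<Longrightarrow> S.iso (FA F f)"
  by (rule S.isoI[where g = "FA F (inv_arrow D f)"])
    (auto simp: D.iso_Ar F_Cmp[symmetric] simp del: F_Cmp)

lemma Mu_isos: "A \<in> Ob D \<Longrightarrow> B \<in> Ob D \<Longrightarrow> Mu F A B \<in> isos S (FO F A \<odot> FO F B) (FO F (A \<odot>\<^bsub>D\<^esub> B))"
  using strong by (simp add: strong_symmetric_monoidal_def)

lemma iso_Mu [simp]: "A \<in> Ob D \<Longrightarrow> B \<in> Ob D \<Longrightarrow> S.iso (Mu F A B)"
  and Dom_Mu [simp]: "A \<in> Ob D \<Longrightarrow> B \<in> Ob D \<Longrightarrow> Dom S (Mu F A B) = FO F A \<odot> FO F B"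
  and Cod_Mu [simp]: "A \<in> Ob D \<Longrightarrow> B \<in> Ob D \<Longrightarrow> Cod S (Mu F A B) = FO F (A \<odot>\<^bsub>D\<^esub> B)"
  using Mu_isos[of A B] by (simp_all add: S.isos_iff)

lemma Mu_Ar [simp]: "A \<in> Ob D \<Longrightarrow> B \<in> Ob D \<Longrightarrow> Mu F A B \<in> Ar S"
  by (simp add: S.iso_Ar)

lemma iso_Eps [simp]: "S.iso (Eps F)"
  and Dom_Eps [simp]: "Dom S (Eps F) = \<one>"
  and Cod_Eps [simp]: "Cod S (Eps F) = FO F \<one>\<^bsub>D\<^esub>"
  using strong by (simp_all add: strong_symmetric_monoidal_def S.isos_iff)

lemma Eps_Ar [simp]: "Eps F \<in> Ar S"
  by (simp add: S.iso_Ar)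

lemma Mu_nat: "\<lbrakk>f \<in> Ar D; g \<in> Ar D; Dom D f = A; Dom D g = B\<rbrakk> \<Longrightarrow>
    FA F (f \<otimes>\<^bsub>D\<^esub> g) \<cdot> Mu F A B = Mu F (Cod D f) (Cod D g) \<cdot> (FA F f \<otimes> FA F g)"
  using strong by (auto simp: strong_symmetric_monoidal_def hom_def)

lemma F_assoc: "\<lbrakk>A \<in> Ob D; B \<in> Ob D; E \<in> Ob D\<rbrakk> \<Longrightarrow>
    FA F (assoc D A B E) \<cdot> (Mu F (A \<odot>\<^bsub>D\<^esub> B) E \<cdot> (Mu F A B \<otimes> Id S (FO F E))) =
    Mu F A (B \<odot>\<^bsub>D\<^esub> E) \<cdot> ((Id S (FO F A) \<otimes> Mu F B E) \<cdot> assoc S (FO F A) (FO F B) (FO F E))"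
  using strong by (simp add: strong_symmetric_monoidal_def)

lemma F_lunit: "A \<in> Ob D \<Longrightarrow>
    FA F (lunit D A) \<cdot> (Mu F \<one>\<^bsub>D\<^esub> A \<cdot> (Eps F \<otimes> Id S (FO F A))) = lunit S (FO F A)"
  and F_runit: "A \<in> Ob D \<Longrightarrow>
    FA F (runit D A) \<cdot> (Mu F A \<one>\<^bsub>D\<^esub> \<cdot> (Id S (FO F A) \<otimes> Eps F)) = runit S (FO F A)"
  using strong by (simp_all add: strong_symmetric_monoidal_def)

lemma F_braid: "A \<in> Ob D \<Longrightarrow> B \<in> Ob D \<Longrightarrow>
    FA F (braid D A B) \<cdot> Mu F A B = Mu F B A \<cdot> braid S (FO F A) (FO F B)"
  using strong by (simp add: strong_symmetric_monoidal_def)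

lemmas F_simps = Mu_nat F_assoc F_lunit F_runit F_braid
  Mu_nat[THEN S.reassoc] F_assoc[THEN S.reassoc3] F_lunit[THEN S.reassoc3] F_runit[THEN S.reassoc3] F_braid[THEN S.reassoc]

end

text \<open>The definition nests composites to the left and quantifies over homsets; the rule asks
  for the right-nested equations over \<open>Ar\<close>, \<open>Dom\<close> and \<open>Cod\<close>
  that the simplifier works with.\<close>

lemma (in symmetric_monoidal_category) strong_symmetric_monoidalI
  [case_names D F Mu Eps nat assoc lunit runit braid]:
  assumes D: "symmetric_monoidal_category D" and F: "is_functor D R F"
    and Mu: "\<And>A B. A \<in> Ob D \<Longrightarrow> B \<in> Ob D \<Longrightarrow> Mu F A B \<in> isos R (FO F A \<odot> FO F B) (FO F (A \<odot>\<^bsub>D\<^esub> B))"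
    and Eps: "Eps F \<in> isos R \<one> (FO F \<one>\<^bsub>D\<^esub>)"
    and nat: "\<And>f g. f \<in> Ar D \<Longrightarrow> g \<in> Ar D \<Longrightarrow>
      FA F (f \<otimes>\<^bsub>D\<^esub> g) \<cdot> Mu F (Dom D f) (Dom D g) = Mu F (Cod D f) (Cod D g) \<cdot> (FA F f \<otimes> FA F g)"
    and ass: "\<And>A B E. A \<in> Ob D \<Longrightarrow> B \<in> Ob D \<Longrightarrow> E \<in> Ob D \<Longrightarrow>
      FA F (assoc D A B E) \<cdot> (Mu F (A \<odot>\<^bsub>D\<^esub> B) E \<cdot> (Mu F A B \<otimes> Id R (FO F E))) =
      Mu F A (B \<odot>\<^bsub>D\<^esub> E) \<cdot> ((Id R (FO F A) \<otimes> Mu F B E) \<cdot> assoc R (FO F A) (FO F B) (FO F E))"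
    and lu: "\<And>A. A \<in> Ob D \<Longrightarrow> FA F (lunit D A) \<cdot> (Mu F \<one>\<^bsub>D\<^esub> A \<cdot> (Eps F \<otimes> Id R (FO F A))) = lunit R (FO F A)"
    and ru: "\<And>A. A \<in> Ob D \<Longrightarrow> FA F (runit D A) \<cdot> (Mu F A \<one>\<^bsub>D\<^esub> \<cdot> (Id R (FO F A) \<otimes> Eps F)) = runit R (FO F A)"
    and br: "\<And>A B. A \<in> Ob D \<Longrightarrow> B \<in> Ob D \<Longrightarrow>
      FA F (braid D A B) \<cdot> Mu F A B = Mu F B A \<cdot> braid R (FO F A) (FO F B)"
  shows "strong_symmetric_monoidal D R F"
proof -
  interpret D: symmetric_monoidal_category D by fact
  have F1: "FO F A \<in> Ob R" if "A \<in> Ob D" for A using functor_Ob[OF F that] .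
  have F2: "FA F f \<in> Ar R" "Dom R (FA F f) = FO F (Dom D f)" "Cod R (FA F f) = FO F (Cod D f)" if "f \<in> Ar D" for f
    using functor_hom[OF F, of f "Dom D f" "Cod D f"] that by (simp_all add: hom_def)
  have Mu': "iso (Mu F A B)" "Mu F A B \<in> Ar R" "Dom R (Mu F A B) = FO F A \<odot> FO F B" "Cod R (Mu F A B) = FO F (A \<odot>\<^bsub>D\<^esub> B)"
    if "A \<in> Ob D" "B \<in> Ob D" for A B using Mu[OF that] by (simp_all add: isos_iff iso_Ar)
  have Eps': "Eps F \<in> Ar R" "Dom R (Eps F) = \<one>" "Cod R (Eps F) = FO F \<one>\<^bsub>D\<^esub>"
    using Eps by (simp_all add: isos_iff iso_Ar)
  show ?thesis
    unfolding strong_symmetric_monoidal_def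
    using F Mu Eps nat ass lu ru br by (auto simp: F1 F2 Mu' Eps' hom_def)
qed

text \<open>The categorified analogue of a derivation along a ring homomorphism: objects of
  \<open>D\<close> act on \<open>S\<close> through \<open>F\<close>, and \<open>L\<close> and
  \<open>K\<close> are the strengths for this action. The equations are the second components of the
  monoidal functor axioms for \<open>(F, P)\<close> into \<open>dual_rig S\<close>, restricted to
  single summands; \<open>LK_iso\<close> and \<open>P_initial\<close> are the Leibniz rule for
  products and for the unit.\<close>

locale relative_derivation = monoidal_functor D S F + S: distributive_category S
  for D :: "('o, 'a, 'm) monoidal_data_scheme" and S :: "('p, 'b, 'n) monoidal_data_scheme" (structure)
  and F :: "('o, 'a, 'p, 'b, 'k) monoidal_functor_data_scheme" +
  fixes P :: "('o, 'a, 'p, 'b, 'l) functor_data_scheme" and L K :: "'o \<Rightarrow> 'o \<Rightarrow> 'b"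
  assumes P: "is_functor D S P"
    and L_hom: "A \<in> Ob D \<Longrightarrow> B \<in> Ob D \<Longrightarrow> L A B \<in> hom S (FO F A \<odot> FO P B) (FO P (A \<odot>\<^bsub>D\<^esub> B))"
    and K_hom: "A \<in> Ob D \<Longrightarrow> B \<in> Ob D \<Longrightarrow> K A B \<in> hom S (FO P A \<odot> FO F B) (FO P (A \<odot>\<^bsub>D\<^esub> B))"
    and L_nat: "\<lbrakk>f \<in> Ar D; g \<in> Ar D; Dom D f = A; Dom D g = B\<rbrakk> \<Longrightarrow>
      FA P (f \<otimes>\<^bsub>D\<^esub> g) \<cdot> L A B = L (Cod D f) (Cod D g) \<cdot> (FA F f \<otimes> FA P g)"
    and K_nat: "\<lbrakk>f \<in> Ar D; g \<in> Ar D; Dom D f = A; Dom D g = B\<rbrakk> \<Longrightarrow>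
      FA P (f \<otimes>\<^bsub>D\<^esub> g) \<cdot> K A B = K (Cod D f) (Cod D g) \<cdot> (FA P f \<otimes> FA F g)"
    and L_unit: "A \<in> Ob D \<Longrightarrow>
      FA P (lunit D A) \<cdot> (L \<one>\<^bsub>D\<^esub> A \<cdot> (Eps F \<otimes> Id S (FO P A))) = lunit S (FO P A)"
    and K_unit: "A \<in> Ob D \<Longrightarrow>
      FA P (runit D A) \<cdot> (K A \<one>\<^bsub>D\<^esub> \<cdot> (Id S (FO P A) \<otimes> Eps F)) = runit S (FO P A)"
    and LL_assoc: "\<lbrakk>A \<in> Ob D; B \<in> Ob D; E \<in> Ob D\<rbrakk> \<Longrightarrow>
      FA P (assoc D A B E) \<cdot> (L (A \<odot>\<^bsub>D\<^esub> B) E \<cdot> (Mu F A B \<otimes> Id S (FO P E))) =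
      L A (B \<odot>\<^bsub>D\<^esub> E) \<cdot> ((Id S (FO F A) \<otimes> L B E) \<cdot> assoc S (FO F A) (FO F B) (FO P E))"
    and LK_assoc: "\<lbrakk>A \<in> Ob D; B \<in> Ob D; E \<in> Ob D\<rbrakk> \<Longrightarrow>
      FA P (assoc D A B E) \<cdot> (K (A \<odot>\<^bsub>D\<^esub> B) E \<cdot> (L A B \<otimes> Id S (FO F E))) =
      L A (B \<odot>\<^bsub>D\<^esub> E) \<cdot> ((Id S (FO F A) \<otimes> K B E) \<cdot> assoc S (FO F A) (FO P B) (FO F E))"
    and KK_assoc: "\<lbrakk>A \<in> Ob D; B \<in> Ob D; E \<in> Ob D\<rbrakk> \<Longrightarrow>
      FA P (assoc D A B E) \<cdot> (K (A \<odot>\<^bsub>D\<^esub> B) E \<cdot> (K A B \<otimes> Id S (FO F E))) =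
      K A (B \<odot>\<^bsub>D\<^esub> E) \<cdot> ((Id S (FO P A) \<otimes> Mu F B E) \<cdot> assoc S (FO P A) (FO F B) (FO F E))"
    and L_braid: "A \<in> Ob D \<Longrightarrow> B \<in> Ob D \<Longrightarrow>
      FA P (braid D A B) \<cdot> L A B = K B A \<cdot> braid S (FO F A) (FO P B)"
    and LK_iso: "A \<in> Ob D \<Longrightarrow> B \<in> Ob D \<Longrightarrow> S.iso (copair S (L A B) (K A B))"
    and P_initial: "is_initial S (FO P \<one>\<^bsub>D\<^esub>)"

lemmas relative_derivationI [case_names D S strong distributive P L_hom K_hom L_nat K_nat L_unit K_unit
    LL_assoc LK_assoc KK_assoc L_braid LK_iso P_initial] =
  relative_derivation.intro[OF monoidal_functor.intro[OF _ _ monoidal_functor_axioms.intro] _ relative_derivation_axioms.intro]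

context relative_derivation
begin

lemma P_Ob [simp]: "A \<in> Ob D \<Longrightarrow> FO P A \<in> Ob S"
  by (rule functor_Ob[OF P])

lemma P_Ar [simp]: "f \<in> Ar D \<Longrightarrow> FA P f \<in> Ar S"
  and Dom_P [simp]: "f \<in> Ar D \<Longrightarrow> Dom S (FA P f) = FO P (Dom D f)"
  and Cod_P [simp]: "f \<in> Ar D \<Longrightarrow> Cod S (FA P f) = FO P (Cod D f)"
  using functor_hom[OF P, of f "Dom D f" "Cod D f"] by (simp_all add: hom_def)

lemma P_Id [simp]: "A \<in> Ob D \<Longrightarrow> FA P (Id D A) = Id S (FO P A)"
  by (rule functor_Id[OF P])

lemma P_Cmp [simp]: "\<lbrakk>f \<in> Ar D; g \<in> Ar D; Dom D g = Cod D f\<rbrakk> \<Longrightarrow>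
    FA P (g \<cdot>\<^bsub>D\<^esub> f) = FA P g \<cdot> FA P f"
  using functor_Cmp[OF P, of f "Dom D f" "Cod D f" g "Cod D g"] by (simp add: hom_def)

lemma
  assumes "A \<in> Ob D" "B \<in> Ob D"
  shows L_Ar [simp]: "L A B \<in> Ar S" and Dom_L [simp]: "Dom S (L A B) = FO F A \<odot> FO P B"
    and Cod_L [simp]: "Cod S (L A B) = FO P (A \<odot>\<^bsub>D\<^esub> B)"
    and K_Ar [simp]: "K A B \<in> Ar S" and Dom_K [simp]: "Dom S (K A B) = FO P A \<odot> FO F B"
    and Cod_K [simp]: "Cod S (K A B) = FO P (A \<odot>\<^bsub>D\<^esub> B)"
  using L_hom[OF assms] K_hom[OF assms] by (simp_all add: hom_def)

text \<open>Composing \<open>L_braid\<close> at \<open>B\<close>, \<open>A\<close> with braidings on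
  both sides cancels its own braidings, since the symmetry is an involution; what remains is the
  mirrored axiom.\<close>

lemma K_braid:
  assumes "A \<in> Ob D" "B \<in> Ob D"
  shows "FA P (braid D A B) \<cdot> K A B = L B A \<cdot> braid S (FO P A) (FO F B)"
proof -
  have "FA P (braid D A B) \<cdot> (FA P (braid D B A) \<cdot> (L B A \<cdot> braid S (FO P A) (FO F B))) =
      FA P (braid D A B) \<cdot> ((FA P (braid D B A) \<cdot> L B A) \<cdot> braid S (FO P A) (FO F B))"
    using assms by simp
  also have "\<dots> = FA P (braid D A B) \<cdot> K A B"
    using assms by (subst L_braid) simp_all
  finally show ?thesis
    using assms S.Cmp_Cmp[of "L B A \<cdot> braid S (FO P A) (FO F B)" "FA P (braid D B A)" "FA P (braid D A B)"]
    by (simp add: P_Cmp[symmetric] del: P_Cmp S.Cmp_Cmp)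
qed

lemmas P_axioms = L_nat K_nat L_unit K_unit LL_assoc LK_assoc KK_assoc L_braid K_braid
lemmas P_simps = P_axioms L_nat[THEN S.reassoc] K_nat[THEN S.reassoc] L_unit[THEN S.reassoc3] K_unit[THEN S.reassoc3]
  LL_assoc[THEN S.reassoc3] LK_assoc[THEN S.reassoc3] KK_assoc[THEN S.reassoc3] L_braid[THEN S.reassoc] K_braid[THEN S.reassoc]

end

lemma (in distributive_category) copair_tensor_inj:
  assumes "f \<in> Ar R" "g \<in> Ar R" "Cod R f = Cod R g" "Dom R f = A" "Dom R g = B" "Z \<in> Ob R"
  shows "(copair R f g \<otimes> Id R Z) \<cdot> (inj1 R A B \<otimes> Id R Z) = f \<otimes> Id R Z"
    and "(copair R f g \<otimes> Id R Z) \<cdot> (inj2 R A B \<otimes> Id R Z) = g \<otimes> Id R Z"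
    and "(Id R Z \<otimes> copair R f g) \<cdot> (Id R Z \<otimes> inj1 R A B) = Id R Z \<otimes> f"
    and "(Id R Z \<otimes> copair R f g) \<cdot> (Id R Z \<otimes> inj2 R A B) = Id R Z \<otimes> g"
  using assms by (auto simp: interchange)

lemmas (in distributive_category) copair_tensor_inj' = copair_tensor_inj copair_tensor_inj[THEN reassoc]

section \<open>From relative derivations to monoidal functors into the dual numbers\<close>

definition dual_pair where
  "dual_pair D S F P L K = \<lparr>
     FO = \<lambda>A. (FO F A, FO P A),
     FA = \<lambda>f. (FA F f, FA P f),
     Mu = \<lambda>A B. (Mu F A B, copair S (L A B) (K A B)),
     Eps = (Eps F, from_initial S (initial_obj S) (FO P \<one>\<^bsub>D\<^esub>)) \<rparr>"

lemma dual_pair_simps [simp]: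
  "FO (dual_pair D S F P L K) A = (FO F A, FO P A)"
  "FA (dual_pair D S F P L K) f = (FA F f, FA P f)"
  "Mu (dual_pair D S F P L K) A B = (Mu F A B, copair S (L A B) (K A B))"
  "Eps (dual_pair D S F P L K) = (Eps F, from_initial S (initial_obj S) (FO P \<one>\<^bsub>D\<^esub>))"
  by (simp_all add: dual_pair_def)

context relative_derivation
begin

text \<open>First components are the axioms of \<open>F\<close>. The equations in second components
  are checked on summands, where they become the equations in \<open>P_axioms\<close>; in the unit
  laws one summand is initial.\<close>

lemma strong_dual_pair: "strong_symmetric_monoidal D (dual_rig S) (dual_pair D S F P L K)"
proof -
  interpret E: symmetric_monoidal_category "dual_rig S" by (rule S.symmetric_monoidal_dual_rig)
  show ?thesis
  proof (induct rule: E.strong_symmetric_monoidalI)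
    case F
    show ?case unfolding functor_dual_rig using F_functor P by (simp add: is_functor_def)
  next
    case (Mu A B)
    thus ?case using Mu_isos LK_iso by (simp add: S.isos_dual_rig S.isos_iff)
  next
    case Eps
    show ?case by (simp add: S.isos_dual_rig S.isos_iff S.initial_iso P_initial)
  next
    case fg: (nat f g)
    have "FA P (f \<otimes>\<^bsub>D\<^esub> g) \<cdot> copair S (L (Dom D f) (Dom D g)) (K (Dom D f) (Dom D g)) =
        copair S (L (Cod D f) (Cod D g)) (K (Cod D f) (Cod D g)) \<cdot>
          coprod_arrow S (FA F f \<otimes> FA P g) (FA P f \<otimes> FA F g)"
      by (rule S.coprod_eq[of _ "FO F (Dom D f) \<odot> FO P (Dom D g)" "FO P (Dom D f) \<odot> FO F (Dom D g)"])
        (use fg in \<open>simp_all add: P_simps\<close>)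
    thus ?case using fg by (simp add: F_simps)
  next
    case ob: (assoc A B E)
    have "FA P (assoc D A B E) \<cdot> (copair S (L (A \<odot>\<^bsub>D\<^esub> B) E) (K (A \<odot>\<^bsub>D\<^esub> B) E) \<cdot>
          coprod_arrow S (Mu F A B \<otimes> Id S (FO P E)) (copair S (L A B) (K A B) \<otimes> Id S (FO F E))) =
        copair S (L A (B \<odot>\<^bsub>D\<^esub> E)) (K A (B \<odot>\<^bsub>D\<^esub> E)) \<cdot>
          (coprod_arrow S (Id S (FO F A) \<otimes> copair S (L B E) (K B E)) (Id S (FO P A) \<otimes> Mu F B E) \<cdot>
           S.assoc2 (FO F A) (FO P A) (FO F B) (FO P B) (FO F E) (FO P E))"
      apply (rule S.coprod_eq[of _ "(FO F A \<odot> FO F B) \<odot> FO P E"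
            "coprod S (FO F A \<odot> FO P B) (FO P A \<odot> FO F B) \<odot> FO F E"])
              apply (use ob in \<open>simp_all add: P_simps S.assoc2_simps S.copair_tensor_inj'\<close>)
      apply (rule S.coprod_right_eq[where A = "FO F A \<odot> FO P B" and B = "FO P A \<odot> FO F B"])
               apply (use ob in \<open>simp_all add: P_simps S.assoc2_simps S.copair_tensor_inj'\<close>)
      done
    thus ?case using ob by (simp add: F_simps)
  next
    case ob: (lunit A)
    have "FA P (lunit D A) \<cdot> (copair S (L \<one>\<^bsub>D\<^esub> A) (K \<one>\<^bsub>D\<^esub> A) \<cdot>
          coprod_arrow S (Eps F \<otimes> Id S (FO P A)) (from_initial S (initial_obj S) (FO P \<one>\<^bsub>D\<^esub>) \<otimes> Id S (FO F A))) =
        S.lunit2 (FO F A) (FO P A)"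
      apply (rule S.coprod_eq[of _ "\<one> \<odot> FO P A" "initial_obj S \<odot> FO F A"])
              apply (use ob in \<open>simp_all add: P_simps S.unit2_simps\<close>)
      apply (rule S.initial_eq[of "initial_obj S \<odot> FO F A"])
           apply (use ob in simp_all)
      done
    thus ?case using ob by (simp add: F_simps)
  next
    case ob: (runit A)
    have "FA P (runit D A) \<cdot> (copair S (L A \<one>\<^bsub>D\<^esub>) (K A \<one>\<^bsub>D\<^esub>) \<cdot>
          coprod_arrow S (Id S (FO F A) \<otimes> from_initial S (initial_obj S) (FO P \<one>\<^bsub>D\<^esub>)) (Id S (FO P A) \<otimes> Eps F)) =
        S.runit2 (FO F A) (FO P A)"
      apply (rule S.coprod_eq[of _ "FO F A \<odot> initial_obj S" "FO P A \<odot> \<one>"])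
              apply (use ob in \<open>simp_all add: P_simps S.unit2_simps\<close>)
      apply (rule S.initial_eq[of "FO F A \<odot> initial_obj S"])
           apply (use ob in simp_all)
      done
    thus ?case using ob by (simp add: F_simps)
  next
    case ob: (braid A B)
    have "FA P (braid D A B) \<cdot> copair S (L A B) (K A B) =
        copair S (L B A) (K B A) \<cdot> S.braid2 (FO F A) (FO P A) (FO F B) (FO P B)"
      by (rule S.coprod_eq[of _ "FO F A \<odot> FO P B" "FO P A \<odot> FO F B"])
        (use ob in \<open>simp_all add: P_simps S.braid2_simps\<close>)
    thus ?case using ob by (simp add: F_simps)
  qed (rule D.symmetric_monoidal_category_axioms)
qed

end

lemma (in relative_derivation) rig_map_dual_pair:
  assumes "cocontinuous \<A> D S F" "cocontinuous \<A> D S P"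
  shows "is_rig_map \<A> D (dual_rig S) (dual_pair D S F P L K)"
proof -
  have "cocontinuous \<A> D (dual_rig S) (dual_pair D S F P L K)"
    unfolding cocontinuous_dual_rig
    by (intro conjI cocontinuous_cong[OF _ _ assms(1)] cocontinuous_cong[OF _ _ assms(2)]) (simp_all add: fun_eq_iff)
  thus ?thesis using strong_dual_pair by (simp add: is_rig_map_def)
qed

section \<open>From monoidal functors into the dual numbers back to relative derivations\<close>

locale dual_functor = D: symmetric_monoidal_category D + S: distributive_category S
  for D :: "('o, 'a, 'm) monoidal_data_scheme" and S :: "('p, 'b, 'n) monoidal_data_scheme" (structure) +
  fixes G :: "('o, 'a, 'p \<times> 'p, 'b \<times> 'b, 'k) monoidal_functor_data_scheme"
  assumes strong: "strong_symmetric_monoidal D (dual_rig S) G"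
begin

definition "F = map_monoidal fst fst G"
definition "P = snd_functor G"
definition "N A B = snd (Mu G A B)"
definition "e = snd (Eps G)"
text \<open>The second component \<open>N\<close> of the multiplication starts at a sum; its
  restrictions to the two summands are the strengths.\<close>

definition "L A B = N A B \<cdot> inj1 S (FO F A \<odot> FO P B) (FO P A \<odot> FO F B)"
definition "K A B = N A B \<cdot> inj2 S (FO F A \<odot> FO P B) (FO P A \<odot> FO F B)"

lemma G_simps [simp]:
  "FO G A = (FO F A, FO P A)" "FA G f = (FA F f, FA P f)" "Mu G A B = (Mu F A B, N A B)" "Eps G = (Eps F, e)"
  by (simp_all add: F_def P_def N_def e_def)

interpretation E: monoidal_functor D "dual_rig S" G
  using D.symmetric_monoidal_category_axioms S.symmetric_monoidal_dual_rig strong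
  by (simp add: monoidal_functor_def monoidal_functor_axioms_def)

lemma functor_components: "is_functor D S F" "is_functor D S P"
  using E.F_functor unfolding functor_dual_rig by (simp_all add: is_functor_def)

lemma strong_F: "strong_symmetric_monoidal D S F"
proof (rule S.strong_symmetric_monoidalI)
  show "Mu F A B \<in> isos S (FO F A \<odot> FO F B) (FO F (A \<odot>\<^bsub>D\<^esub> B))" if "A \<in> Ob D" "B \<in> Ob D" for A B
    using E.Mu_isos[OF that] by (simp add: S.isos_dual_rig)
  show "Eps F \<in> isos S \<one> (FO F \<one>\<^bsub>D\<^esub>)"
    using strong by (simp add: strong_symmetric_monoidal_def S.isos_dual_rig)
qed (use E.Mu_nat E.F_assoc E.F_lunit E.F_runit E.F_braid functor_components D.symmetric_monoidal_category_axioms in simp_all)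

interpretation F: monoidal_functor D S F
  using D.symmetric_monoidal_category_axioms S.symmetric_monoidal_category_axioms strong_F
  by (simp add: monoidal_functor_def monoidal_functor_axioms_def)

lemma P_Ob [simp]: "A \<in> Ob D \<Longrightarrow> FO P A \<in> Ob S"
  by (rule functor_Ob[OF functor_components(2)])

lemma P_Ar [simp]: "f \<in> Ar D \<Longrightarrow> FA P f \<in> Ar S"
  and Dom_P [simp]: "f \<in> Ar D \<Longrightarrow> Dom S (FA P f) = FO P (Dom D f)"
  and Cod_P [simp]: "f \<in> Ar D \<Longrightarrow> Cod S (FA P f) = FO P (Cod D f)"
  using functor_hom[OF functor_components(2), of f "Dom D f" "Cod D f"] by (simp_all add: hom_def)

lemma N_iso [simp]: "A \<in> Ob D \<Longrightarrow> B \<in> Ob D \<Longrightarrow> S.iso (N A B)"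
  and Dom_N [simp]: "A \<in> Ob D \<Longrightarrow> B \<in> Ob D \<Longrightarrow>
    Dom S (N A B) = coprod S (FO F A \<odot> FO P B) (FO P A \<odot> FO F B)"
  and Cod_N [simp]: "A \<in> Ob D \<Longrightarrow> B \<in> Ob D \<Longrightarrow> Cod S (N A B) = FO P (A \<odot>\<^bsub>D\<^esub> B)"
  using E.Mu_isos[of A B] by (simp_all add: S.isos_dual_rig S.isos_iff)

lemma N_Ar [simp]: "A \<in> Ob D \<Longrightarrow> B \<in> Ob D \<Longrightarrow> N A B \<in> Ar S"
  by (simp add: S.iso_Ar)

lemma e_iso: "S.iso e" "Dom S e = initial_obj S" "Cod S e = FO P \<one>\<^bsub>D\<^esub>"
  using strong by (simp_all add: strong_symmetric_monoidal_def S.isos_dual_rig S.isos_iff)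

lemma e_Ar: "e \<in> Ar S"
  using e_iso by (simp add: S.iso_Ar)

lemma relative_derivation: "relative_derivation D S F P L K"
proof (induct rule: relative_derivationI)
  let ?i = "\<lambda>A B. inj1 S (FO F A \<odot> FO P B) (FO P A \<odot> FO F B)"
    and ?j = "\<lambda>A B. inj2 S (FO F A \<odot> FO P B) (FO P A \<odot> FO F B)"
    and ?k = "\<lambda>A B E. inj2 S ((FO F A \<odot> FO F B) \<odot> FO P E) (coprod S (FO F A \<odot> FO P B) (FO P A \<odot> FO F B) \<odot> FO F E)"
  \<comment> \<open>The second component of associativity for \<open>G\<close>; restricted to its
    three summands it yields \<open>LL_assoc\<close>, \<open>LK_assoc\<close> and
    \<open>KK_assoc\<close>.\<close>
  have ass: "FA P (assoc D A B E) \<cdot> (N (A \<odot>\<^bsub>D\<^esub> B) E \<cdot>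
        coprod_arrow S (Mu F A B \<otimes> Id S (FO P E)) (N A B \<otimes> Id S (FO F E))) =
      N A (B \<odot>\<^bsub>D\<^esub> E) \<cdot> (coprod_arrow S (Id S (FO F A) \<otimes> N B E) (Id S (FO P A) \<otimes> Mu F B E) \<cdot>
        S.assoc2 (FO F A) (FO P A) (FO F B) (FO P B) (FO F E) (FO P E))"
    if "A \<in> Ob D" "B \<in> Ob D" "E \<in> Ob D" for A B E
    using E.F_assoc[OF that] by simp
  {
    case (LL_assoc A B E)
    thus ?case
      using arg_cong[OF ass[OF LL_assoc], of "\<lambda>x. x \<cdot> inj1 S ((FO F A \<odot> FO F B) \<odot> FO P E) (coprod S (FO F A \<odot> FO P B) (FO P A \<odot> FO F B) \<odot> FO F E)"]
      by (simp add: L_def S.assoc2_simps S.whisker_left S.whisker_right)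
  next
    case (LK_assoc A B E)
    thus ?case
      using arg_cong[OF ass[OF LK_assoc], of "\<lambda>x. x \<cdot> (?k A B E \<cdot> (?i A B \<otimes> Id S (FO F E)))"]
      by (simp add: L_def K_def S.assoc2_simps S.whisker_left S.whisker_right)
  next
    case (KK_assoc A B E)
    thus ?case
      using arg_cong[OF ass[OF KK_assoc], of "\<lambda>x. x \<cdot> (?k A B E \<cdot> (?j A B \<otimes> Id S (FO F E)))"]
      by (simp add: K_def S.assoc2_simps S.whisker_left S.whisker_right)
  next
    case fg: (L_nat f g A B)
    show ?case using arg_cong[OF E.Mu_nat[OF fg], of "\<lambda>x. snd x \<cdot> ?i A B"] fg by (auto simp: L_def)
  next
    case fg: (K_nat f g A B)
    show ?case using arg_cong[OF E.Mu_nat[OF fg], of "\<lambda>x. snd x \<cdot> ?j A B"] fg by (auto simp: K_def)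
  next
    case (L_unit A)
    thus ?case
      using arg_cong[OF E.F_lunit[OF L_unit], of "\<lambda>x. snd x \<cdot> inj1 S (\<one> \<odot> FO P A) (initial_obj S \<odot> FO F A)"]
      by (simp add: L_def S.unit2_simps e_iso e_Ar)
  next
    case (K_unit A)
    thus ?case
      using arg_cong[OF E.F_runit[OF K_unit], of "\<lambda>x. snd x \<cdot> inj2 S (FO F A \<odot> initial_obj S) (FO P A \<odot> \<one>)"]
      by (simp add: K_def S.unit2_simps e_iso e_Ar)
  next
    case (L_braid A B)
    thus ?case
      using arg_cong[OF E.F_braid[OF L_braid], of "\<lambda>x. snd x \<cdot> ?i A B"] by (simp add: L_def K_def S.braid2_simps)
  next
    case (LK_iso A B)
    have "copair S (L A B) (K A B) = N A B"
      by (rule S.coprod_eq[of _ "FO F A \<odot> FO P B" "FO P A \<odot> FO F B"]) (use LK_iso in \<open>simp_all add: L_def K_def\<close>)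
    thus ?case using LK_iso by simp
  next
    case P_initial
    show ?case using S.iso_from_initial[OF S.initial_obj e_iso(1,2)] by (simp add: e_iso)
  }
qed (use functor_components strong_F D.symmetric_monoidal_category_axioms S.symmetric_monoidal_category_axioms
  S.distributive_category_axioms in \<open>simp_all add: L_def K_def hom_def\<close>)

end

context relative_derivation
begin

text \<open>As for modules, \<open>P\<close> is kept while the acting functor \<open>F\<close> is
  replaced by an isomorphic \<open>G\<close>, and the strengths are precomposed with the
  isomorphism. This repairs a rig map into the dual numbers whose first component is merely
  isomorphic to the identity.\<close>

lemma restrict_scalars:
  assumes G: "strong_symmetric_monoidal D S G" and \<theta>: "monoidal_transformation D S G F \<theta>"
    and iso: "\<And>A. A \<in> Ob D \<Longrightarrow> S.iso (\<theta> A)"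
  shows "relative_derivation D S G P (\<lambda>A B. L A B \<cdot> (\<theta> A \<otimes> Id S (FO P B)))
    (\<lambda>A B. K A B \<cdot> (Id S (FO P A) \<otimes> \<theta> B))"
proof -
  interpret G: monoidal_functor D S G
    using D.symmetric_monoidal_category_axioms S.symmetric_monoidal_category_axioms G
    by (simp add: monoidal_functor_def monoidal_functor_axioms_def)
  have t [simp]: "\<theta> A \<in> Ar S" "Dom S (\<theta> A) = FO G A" "Cod S (\<theta> A) = FO F A" if "A \<in> Ob D" for A
    using \<theta> that by (simp_all add: monoidal_transformation_def hom_def)
  have nat: "FA F f \<cdot> \<theta> A = \<theta> (Cod D f) \<cdot> FA G f" if "f \<in> Ar D" "Dom D f = A" for f A
    using \<theta> that by (simp add: monoidal_transformation_def hom_def)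
  have mu: "\<theta> (A \<odot>\<^bsub>D\<^esub> B) \<cdot> Mu G A B = Mu F A B \<cdot> (\<theta> A \<otimes> \<theta> B)" if "A \<in> Ob D" "B \<in> Ob D" for A B
    using \<theta> that by (simp add: monoidal_transformation_def)
  have eps: "\<theta> \<one>\<^bsub>D\<^esub> \<cdot> Eps G = Eps F" using \<theta> by (simp add: monoidal_transformation_def)
  have LL: "(\<theta> (A \<odot>\<^bsub>D\<^esub> B) \<otimes> Id S (FO P E)) \<cdot> (Mu G A B \<otimes> Id S (FO P E)) =
      (Mu F A B \<otimes> Id S (FO P E)) \<cdot> ((\<theta> A \<otimes> \<theta> B) \<otimes> Id S (FO P E))"
    if "A \<in> Ob D" "B \<in> Ob D" "E \<in> Ob D" for A B E
    using that by (simp add: S.interchange mu)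
  \<comment> \<open>Both sides equal \<open>(L A B \<cdot> (\<theta> A \<otimes> Id S (FO P B)))
    \<otimes> \<theta> E\<close>; the right-hand form exposes
    \<open>L A B \<otimes> Id S (FO F E)\<close> to the axiom \<open>LK_assoc\<close>.\<close>
  have LK: "(Id S (FO P (A \<odot>\<^bsub>D\<^esub> B)) \<otimes> \<theta> E) \<cdot> ((L A B \<cdot> (\<theta> A \<otimes> Id S (FO P B))) \<otimes> Id S (FO G E)) =
      (L A B \<otimes> Id S (FO F E)) \<cdot> ((\<theta> A \<otimes> Id S (FO P B)) \<otimes> \<theta> E)"
    if "A \<in> Ob D" "B \<in> Ob D" "E \<in> Ob D" for A B E
    using that by (simp add: S.interchange)
  have KK: "(Id S (FO P (A \<odot>\<^bsub>D\<^esub> B)) \<otimes> \<theta> E) \<cdot> ((K A B \<cdot> (Id S (FO P A) \<otimes> \<theta> B)) \<otimes> Id S (FO G E)) =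
      (K A B \<otimes> Id S (FO F E)) \<cdot> ((Id S (FO P A) \<otimes> \<theta> B) \<otimes> \<theta> E)"
    if "A \<in> Ob D" "B \<in> Ob D" "E \<in> Ob D" for A B E
    using that by (simp add: S.interchange)
  show ?thesis
  proof (induct rule: relative_derivationI)
    case ob: (LL_assoc A B E)
    thus ?case
      by (simp add: LL P_simps S.assoc_nat) (simp add: S.interchange S.interchange')
  next
    case ob: (LK_assoc A B E)
    thus ?case
      by (simp add: LK P_simps S.assoc_nat) (simp add: S.interchange S.interchange')
  next
    case ob: (KK_assoc A B E)
    thus ?case
      by (simp add: KK P_simps S.assoc_nat) (simp add: S.interchange S.interchange' mu)
  next
    case ob: (LK_iso A B)
    have "copair S (L A B \<cdot> (\<theta> A \<otimes> Id S (FO P B))) (K A B \<cdot> (Id S (FO P A) \<otimes> \<theta> B)) =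
        copair S (L A B) (K A B) \<cdot> coprod_arrow S (\<theta> A \<otimes> Id S (FO P B)) (Id S (FO P A) \<otimes> \<theta> B)"
      by (rule S.coprod_eq[of _ "FO G A \<odot> FO P B" "FO P A \<odot> FO G B"]) (use ob in simp_all)
    thus ?case using ob iso LK_iso by (simp add: S.iso_coprod_arrow)
  qed (use P P_initial G D.symmetric_monoidal_category_axioms S.symmetric_monoidal_category_axioms
    S.distributive_category_axioms in \<open>auto simp: hom_def P_simps S.interchange S.interchange' nat eps S.braid_nat\<close>)
qed

end

section \<open>Derivations as relative derivations along the identity\<close>

definition id_monoidal :: "('o, 'a, 'm) monoidal_data_scheme \<Rightarrow> ('o, 'a, 'o, 'a) monoidal_functor_data" where
  "id_monoidal R = \<lparr>FO = \<lambda>A. A, FA = \<lambda>f. f, Mu = \<lambda>A B. Id R (A \<odot>\<^bsub>R\<^esub> B), Eps = Id R \<one>\<^bsub>R\<^esub>\<rparr>"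

lemma id_monoidal_simps [simp]:
  "FO (id_monoidal R) A = A" "FA (id_monoidal R) f = f" "Mu (id_monoidal R) A B = Id R (A \<odot>\<^bsub>R\<^esub> B)"
  "Eps (id_monoidal R) = Id R \<one>\<^bsub>R\<^esub>"
  by (simp_all add: id_monoidal_def)

lemma (in symmetric_monoidal_category) strong_id: "strong_symmetric_monoidal R R (id_monoidal R)"
  by (rule strong_symmetric_monoidalI[OF symmetric_monoidal_category_axioms])
    (auto simp: isos_iff is_functor_def)

lemma comp_id [simp]: "comp_functor (id_monoidal R) D = D" for D :: "('i, 'j, 'o, 'a) functor_data"
  by (cases D) (simp add: comp_functor_def)

lemma cocontinuous_id: "cocontinuous \<A> R R (id_monoidal R)"
  by (simp add: cocontinuous_iff) (simp add: is_functor_def)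

lemma dual_map_eq: "dual_map R d = dual_pair R R (id_monoidal R) d (LStr d) (RStr d)"
  by (simp add: dual_map_def dual_pair_def)

context cocartesian_category
begin

text \<open>\<open>leibnizator\<close> lists the right strength first, \<open>dual_rig\<close> puts
  the left one first; this converts between the two orders.\<close>

lemma iso_copair_swap:
  assumes "iso (copair C f g)" "f \<in> Ar C" "g \<in> Ar C" "Cod C f = Cod C g"
  shows "iso (copair C g f)"
proof -
  let ?A = "Dom C f" and ?B = "Dom C g"
  have "iso (copair C (inj2 C ?A ?B) (inj1 C ?A ?B))"
  proof (rule isoI[where g = "copair C (inj2 C ?B ?A) (inj1 C ?B ?A)"])
    show "copair C (inj2 C ?B ?A) (inj1 C ?B ?A) \<cdot> copair C (inj2 C ?A ?B) (inj1 C ?A ?B) =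
        Id C (Dom C (copair C (inj2 C ?A ?B) (inj1 C ?A ?B)))"
      by (rule coprod_eq[of _ ?B ?A]) (use assms in simp_all)
    show "copair C (inj2 C ?A ?B) (inj1 C ?A ?B) \<cdot> copair C (inj2 C ?B ?A) (inj1 C ?B ?A) =
        Id C (Cod C (copair C (inj2 C ?A ?B) (inj1 C ?A ?B)))"
      by (rule coprod_eq[of _ ?A ?B]) (use assms in simp_all)
  qed (use assms in simp_all)
  moreover have "copair C g f = copair C f g \<cdot> copair C (inj2 C ?A ?B) (inj1 C ?A ?B)"
    by (rule coprod_eq[of _ ?B ?A]) (use assms in simp_all)
  ultimately show ?thesis using assms by simp
qed

text \<open>Invertibility of a \<open>copair\<close> refers to chosen coproducts; as a universal
  property it can be carried along a cocontinuous functor.\<close>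

lemma iso_copair_coproduct:
  assumes "iso (copair C f g)" "f \<in> Ar C" "g \<in> Ar C" "Cod C f = Cod C g"
  shows "is_coproduct C (Dom C f) (Dom C g) (Cod C g, f, g)"
proof (rule is_coproductI)
  fix u v assume uv: "u \<in> Ar C" "v \<in> Ar C" "Dom C u = Dom C f" "Dom C v = Dom C g" "Cod C u = Cod C v"
  let ?h = "copair C u v \<cdot> inv_arrow C (copair C f g)"
  have "inv_arrow C (copair C f g) \<cdot> f = inj1 C (Dom C f) (Dom C g)"
    by (rule iso_mono[where e = "copair C f g"]) (use assms in simp_all)
  moreover have "inv_arrow C (copair C f g) \<cdot> g = inj2 C (Dom C f) (Dom C g)"
    by (rule iso_mono[where e = "copair C f g"]) (use assms in simp_all)
  ultimately have "?h \<in> Ar C \<and> Dom C ?h = Cod C g \<and> Cod C ?h = Cod C u \<and> ?h \<cdot> f = u \<and> ?h \<cdot> g = v"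
    using assms uv by simp
  thus "\<exists>h. h \<in> Ar C \<and> Dom C h = Cod C g \<and> Cod C h = Cod C u \<and> h \<cdot> f = u \<and> h \<cdot> g = v" by blast
next
  fix h k assume hk: "h \<in> Ar C" "k \<in> Ar C" "Dom C h = Cod C g" "Dom C k = Cod C g" "Cod C h = Cod C k"
    "h \<cdot> f = k \<cdot> f" "h \<cdot> g = k \<cdot> g"
  have "h \<cdot> copair C f g = k \<cdot> copair C f g"
    by (rule coprod_eq[of _ "Dom C f" "Dom C g"]) (use assms hk in simp_all)
  thus "h = k" by (rule iso_epi) (use assms hk in simp_all)
qed (use assms in simp_all)

end

locale derivation = relative_derivation R R "id_monoidal R" d "LStr d" "RStr d"
  for R :: "('o, 'a, 'm) monoidal_data_scheme" (structure) and d :: "('o, 'a, 'k) derivation_data_scheme"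
begin

lemma iso_d: "D.iso f \<Longrightarrow> D.iso (FA d f)"
  by (rule D.isoI[where g = "FA d (inv_arrow R f)"]) (auto simp: D.iso_Ar P_Cmp[symmetric] simp del: P_Cmp)

lemma strengths_nat:
  assumes "f \<in> Ar R" "g \<in> Ar R" "Dom R f = A" "Dom R g = B"
  shows "FA d (f \<otimes> g) \<cdot> LStr d A B = LStr d (Cod R f) (Cod R g) \<cdot> (f \<otimes> FA d g)"
    and "FA d (f \<otimes> g) \<cdot> RStr d A B = RStr d (Cod R f) (Cod R g) \<cdot> (FA d f \<otimes> g)"
  using L_nat[OF assms] K_nat[OF assms] by simp_all

lemma strengths_unit:
  assumes "A \<in> Ob R"
  shows "FA d (lunit R A) \<cdot> LStr d \<one> A = lunit R (FO d A)" and "FA d (runit R A) \<cdot> RStr d A \<one> = runit R (FO d A)"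
  using L_unit[OF assms] K_unit[OF assms] assms by simp_all

lemma strengths_assoc:
  assumes "A \<in> Ob R" "B \<in> Ob R" "E \<in> Ob R"
  shows "FA d (assoc R A B E) \<cdot> LStr d (A \<odot> B) E = LStr d A (B \<odot> E) \<cdot> ((Id R A \<otimes> LStr d B E) \<cdot> assoc R A B (FO d E))"
    and "FA d (assoc R A B E) \<cdot> (RStr d (A \<odot> B) E \<cdot> (LStr d A B \<otimes> Id R E)) =
      LStr d A (B \<odot> E) \<cdot> ((Id R A \<otimes> RStr d B E) \<cdot> assoc R A (FO d B) E)"
    and "FA d (assoc R A B E) \<cdot> (RStr d (A \<odot> B) E \<cdot> (RStr d A B \<otimes> Id R E)) = RStr d A (B \<odot> E) \<cdot> assoc R (FO d A) B E"
  using LL_assoc[OF assms] LK_assoc[OF assms] KK_assoc[OF assms] assms by simp_all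

lemma strengths_braid: "A \<in> Ob R \<Longrightarrow> B \<in> Ob R \<Longrightarrow> FA d (braid R A B) \<cdot> LStr d A B = RStr d B A \<cdot> braid R A (FO d B)"
  using L_braid[of A B] by simp

end

text \<open>Along the identity the constraints \<open>Mu\<close> and \<open>Eps\<close> are
  identities and cancel. What differs is the order of the summands in the Leibniz rule and the
  wording of its unit case, invertibility of the arrow from \<open>initial_obj R\<close> against
  initiality of \<open>FO d \<one>\<close>.\<close>

lemma (in distributive_category) derivation_iff:
  "is_derivation \<A> R d \<longleftrightarrow> cocontinuous \<A> R R d \<and> derivation R d"
  unfolding derivation_def
proof
  assume d: "is_derivation \<A> R d"
  hence ls: "is_left_strength R d" and rs: "is_right_strength R d" and sc: "strengths_compatible R d"
    and c: "cocontinuous \<A> R R d" by (simp_all add: is_derivation_def)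
  have dO: "FO d A \<in> Ob R" if "A \<in> Ob R" for A using functor_Ob[OF cocontinuous_functor[OF c] that] .
  have L: "LStr d A B \<in> Ar R" "Dom R (LStr d A B) = A \<odot> FO d B" "Cod R (LStr d A B) = FO d (A \<odot> B)"
    and K: "RStr d A B \<in> Ar R" "Dom R (RStr d A B) = FO d A \<odot> B" "Cod R (RStr d A B) = FO d (A \<odot> B)"
    if "A \<in> Ob R" "B \<in> Ob R" for A B
    using ls rs that by (simp_all add: is_left_strength_def is_right_strength_def hom_def)
  have dA: "FA d f \<in> Ar R" "Dom R (FA d f) = FO d (Dom R f)" "Cod R (FA d f) = FO d (Cod R f)" if "f \<in> Ar R" for f
  proof -
    have "FA d f \<in> hom R (FO d (Dom R f)) (FO d (Cod R f))"
      by (rule functor_hom[OF cocontinuous_functor[OF c]]) (simp add: hom_def that)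
    thus "FA d f \<in> Ar R" "Dom R (FA d f) = FO d (Dom R f)" "Cod R (FA d f) = FO d (Cod R f)"
      unfolding hom_def by blast+
  qed
  have leib: "iso (copair R (RStr d A B) (LStr d A B))" if "A \<in> Ob R" "B \<in> Ob R" for A B
  proof -
    have "leibnizator R d A B \<in> isos R (coprod R (FO d A \<odot> B) (A \<odot> FO d B)) (FO d (A \<odot> B))"
      using d that unfolding is_derivation_def by blast
    thus ?thesis by (simp add: leibnizator_def isos_iff)
  qed
  have init: "iso (from_initial R (initial_obj R) (FO d \<one>))"
    using d unfolding is_derivation_def isos_iff by blast
  have "relative_derivation R R (id_monoidal R) d (LStr d) (RStr d)"
  proof (induct rule: relative_derivationI)
    case (LK_iso A B)
    show ?case by (rule iso_copair_swap[OF leib]) (use LK_iso in \<open>simp_all add: L K\<close>)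
  next
    case P_initial
    show ?case using iso_from_initial[OF initial_obj init] by (simp add: dO)
  next
    case (L_nat f g A B)
    thus ?case using ls by (auto simp: is_left_strength_def hom_def)
  next
    case (K_nat f g A B)
    thus ?case using rs by (auto simp: is_right_strength_def hom_def)
  qed (use ls rs sc strong_id cocontinuous_functor[OF c] symmetric_monoidal_category_axioms distributive_category_axioms in
    \<open>simp_all add: is_left_strength_def is_right_strength_def strengths_compatible_def L K dO dA hom_def\<close>)
  with c show "cocontinuous \<A> R R d \<and> relative_derivation R R (id_monoidal R) d (LStr d) (RStr d)" by blast
next
  assume d: "cocontinuous \<A> R R d \<and> relative_derivation R R (id_monoidal R) d (LStr d) (RStr d)"
  then interpret d: derivation R d by (simp add: derivation_def)
  have "is_left_strength R d"
    unfolding is_left_strength_def using d.strengths_nat(1) by (auto simp: hom_def d.strengths_assoc d.strengths_unit)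
  moreover have "is_right_strength R d"
    unfolding is_right_strength_def using d.strengths_nat(2) by (auto simp: hom_def d.strengths_assoc d.strengths_unit)
  moreover have "strengths_compatible R d"
    unfolding strengths_compatible_def using d.strengths_assoc(2) d.strengths_braid by auto
  moreover have "leibnizator R d A B \<in> isos R (coprod R (FO d A \<odot> B) (A \<odot> FO d B)) (FO d (A \<odot> B))"
    if "A \<in> Ob R" "B \<in> Ob R" for A B
    using iso_copair_swap[OF d.LK_iso[OF that]] that by (simp add: leibnizator_def isos_iff)
  moreover have "from_initial R (initial_obj R) (FO d \<one>) \<in> isos R (initial_obj R) (FO d \<one>)"
    by (simp add: isos_iff initial_iso d.P_initial)
  ultimately show "is_derivation \<A> R d" using d by (simp add: is_derivation_def)
qed

section \<open>The two relative derivations obtained by composing a derivation with a monoidal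
  functor\<close>

locale differential_functors = D: distributive_category D + S: distributive_category S + F: monoidal_functor D S F +
  dD: derivation D d + dS: derivation S d'
  for D :: "('o, 'a, 'm) monoidal_data_scheme" and d :: "('o, 'a, 'k) derivation_data_scheme"
  and S :: "('p, 'b, 'n) monoidal_data_scheme" (structure) and d' :: "('p, 'b, 'l) derivation_data_scheme"
  and F :: "('o, 'a, 'p, 'b, 'q) monoidal_functor_data_scheme"
begin

text \<open>Each axiom combines the image under \<open>d'\<close> of a coherence law of
  \<open>F\<close> with the corresponding strength axiom of \<open>d'\<close> at objects
  \<open>FO F A\<close>.\<close>

lemma derivation_comp:
  "relative_derivation D S F (comp_functor d' F)
    (\<lambda>A B. FA d' (Mu F A B) \<cdot> LStr d' (FO F A) (FO F B))
    (\<lambda>A B. FA d' (Mu F A B) \<cdot> RStr d' (FO F A) (FO F B))"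
proof (induct rule: relative_derivationI)
  have nat: "FA d' (FA F (f \<otimes>\<^bsub>D\<^esub> g)) \<cdot> FA d' (Mu F A B) = FA d' (Mu F (Cod D f) (Cod D g)) \<cdot> FA d' (FA F f \<otimes> FA F g)"
    if "f \<in> Ar D" "g \<in> Ar D" "Dom D f = A" "Dom D g = B" for f g A B
    using arg_cong[OF F.Mu_nat[OF that], of "FA d'"] that by auto
  have ass: "FA d' (FA F (assoc D A B E)) \<cdot> (FA d' (Mu F (A \<odot>\<^bsub>D\<^esub> B) E) \<cdot> FA d' (Mu F A B \<otimes> Id S (FO F E))) =
    FA d' (Mu F A (B \<odot>\<^bsub>D\<^esub> E)) \<cdot> (FA d' (Id S (FO F A) \<otimes> Mu F B E) \<cdot> FA d' (assoc S (FO F A) (FO F B) (FO F E)))"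
    if "A \<in> Ob D" "B \<in> Ob D" "E \<in> Ob D" for A B E
    using arg_cong[OF F.F_assoc[OF that], of "FA d'"] that by simp
  have lu: "FA d' (FA F (lunit D A)) \<cdot> (FA d' (Mu F \<one>\<^bsub>D\<^esub> A) \<cdot> FA d' (Eps F \<otimes> Id S (FO F A))) = FA d' (lunit S (FO F A))"
    and ru: "FA d' (FA F (runit D A)) \<cdot> (FA d' (Mu F A \<one>\<^bsub>D\<^esub>) \<cdot> FA d' (Id S (FO F A) \<otimes> Eps F)) = FA d' (runit S (FO F A))"
    if "A \<in> Ob D" for A
    using arg_cong[OF F.F_lunit[OF that], of "FA d'"] arg_cong[OF F.F_runit[OF that], of "FA d'"] that by simp_all
  have br: "FA d' (FA F (braid D A B)) \<cdot> FA d' (Mu F A B) = FA d' (Mu F B A) \<cdot> FA d' (braid S (FO F A) (FO F B))"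
    if "A \<in> Ob D" "B \<in> Ob D" for A B
    using arg_cong[OF F.F_braid[OF that], of "FA d'"] that by simp
  note nats = dS.strengths_nat dS.strengths_nat[THEN S.reassoc] dS.strengths_assoc dS.strengths_assoc(1)[THEN S.reassoc]
    dS.strengths_assoc(2,3)[THEN S.reassoc3] dS.strengths_braid dS.strengths_unit
  note Fs = nat[THEN S.reassoc] br[THEN S.reassoc] ass[THEN S.reassoc3] lu[THEN S.reassoc3] ru[THEN S.reassoc3]
  \<comment> \<open>Naturality of the strengths of \<open>d'\<close> moves the constraint
    \<open>Mu F A B\<close> under \<open>FA d'\<close>, where the law \<open>ass\<close> can absorb
    it.\<close>
  have LL: "LStr d' (FO F (A \<odot>\<^bsub>D\<^esub> B)) (FO F E) \<cdot> (Mu F A B \<otimes> Id S (FO d' (FO F E))) =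
      FA d' (Mu F A B \<otimes> Id S (FO F E)) \<cdot> LStr d' (FO F A \<odot> FO F B) (FO F E)"
    and KK: "RStr d' (FO F (A \<odot>\<^bsub>D\<^esub> B)) (FO F E) \<cdot> (FA d' (Mu F A B) \<otimes> Id S (FO F E)) =
      FA d' (Mu F A B \<otimes> Id S (FO F E)) \<cdot> RStr d' (FO F A \<odot> FO F B) (FO F E)"
    if "A \<in> Ob D" "B \<in> Ob D" "E \<in> Ob D" for A B E
    using that by (simp_all add: nats)
  {
    case (L_nat f g A B)
    thus ?case by (auto simp: Fs nats)
  next
    case (K_nat f g A B)
    thus ?case by (auto simp: Fs nats)
  next
    case (L_unit A)
    have "LStr d' (FO F \<one>\<^bsub>D\<^esub>) (FO F A) \<cdot> (Eps F \<otimes> Id S (FO d' (FO F A))) = FA d' (Eps F \<otimes> Id S (FO F A)) \<cdot> LStr d' \<one> (FO F A)"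
      using L_unit by (simp add: nats)
    thus ?case using L_unit by (simp add: Fs dS.strengths_unit)
  next
    case (K_unit A)
    have "RStr d' (FO F A) (FO F \<one>\<^bsub>D\<^esub>) \<cdot> (Id S (FO d' (FO F A)) \<otimes> Eps F) = FA d' (Id S (FO F A) \<otimes> Eps F) \<cdot> RStr d' (FO F A) \<one>"
      using K_unit by (simp add: nats)
    thus ?case using K_unit by (simp add: Fs dS.strengths_unit)
  next
    case (LL_assoc A B E)
    thus ?case by (simp add: LL Fs) (simp add: nats S.whisker_left)
  next
    case (LK_assoc A B E)
    thus ?case by (simp add: KK[THEN S.reassoc] Fs S.whisker_right) (simp add: nats S.whisker_left)
  next
    case (KK_assoc A B E)
    thus ?case by (simp add: KK[THEN S.reassoc] Fs S.whisker_right) (simp add: nats S.whisker_left)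
  next
    case (L_braid A B)
    thus ?case by (simp add: Fs nats)
  next
    case (LK_iso A B)
    have "copair S (FA d' (Mu F A B) \<cdot> LStr d' (FO F A) (FO F B)) (FA d' (Mu F A B) \<cdot> RStr d' (FO F A) (FO F B)) =
        FA d' (Mu F A B) \<cdot> copair S (LStr d' (FO F A) (FO F B)) (RStr d' (FO F A) (FO F B))"
      by (rule S.coprod_eq[of _ "FO F A \<odot> FO d' (FO F B)" "FO d' (FO F A) \<odot> FO F B"]) (use LK_iso in simp_all)
    thus ?case using LK_iso dS.LK_iso[of "FO F A" "FO F B"] by (simp add: dS.iso_d)
  next
    case P_initial
    show ?case using S.iso_from_initial[OF dS.P_initial dS.iso_d[OF F.iso_Eps]] by simp
  }
qed (use functor_comp[OF F.F_functor dS.P] F.strong D.symmetric_monoidal_category_axioms S.symmetric_monoidal_category_axioms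
  S.distributive_category_axioms in \<open>simp_all add: hom_def\<close>)

lemma comp_derivation:
  assumes \<A>: "additive_doctrine \<A>" and c: "cocontinuous \<A> D S F"
  shows "relative_derivation D S F (comp_functor F d)
    (\<lambda>A B. FA F (LStr d A B) \<cdot> Mu F A (FO d B))
    (\<lambda>A B. FA F (RStr d A B) \<cdot> Mu F (FO d A) B)"
proof (induct rule: relative_derivationI)
  have Lnat: "FA F (FA d (f \<otimes>\<^bsub>D\<^esub> g)) \<cdot> FA F (LStr d A B) = FA F (LStr d (Cod D f) (Cod D g)) \<cdot> FA F (f \<otimes>\<^bsub>D\<^esub> FA d g)"
    and Knat: "FA F (FA d (f \<otimes>\<^bsub>D\<^esub> g)) \<cdot> FA F (RStr d A B) = FA F (RStr d (Cod D f) (Cod D g)) \<cdot> FA F (FA d f \<otimes>\<^bsub>D\<^esub> g)"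
    if "f \<in> Ar D" "g \<in> Ar D" "Dom D f = A" "Dom D g = B" for f g A B
    using arg_cong[OF dD.L_nat[OF that], of "FA F"] arg_cong[OF dD.K_nat[OF that], of "FA F"] that by auto
  have lu: "FA F (FA d (lunit D A)) \<cdot> FA F (LStr d \<one>\<^bsub>D\<^esub> A) = FA F (lunit D (FO d A))"
    and ru: "FA F (FA d (runit D A)) \<cdot> FA F (RStr d A \<one>\<^bsub>D\<^esub>) = FA F (runit D (FO d A))" if "A \<in> Ob D" for A
    using arg_cong[OF dD.L_unit[OF that], of "FA F"] arg_cong[OF dD.K_unit[OF that], of "FA F"] that by simp_all
  have ll: "FA F (FA d (assoc D A B E)) \<cdot> FA F (LStr d (A \<odot>\<^bsub>D\<^esub> B) E) =
      FA F (LStr d A (B \<odot>\<^bsub>D\<^esub> E)) \<cdot> (FA F (Id D A \<otimes>\<^bsub>D\<^esub> LStr d B E) \<cdot> FA F (assoc D A B (FO d E)))"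
    and lk: "FA F (FA d (assoc D A B E)) \<cdot> (FA F (RStr d (A \<odot>\<^bsub>D\<^esub> B) E) \<cdot> FA F (LStr d A B \<otimes>\<^bsub>D\<^esub> Id D E)) =
      FA F (LStr d A (B \<odot>\<^bsub>D\<^esub> E)) \<cdot> (FA F (Id D A \<otimes>\<^bsub>D\<^esub> RStr d B E) \<cdot> FA F (assoc D A (FO d B) E))"
    and kk: "FA F (FA d (assoc D A B E)) \<cdot> (FA F (RStr d (A \<odot>\<^bsub>D\<^esub> B) E) \<cdot> FA F (RStr d A B \<otimes>\<^bsub>D\<^esub> Id D E)) =
      FA F (RStr d A (B \<odot>\<^bsub>D\<^esub> E)) \<cdot> FA F (assoc D (FO d A) B E)"
    if "A \<in> Ob D" "B \<in> Ob D" "E \<in> Ob D" for A B E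
    using arg_cong[OF dD.LL_assoc[OF that], of "FA F"] arg_cong[OF dD.LK_assoc[OF that], of "FA F"]
      arg_cong[OF dD.KK_assoc[OF that], of "FA F"] that by simp_all
  have br: "FA F (FA d (braid D A B)) \<cdot> FA F (LStr d A B) = FA F (RStr d B A) \<cdot> FA F (braid D A (FO d B))"
    if "A \<in> Ob D" "B \<in> Ob D" for A B
    using arg_cong[OF dD.L_braid[OF that], of "FA F"] that by simp
  note ds = Lnat[THEN S.reassoc] Knat[THEN S.reassoc] lu[THEN S.reassoc] ru[THEN S.reassoc]
    ll[THEN S.reassoc] lk[THEN S.reassoc3] kk[THEN S.reassoc3] br[THEN S.reassoc]
  \<comment> \<open>Naturality of \<open>Mu\<close>, oriented so that the strength is tensored
    inside \<open>FA F\<close>, the form in which \<open>lk\<close> and \<open>kk\<close>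
    apply.\<close>
  have LK: "Mu F (FO d (A \<odot>\<^bsub>D\<^esub> B)) E \<cdot> (FA F (LStr d A B) \<otimes> Id S (FO F E)) = FA F (LStr d A B \<otimes>\<^bsub>D\<^esub> Id D E) \<cdot> Mu F (A \<odot>\<^bsub>D\<^esub> FO d B) E"
    and KK: "Mu F (FO d (A \<odot>\<^bsub>D\<^esub> B)) E \<cdot> (FA F (RStr d A B) \<otimes> Id S (FO F E)) = FA F (RStr d A B \<otimes>\<^bsub>D\<^esub> Id D E) \<cdot> Mu F (FO d A \<odot>\<^bsub>D\<^esub> B) E"
    if "A \<in> Ob D" "B \<in> Ob D" "E \<in> Ob D" for A B E
    using that by (simp_all add: F.F_simps)
  {
    case (L_nat f g A B)
    thus ?case by (auto simp: ds F.F_simps)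
  next
    case (K_nat f g A B)
    thus ?case by (auto simp: ds F.F_simps)
  next
    case (L_unit A)
    thus ?case by (auto simp: ds F.F_simps)
  next
    case (K_unit A)
    thus ?case by (auto simp: ds F.F_simps)
  next
    case (L_braid A B)
    thus ?case by (auto simp: ds F.F_simps)
  next
    case (LL_assoc A B E)
    thus ?case by (simp add: ds F.F_simps S.whisker_left)
  next
    case (LK_assoc A B E)
    thus ?case by (simp add: LK[THEN S.reassoc] ds S.whisker_right) (simp add: F.F_simps S.whisker_left)
  next
    case (KK_assoc A B E)
    thus ?case by (simp add: KK[THEN S.reassoc] ds S.whisker_right) (simp add: F.F_simps S.whisker_left)
  next
    case (LK_iso A B)
    have "is_coproduct D (A \<odot>\<^bsub>D\<^esub> FO d B) (FO d A \<odot>\<^bsub>D\<^esub> B) (FO d (A \<odot>\<^bsub>D\<^esub> B), LStr d A B, RStr d A B)"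
      using D.iso_copair_coproduct[OF dD.LK_iso[OF LK_iso]] LK_iso by simp
    hence "S.iso (copair S (FA F (LStr d A B)) (FA F (RStr d A B)))"
      by (intro S.coproduct_copair_iso[OF cocontinuous_coproduct[OF \<A> D.category_axioms S.category_axioms c]])
    moreover have "copair S (FA F (LStr d A B) \<cdot> Mu F A (FO d B)) (FA F (RStr d A B) \<cdot> Mu F (FO d A) B) =
        copair S (FA F (LStr d A B)) (FA F (RStr d A B)) \<cdot> coprod_arrow S (Mu F A (FO d B)) (Mu F (FO d A) B)"
      by (rule S.coprod_eq[of _ "FO F A \<odot> FO F (FO d B)" "FO F (FO d A) \<odot> FO F B"]) (use LK_iso in simp_all)
    ultimately show ?case using LK_iso by (simp add: S.iso_coprod_arrow)
  next
    case P_initial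
    show ?case using cocontinuous_initial[OF \<A> D.category_axioms S.category_axioms c dD.P_initial] by simp
  }
qed (use functor_comp[OF dD.P F.F_functor] F.strong D.symmetric_monoidal_category_axioms S.symmetric_monoidal_category_axioms
  S.distributive_category_axioms in \<open>simp_all add: hom_def\<close>)

end

section \<open>Monoidal transformations\<close>

lemma transformationD:
  assumes "monoidal_transformation D S F G \<theta>"
  shows "A \<in> Ob D \<Longrightarrow> \<theta> A \<in> hom S (FO F A) (FO G A)"
    and "f \<in> hom D A B \<Longrightarrow> \<theta> B \<cdot>\<^bsub>S\<^esub> FA F f = FA G f \<cdot>\<^bsub>S\<^esub> \<theta> A"
    and "A \<in> Ob D \<Longrightarrow> B \<in> Ob D \<Longrightarrow> \<theta> (A \<odot>\<^bsub>D\<^esub> B) \<cdot>\<^bsub>S\<^esub> Mu F A B = Mu G A B \<cdot>\<^bsub>S\<^esub> (\<theta> A \<otimes>\<^bsub>S\<^esub> \<theta> B)"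
    and "\<theta> \<one>\<^bsub>D\<^esub> \<cdot>\<^bsub>S\<^esub> Eps F = Eps G"
    and "\<theta> \<in> extensional (Ob D)"
  using assms by (simp_all add: monoidal_transformation_def)

locale monoidal_functors = D: symmetric_monoidal_category D + S: symmetric_monoidal_category S +
  F: monoidal_functor D S F + G: monoidal_functor D S G for D and S (structure) and F G
begin

lemma transformationI:
  assumes "\<And>A. A \<in> Ob D \<Longrightarrow> \<theta> A \<in> hom S (FO F A) (FO G A)"
    and "\<And>f. f \<in> Ar D \<Longrightarrow> \<theta> (Cod D f) \<cdot> FA F f = FA G f \<cdot> \<theta> (Dom D f)"
    and "\<And>A B. A \<in> Ob D \<Longrightarrow> B \<in> Ob D \<Longrightarrow> \<theta> (A \<odot>\<^bsub>D\<^esub> B) \<cdot> Mu F A B = Mu G A B \<cdot> (\<theta> A \<otimes> \<theta> B)"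
    and "\<theta> \<one>\<^bsub>D\<^esub> \<cdot> Eps F = Eps G"
  shows "monoidal_transformation D S F G (restrict \<theta> (Ob D))"
  unfolding monoidal_transformation_def
proof (intro conjI allI ballI)
  fix A B f assume "f \<in> hom D A B"
  hence "f \<in> Ar D" "A = Dom D f" "B = Cod D f" by (auto simp: hom_def)
  thus "restrict \<theta> (Ob D) B \<cdot> FA F f = FA G f \<cdot> restrict \<theta> (Ob D) A" using assms(2) by simp
qed (use assms in simp_all)

lemma transformation_Ar:
  assumes "monoidal_transformation D S F G \<theta>" "A \<in> Ob D"
  shows "\<theta> A \<in> Ar S" "Dom S (\<theta> A) = FO F A" "Cod S (\<theta> A) = FO G A"
  using transformationD(1)[OF assms] by (simp_all add: hom_def)

lemma transformation_nat: "monoidal_transformation D S F G \<theta> \<Longrightarrow> f \<in> Ar D \<Longrightarrow>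
    \<theta> (Cod D f) \<cdot> FA F f = FA G f \<cdot> \<theta> (Dom D f)"
  by (rule transformationD(2)) (auto simp: hom_def)

text \<open>Composites back to the starting functor suffice, since they serve to recognise mutually
  inverse transformations.\<close>

lemma comp_transformation:
  assumes \<theta>: "monoidal_transformation D S F G \<theta>" and \<theta>': "monoidal_transformation D S G F \<theta>'"
  shows "monoidal_transformation D S F F (\<lambda>A\<in>Ob D. \<theta>' A \<cdot> \<theta> A)"
proof -
  interpret GF: monoidal_functors D S G F ..
  interpret FF: monoidal_functors D S F F ..
  note t = transformation_Ar[OF \<theta>] GF.transformation_Ar[OF \<theta>']
  show ?thesis
  proof (rule FF.transformationI)
    fix f assume f: "f \<in> Ar D"
    show "\<theta>' (Cod D f) \<cdot> \<theta> (Cod D f) \<cdot> FA F f = FA F f \<cdot> (\<theta>' (Dom D f) \<cdot> \<theta> (Dom D f))"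
      using f transformation_nat[OF \<theta> f] GF.transformation_nat[OF \<theta>' f, THEN S.reassoc] by (simp add: t)
  next
    fix A B assume ob: "A \<in> Ob D" "B \<in> Ob D"
    show "\<theta>' (A \<odot>\<^bsub>D\<^esub> B) \<cdot> \<theta> (A \<odot>\<^bsub>D\<^esub> B) \<cdot> Mu F A B =
        Mu F A B \<cdot> ((\<theta>' A \<cdot> \<theta> A) \<otimes> (\<theta>' B \<cdot> \<theta> B))"
      using ob transformationD(3)[OF \<theta> ob] transformationD(3)[OF \<theta>' ob, THEN S.reassoc]
      by (simp add: t S.interchange)
  next
    show "\<theta>' \<one>\<^bsub>D\<^esub> \<cdot> \<theta> \<one>\<^bsub>D\<^esub> \<cdot> Eps F = Eps F"
      using transformationD(4)[OF \<theta>] transformationD(4)[OF \<theta>'] by (simp add: t)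
  qed (simp add: t hom_def)
qed

end

lemma (in monoidal_functor) id_transformation:
  "monoidal_transformation D S F F (\<lambda>A\<in>Ob D. Id S (FO F A))"
proof -
  interpret FF: monoidal_functors D S F F ..
  show ?thesis by (rule FF.transformationI) (auto simp: S.Id_hom)
qed

lemma rig_map_monoidal_functor:
  "\<lbrakk>is_rig \<A> D; is_rig \<A> S; is_rig_map \<A> D S F\<rbrakk> \<Longrightarrow> monoidal_functor D S F"
  by (simp add: monoidal_functor_def monoidal_functor_axioms_def is_rig_map_def rig_symmetric_monoidal)

text \<open>A full and faithful functor reflects isomorphisms: the inverses on generators extend as
  well, and both round trips agree with identities on generators, hence everywhere.\<close>

lemma (in free_rig) ex_iso_transformation:
  fixes F G :: "('o, 'a, 'p, 'b) monoidal_functor_data"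
  assumes FG: "is_rig_map \<A> D R F" "is_rig_map \<A> D R G"
    and f: "\<And>x. x \<in> X \<Longrightarrow> f x \<in> isos R (FO F (\<eta> x)) (FO G (\<eta> x))"
  obtains \<theta> where "monoidal_transformation D R F G \<theta>" "\<And>x. x \<in> X \<Longrightarrow> \<theta> (\<eta> x) = f x"
    "\<And>A. A \<in> Ob D \<Longrightarrow> \<theta> A \<in> isos R (FO F A) (FO G A)"
proof -
  have D: "is_rig \<A> D" using free by (simp add: is_free_rig_def)
  interpret F: monoidal_functor D R F by (rule rig_map_monoidal_functor[OF D R FG(1)])
  interpret G: monoidal_functor D R G by (rule rig_map_monoidal_functor[OF D R FG(2)])
  interpret FG: monoidal_functors D R F G ..
  interpret GF: monoidal_functors D R G F ..
  have f': "F.S.iso (f x)" "Dom R (f x) = FO F (\<eta> x)" "Cod R (f x) = FO G (\<eta> x)" if "x \<in> X" for x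
    using f[OF that] by (simp_all add: F.S.isos_iff)
  obtain \<theta> where \<theta>: "monoidal_transformation D R F G \<theta>" "\<And>x. x \<in> X \<Longrightarrow> \<theta> (\<eta> x) = f x"
  proof (rule ex_transformation[OF FG])
    show "f x \<in> hom R (FO F (\<eta> x)) (FO G (\<eta> x))" if "x \<in> X" for x using f[OF that] by (simp add: isos_def)
  qed blast
  obtain \<zeta> where \<zeta>: "monoidal_transformation D R G F \<zeta>" "\<And>x. x \<in> X \<Longrightarrow> \<zeta> (\<eta> x) = inv_arrow R (f x)"
  proof (rule ex_transformation[OF FG(2) FG(1)])
    show "inv_arrow R (f x) \<in> hom R (FO G (\<eta> x)) (FO F (\<eta> x))" if "x \<in> X" for x
      using f'[OF that] by (simp add: hom_def)
  qed blast
  note t = FG.transformation_Ar[OF \<theta>(1)] GF.transformation_Ar[OF \<zeta>(1)]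
  have 1: "(\<lambda>A\<in>Ob D. \<zeta> A \<cdot>\<^bsub>R\<^esub> \<theta> A) = (\<lambda>A\<in>Ob D. Id R (FO F A))"
    by (rule transformation_unique[OF FG(1) FG(1) FG.comp_transformation[OF \<theta>(1) \<zeta>(1)] F.id_transformation])
      (simp add: generator_Ob \<theta>(2) \<zeta>(2) f')
  have 2: "(\<lambda>A\<in>Ob D. \<theta> A \<cdot>\<^bsub>R\<^esub> \<zeta> A) = (\<lambda>A\<in>Ob D. Id R (FO G A))"
    by (rule transformation_unique[OF FG(2) FG(2) GF.comp_transformation[OF \<zeta>(1) \<theta>(1)] G.id_transformation])
      (simp add: generator_Ob \<theta>(2) \<zeta>(2) f')
  have "\<theta> A \<in> isos R (FO F A) (FO G A)" if A: "A \<in> Ob D" for A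
    unfolding F.S.isos_iff
  proof (intro conjI)
    show "F.S.iso (\<theta> A)"
      by (rule F.S.isoI[where g = "\<zeta> A"]) (use A fun_cong[OF 1, of A] fun_cong[OF 2, of A] in \<open>simp_all add: t\<close>)
  qed (use A in \<open>simp_all add: t\<close>)
  thus thesis using that \<theta> by blast
qed

locale relative_derivations = D: symmetric_monoidal_category D + S: distributive_category S +
  F: relative_derivation D S F P L K + G: relative_derivation D S G Q M N for D and S (structure) and F P L K G Q M N
begin

lemma dual_pair_monoidal:
  "monoidal_functors D (dual_rig S) (dual_pair D S F P L K) (dual_pair D S G Q M N)"
  by (simp add: monoidal_functors_def monoidal_functor_def monoidal_functor_axioms_def
    D.symmetric_monoidal_category_axioms S.symmetric_monoidal_dual_rig F.strong_dual_pair G.strong_dual_pair)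

text \<open>The two strength squares are the restrictions of the multiplication square to its
  summands. The unit square needs no hypothesis on \<open>\<phi>\<close> beyond its type, because
  its second component starts at an initial object.\<close>

lemma pair_transformation:
  assumes \<theta>: "monoidal_transformation D S F G \<theta>"
    and hom: "\<And>A. A \<in> Ob D \<Longrightarrow> \<phi> A \<in> hom S (FO P A) (FO Q A)"
    and nat: "\<And>f. f \<in> Ar D \<Longrightarrow> \<phi> (Cod D f) \<cdot> FA P f = FA Q f \<cdot> \<phi> (Dom D f)"
    and L: "\<And>A B. A \<in> Ob D \<Longrightarrow> B \<in> Ob D \<Longrightarrow> \<phi> (A \<odot>\<^bsub>D\<^esub> B) \<cdot> L A B = M A B \<cdot> (\<theta> A \<otimes> \<phi> B)"
    and K: "\<And>A B. A \<in> Ob D \<Longrightarrow> B \<in> Ob D \<Longrightarrow> \<phi> (A \<odot>\<^bsub>D\<^esub> B) \<cdot> K A B = N A B \<cdot> (\<phi> A \<otimes> \<theta> B)"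
  shows "monoidal_transformation D (dual_rig S) (dual_pair D S F P L K) (dual_pair D S G Q M N)
    (\<lambda>A\<in>Ob D. (\<theta> A, \<phi> A))"
proof -
  interpret FG: monoidal_functors D S F G ..
  interpret E: monoidal_functors D "dual_rig S" "dual_pair D S F P L K" "dual_pair D S G Q M N"
    by (rule dual_pair_monoidal)
  note t = FG.transformation_Ar[OF \<theta>]
  have p: "\<phi> A \<in> Ar S" "Dom S (\<phi> A) = FO P A" "Cod S (\<phi> A) = FO Q A" if "A \<in> Ob D" for A
    using hom[OF that] by (simp_all add: hom_def)
  show ?thesis
  proof (rule E.transformationI)
    fix A B assume ob: "A \<in> Ob D" "B \<in> Ob D"
    have "\<phi> (A \<odot>\<^bsub>D\<^esub> B) \<cdot> copair S (L A B) (K A B) =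
        copair S (M A B) (N A B) \<cdot> coprod_arrow S (\<theta> A \<otimes> \<phi> B) (\<phi> A \<otimes> \<theta> B)"
      by (rule S.coprod_eq[of _ "FO F A \<odot> FO P B" "FO P A \<odot> FO F B"])
        (use ob in \<open>simp_all add: t p L K\<close>)
    thus "(\<theta> (A \<odot>\<^bsub>D\<^esub> B), \<phi> (A \<odot>\<^bsub>D\<^esub> B)) \<cdot>\<^bsub>dual_rig S\<^esub> Mu (dual_pair D S F P L K) A B =
        Mu (dual_pair D S G Q M N) A B \<cdot>\<^bsub>dual_rig S\<^esub> ((\<theta> A, \<phi> A) \<otimes>\<^bsub>dual_rig S\<^esub> (\<theta> B, \<phi> B))"
      using transformationD(3)[OF \<theta> ob] by simp
  next
    have "\<phi> \<one>\<^bsub>D\<^esub> \<cdot> from_initial S (initial_obj S) (FO P \<one>\<^bsub>D\<^esub>) = from_initial S (initial_obj S) (FO Q \<one>\<^bsub>D\<^esub>)"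
      by (rule S.initial_eq[OF S.initial_obj]) (simp_all add: p)
    thus "(\<theta> \<one>\<^bsub>D\<^esub>, \<phi> \<one>\<^bsub>D\<^esub>) \<cdot>\<^bsub>dual_rig S\<^esub> Eps (dual_pair D S F P L K) = Eps (dual_pair D S G Q M N)"
      using transformationD(4)[OF \<theta>] by simp
  qed (use FG.transformation_nat[OF \<theta>] in \<open>simp_all add: hom_def t p nat\<close>)
qed

text \<open>Converse to \<open>pair_transformation\<close>: restricting the multiplication square
  along the injections gives the strength squares back.\<close>

lemma transformation_components:
  assumes \<Theta>: "monoidal_transformation D (dual_rig S) (dual_pair D S F P L K) (dual_pair D S G Q M N) \<Theta>"
  shows "monoidal_transformation D S F G (\<lambda>A\<in>Ob D. fst (\<Theta> A))"
    and "\<And>A. A \<in> Ob D \<Longrightarrow> snd (\<Theta> A) \<in> hom S (FO P A) (FO Q A)"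
    and "\<And>f. f \<in> Ar D \<Longrightarrow> snd (\<Theta> (Cod D f)) \<cdot> FA P f = FA Q f \<cdot> snd (\<Theta> (Dom D f))"
    and "\<And>A B. A \<in> Ob D \<Longrightarrow> B \<in> Ob D \<Longrightarrow> snd (\<Theta> (A \<odot>\<^bsub>D\<^esub> B)) \<cdot> L A B = M A B \<cdot> (fst (\<Theta> A) \<otimes> snd (\<Theta> B))"
    and "\<And>A B. A \<in> Ob D \<Longrightarrow> B \<in> Ob D \<Longrightarrow> snd (\<Theta> (A \<odot>\<^bsub>D\<^esub> B)) \<cdot> K A B = N A B \<cdot> (snd (\<Theta> A) \<otimes> fst (\<Theta> B))"
proof -
  interpret FG: monoidal_functors D S F G ..
  interpret E: monoidal_functors D "dual_rig S" "dual_pair D S F P L K" "dual_pair D S G Q M N"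
    by (rule dual_pair_monoidal)
  obtain \<theta> \<phi> where tp: "\<And>A. \<Theta> A = (\<theta> A, \<phi> A)"
    by (rule that[of "\<lambda>A. fst (\<Theta> A)" "\<lambda>A. snd (\<Theta> A)"]) simp
  have t: "\<theta> A \<in> Ar S" "Dom S (\<theta> A) = FO F A" "Cod S (\<theta> A) = FO G A"
    "\<phi> A \<in> Ar S" "Dom S (\<phi> A) = FO P A" "Cod S (\<phi> A) = FO Q A" if "A \<in> Ob D" for A
    using E.transformation_Ar[OF \<Theta> that] by (simp_all add: tp)
  have nat: "\<theta> (Cod D f) \<cdot> FA F f = FA G f \<cdot> \<theta> (Dom D f)" "\<phi> (Cod D f) \<cdot> FA P f = FA Q f \<cdot> \<phi> (Dom D f)"
    if "f \<in> Ar D" for f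
    using E.transformation_nat[OF \<Theta> that] by (simp_all add: tp)
  have mu: "\<theta> (A \<odot>\<^bsub>D\<^esub> B) \<cdot> Mu F A B = Mu G A B \<cdot> (\<theta> A \<otimes> \<theta> B)"
    "\<phi> (A \<odot>\<^bsub>D\<^esub> B) \<cdot> copair S (L A B) (K A B) =
      copair S (M A B) (N A B) \<cdot> coprod_arrow S (\<theta> A \<otimes> \<phi> B) (\<phi> A \<otimes> \<theta> B)"
    if "A \<in> Ob D" "B \<in> Ob D" for A B
    using transformationD(3)[OF \<Theta> that] by (simp_all add: tp)
  have eps: "\<theta> \<one>\<^bsub>D\<^esub> \<cdot> Eps F = Eps G" using transformationD(4)[OF \<Theta>] by (simp add: tp)
  show "monoidal_transformation D S F G (\<lambda>A\<in>Ob D. fst (\<Theta> A))"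
    by (rule FG.transformationI) (simp_all add: tp t nat mu eps hom_def)
  show "snd (\<Theta> A) \<in> hom S (FO P A) (FO Q A)" if "A \<in> Ob D" for A using that by (simp add: tp t hom_def)
  show "snd (\<Theta> (Cod D f)) \<cdot> FA P f = FA Q f \<cdot> snd (\<Theta> (Dom D f))" if "f \<in> Ar D" for f
    using nat(2)[OF that] by (simp add: tp)
  show "snd (\<Theta> (A \<odot>\<^bsub>D\<^esub> B)) \<cdot> L A B = M A B \<cdot> (fst (\<Theta> A) \<otimes> snd (\<Theta> B))" if "A \<in> Ob D" "B \<in> Ob D" for A B
    using arg_cong[OF mu(2)[OF that], of "\<lambda>x. x \<cdot> inj1 S (FO F A \<odot> FO P B) (FO P A \<odot> FO F B)"] that
    by (simp add: tp t)
  show "snd (\<Theta> (A \<odot>\<^bsub>D\<^esub> B)) \<cdot> K A B = N A B \<cdot> (snd (\<Theta> A) \<otimes> fst (\<Theta> B))" if "A \<in> Ob D" "B \<in> Ob D" for A B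
    using arg_cong[OF mu(2)[OF that], of "\<lambda>x. x \<cdot> inj2 S (FO F A \<odot> FO P B) (FO P A \<odot> FO F B)"] that
    by (simp add: tp t)
qed

end

section \<open>Morphisms of differential rigs\<close>

locale differential_rigs =
  fixes \<A> :: "('i, 'j) category set"
    and D :: "('o, 'a) monoidal_data" and d :: "('o, 'a) derivation_data"
    and S :: "('p, 'b) monoidal_data" (structure) and d' :: "('p, 'b) derivation_data"
  assumes \<A>: "additive_doctrine \<A>" and D_rig: "is_rig \<A> D" and d: "is_derivation \<A> D d"
    and S_rig: "is_rig \<A> S" and d': "is_derivation \<A> S d'"
begin

sublocale D: distributive_category D by (rule rig_distributive[OF \<A> D_rig])
sublocale S: distributive_category S by (rule rig_distributive[OF \<A> S_rig])
sublocale dD: derivation D d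
  using d by (simp add: D.derivation_iff)
sublocale dS: derivation S d'
  using d' by (simp add: S.derivation_iff)

lemma cocontinuous_d: "cocontinuous \<A> D D d" "cocontinuous \<A> S S d'"
  using d d' by (simp_all add: is_derivation_def)

abbreviation "left_L F \<equiv> \<lambda>A B. FA F (LStr d A B) \<cdot> Mu F A (FO d B)"
abbreviation "left_K F \<equiv> \<lambda>A B. FA F (RStr d A B) \<cdot> Mu F (FO d A) B"
abbreviation "right_L F \<equiv> \<lambda>A B. FA d' (Mu F A B) \<cdot> LStr d' (FO F A) (FO F B)"
abbreviation "right_K F \<equiv> \<lambda>A B. FA d' (Mu F A B) \<cdot> RStr d' (FO F A) (FO F B)"

definition left_pair where
  "left_pair F = dual_pair D S F (comp_functor F d)
    (left_L F) (left_K F)"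

definition right_pair where
  "right_pair F = dual_pair D S F (comp_functor d' F)
    (right_L F) (right_K F)"

lemma pair_FO [simp]: "FO (left_pair F) A = (FO F A, FO F (FO d A))" "FO (right_pair F) A = (FO F A, FO d' (FO F A))"
  by (simp_all add: left_pair_def right_pair_def)

lemma monoidal: "is_rig_map \<A> D S F \<Longrightarrow> monoidal_functor D S F"
  by (rule rig_map_monoidal_functor[OF D_rig S_rig])

lemma functors: "is_rig_map \<A> D S F \<Longrightarrow> differential_functors D d S d' F"
  by (intro differential_functors.intro monoidal D.distributive_category_axioms S.distributive_category_axioms
      dD.derivation_axioms dS.derivation_axioms)

lemma cocontinuous_rig_map: "is_rig_map \<A> D S F \<Longrightarrow> cocontinuous \<A> D S F"
  by (simp add: is_rig_map_def)

lemma plain_cocontinuous: "cocontinuous \<A> D S F \<Longrightarrow> cocontinuous \<A> D S (comp_functor F d)"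
    "cocontinuous \<A> D S F \<Longrightarrow> cocontinuous \<A> D S (comp_functor d' F)"
  using cocontinuous_comp[OF cocontinuous_d(1)] cocontinuous_comp[OF _ cocontinuous_d(2)] by blast+

lemma left_derivation: "is_rig_map \<A> D S F \<Longrightarrow> relative_derivation D S F (comp_functor F d)
    (left_L F) (left_K F)"
  by (rule differential_functors.comp_derivation[OF functors \<A> cocontinuous_rig_map])

lemma right_derivation: "is_rig_map \<A> D S F \<Longrightarrow> relative_derivation D S F (comp_functor d' F)
    (right_L F) (right_K F)"
  by (rule differential_functors.derivation_comp[OF functors])

lemma rig_map_left_pair: "is_rig_map \<A> D S F \<Longrightarrow> is_rig_map \<A> D (dual_rig S) (left_pair F)"
  unfolding left_pair_def
  by (intro relative_derivation.rig_map_dual_pair left_derivation cocontinuous_rig_map plain_cocontinuous)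

lemma rig_map_right_pair: "is_rig_map \<A> D S F \<Longrightarrow> is_rig_map \<A> D (dual_rig S) (right_pair F)"
  unfolding right_pair_def
  by (intro relative_derivation.rig_map_dual_pair right_derivation cocontinuous_rig_map plain_cocontinuous)

lemma relative_derivations:
  "is_rig_map \<A> D S F \<Longrightarrow> is_rig_map \<A> D S G \<Longrightarrow> relative_derivations D S F (comp_functor F d)
    (left_L F) (left_K F)
    G (comp_functor d' G)
    (right_L G) (right_K G)"
  by (intro relative_derivations.intro left_derivation right_derivation D.symmetric_monoidal_category_axioms
      S.distributive_category_axioms)

text \<open>With identities as first components, the strength squares of \<open>\<Theta>\<close>
  become those demanded of a differential map.\<close>

lemma differential_mapI:
  assumes F: "is_rig_map \<A> D S F"
    and \<Theta>: "monoidal_transformation D (dual_rig S) (left_pair F) (right_pair F) \<Theta>"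
    and iso: "\<And>A. A \<in> Ob D \<Longrightarrow> \<Theta> A \<in> isos (dual_rig S) (FO (left_pair F) A) (FO (right_pair F) A)"
    and id: "\<And>A. A \<in> Ob D \<Longrightarrow> fst (\<Theta> A) = Id S (FO F A)"
  shows "is_differential_map \<A> D d S d' F (\<lambda>A. snd (\<Theta> A))"
proof -
  interpret F: monoidal_functor D S F by (rule monoidal[OF F])
  interpret E: relative_derivations D S F "comp_functor F d" "left_L F" "left_K F"
    F "comp_functor d' F" "right_L F" "right_K F"
    by (rule relative_derivations[OF F F])
  note c = E.transformation_components[OF \<Theta>[unfolded left_pair_def right_pair_def]]
  have p: "snd (\<Theta> A) \<in> Ar S" "Dom S (snd (\<Theta> A)) = FO F (FO d A)" "Cod S (snd (\<Theta> A)) = FO d' (FO F A)"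
    if "A \<in> Ob D" for A using c(2)[OF that] by (simp_all add: hom_def)
  have "snd (\<Theta> A) \<in> isos S (FO F (FO d A)) (FO d' (FO F A))" if "A \<in> Ob D" for A
    using iso[OF that] by (cases "\<Theta> A") (simp add: S.isos_dual_rig)
  moreover have "snd (\<Theta> B) \<cdot> FA F (FA d f) = FA d' (FA F f) \<cdot> snd (\<Theta> A)" if "f \<in> hom D A B" for A B f
    using c(3)[of f] that by (auto simp: hom_def)
  moreover have "snd (\<Theta> (A \<odot>\<^bsub>D\<^esub> B)) \<cdot> FA F (LStr d A B) \<cdot> Mu F A (FO d B) =
        FA d' (Mu F A B) \<cdot> LStr d' (FO F A) (FO F B) \<cdot> (Id S (FO F A) \<otimes> snd (\<Theta> B))"
    "snd (\<Theta> (A \<odot>\<^bsub>D\<^esub> B)) \<cdot> FA F (RStr d A B) \<cdot> Mu F (FO d A) B =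
        FA d' (Mu F A B) \<cdot> RStr d' (FO F A) (FO F B) \<cdot> (snd (\<Theta> A) \<otimes> Id S (FO F B))"
    if ob: "A \<in> Ob D" "B \<in> Ob D" for A B
    using c(4)[OF ob] c(5)[OF ob] ob by (simp_all add: p id)
  ultimately show ?thesis using F unfolding is_differential_map_def by blast
qed

lemma differential_mapD:
  assumes F: "is_differential_map \<A> D d S d' F \<phi>"
  shows "is_rig_map \<A> D S F"
    and "A \<in> Ob D \<Longrightarrow> \<phi> A \<in> Ar S" "A \<in> Ob D \<Longrightarrow> Dom S (\<phi> A) = FO F (FO d A)"
      "A \<in> Ob D \<Longrightarrow> Cod S (\<phi> A) = FO d' (FO F A)" "A \<in> Ob D \<Longrightarrow> S.iso (\<phi> A)"
    and "f \<in> Ar D \<Longrightarrow> \<phi> (Cod D f) \<cdot> FA F (FA d f) = FA d' (FA F f) \<cdot> \<phi> (Dom D f)"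
    and "A \<in> Ob D \<Longrightarrow> B \<in> Ob D \<Longrightarrow> \<phi> (A \<odot>\<^bsub>D\<^esub> B) \<cdot> (FA F (LStr d A B) \<cdot> Mu F A (FO d B)) =
        FA d' (Mu F A B) \<cdot> (LStr d' (FO F A) (FO F B) \<cdot> (Id S (FO F A) \<otimes> \<phi> B))"
    and "A \<in> Ob D \<Longrightarrow> B \<in> Ob D \<Longrightarrow> \<phi> (A \<odot>\<^bsub>D\<^esub> B) \<cdot> (FA F (RStr d A B) \<cdot> Mu F (FO d A) B) =
        FA d' (Mu F A B) \<cdot> (RStr d' (FO F A) (FO F B) \<cdot> (\<phi> A \<otimes> Id S (FO F B)))"
proof -
  have i: "\<phi> A \<in> isos S (FO F (FO d A)) (FO d' (FO F A))" if "A \<in> Ob D" for A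
    using F that unfolding is_differential_map_def by blast
  show "is_rig_map \<A> D S F" using F unfolding is_differential_map_def by blast
  show "A \<in> Ob D \<Longrightarrow> \<phi> A \<in> Ar S" "A \<in> Ob D \<Longrightarrow> Dom S (\<phi> A) = FO F (FO d A)"
      "A \<in> Ob D \<Longrightarrow> Cod S (\<phi> A) = FO d' (FO F A)" "A \<in> Ob D \<Longrightarrow> S.iso (\<phi> A)"
    using i[of A] by (simp_all add: S.isos_iff S.iso_Ar)
  show "\<phi> (Cod D f) \<cdot> FA F (FA d f) = FA d' (FA F f) \<cdot> \<phi> (Dom D f)" if "f \<in> Ar D"
  proof -
    have "f \<in> hom D (Dom D f) (Cod D f)" using that by (simp add: hom_def)
    thus ?thesis using F unfolding is_differential_map_def by blast
  qed
  interpret F: monoidal_functor D S F using F by (intro monoidal) (simp add: is_differential_map_def)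
  have p: "\<phi> A \<in> Ar S" "Dom S (\<phi> A) = FO F (FO d A)" "Cod S (\<phi> A) = FO d' (FO F A)" if "A \<in> Ob D" for A
    using i[OF that] by (simp_all add: S.isos_iff S.iso_Ar)
  assume ob: "A \<in> Ob D" "B \<in> Ob D"
  note m = F[unfolded is_differential_map_def, THEN conjunct2, THEN conjunct2, THEN conjunct2]
  show
    "\<phi> (A \<odot>\<^bsub>D\<^esub> B) \<cdot> (FA F (LStr d A B) \<cdot> Mu F A (FO d B)) =
        FA d' (Mu F A B) \<cdot> (LStr d' (FO F A) (FO F B) \<cdot> (Id S (FO F A) \<otimes> \<phi> B))"
    "\<phi> (A \<odot>\<^bsub>D\<^esub> B) \<cdot> (FA F (RStr d A B) \<cdot> Mu F (FO d A) B) =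
        FA d' (Mu F A B) \<cdot> (RStr d' (FO F A) (FO F B) \<cdot> (\<phi> A \<otimes> Id S (FO F B)))"
    using m[THEN conjunct1, rule_format, OF ob] m[THEN conjunct2, rule_format, OF ob] ob by (simp_all add: p)
qed

text \<open>A monoidal transformation \<open>\<theta> : F \<Rightarrow> G\<close> can be composed with the structure maps of \<open>F\<close> and \<open>G\<close> in two
  ways; these are the second components of two transformations into the dual numbers, and
  \<open>\<theta>\<close> is a 2-cell of differential rigs precisely when they agree.\<close>

lemma paste_transformations:
  assumes F: "is_differential_map \<A> D d S d' F \<phi>" and G: "is_differential_map \<A> D d S d' G \<psi>"
    and \<theta>: "monoidal_transformation D S F G \<theta>"
  shows "monoidal_transformation D (dual_rig S) (left_pair F) (right_pair G) (\<lambda>A\<in>Ob D. (\<theta> A, \<psi> A \<cdot> \<theta> (FO d A)))"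
    and "monoidal_transformation D (dual_rig S) (left_pair F) (right_pair G) (\<lambda>A\<in>Ob D. (\<theta> A, FA d' (\<theta> A) \<cdot> \<phi> A))"
proof -
  note Fr = differential_mapD(1)[OF F] and Gr = differential_mapD(1)[OF G]
  interpret F: monoidal_functor D S F by (rule monoidal[OF Fr])
  interpret G: monoidal_functor D S G by (rule monoidal[OF Gr])
  interpret FG: monoidal_functors D S F G ..
  interpret E: relative_derivations D S F "comp_functor F d" "left_L F" "left_K F"
    G "comp_functor d' G" "right_L G" "right_K G"
    by (rule relative_derivations[OF Fr Gr])
  note t = FG.transformation_Ar[OF \<theta>]
  note p = differential_mapD(2-4)[OF F] differential_mapD(2-4)[OF G]
  note tn = FG.transformation_nat[OF \<theta>]
  have tL: "\<theta> (FO d (A \<odot>\<^bsub>D\<^esub> B)) \<cdot> FA F (LStr d A B) = FA G (LStr d A B) \<cdot> \<theta> (A \<odot>\<^bsub>D\<^esub> FO d B)"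
    and tK: "\<theta> (FO d (A \<odot>\<^bsub>D\<^esub> B)) \<cdot> FA F (RStr d A B) = FA G (RStr d A B) \<cdot> \<theta> (FO d A \<odot>\<^bsub>D\<^esub> B)"
    if "A \<in> Ob D" "B \<in> Ob D" for A B
    using tn[of "LStr d A B"] tn[of "RStr d A B"] that by simp_all
  note tm = transformationD(3)[OF \<theta>]
  have dm: "FA d' (\<theta> (A \<odot>\<^bsub>D\<^esub> B)) \<cdot> FA d' (Mu F A B) = FA d' (Mu G A B) \<cdot> FA d' (\<theta> A \<otimes> \<theta> B)"
    if "A \<in> Ob D" "B \<in> Ob D" for A B
    using arg_cong[OF tm[OF that], of "FA d'"] that by (simp add: t)
  note nat = dS.strengths_nat[of "\<theta> A" "\<theta> B" for A B, THEN S.reassoc]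
  show "monoidal_transformation D (dual_rig S) (left_pair F) (right_pair G) (\<lambda>A\<in>Ob D. (\<theta> A, \<psi> A \<cdot> \<theta> (FO d A)))"
    unfolding left_pair_def right_pair_def
  proof (induct rule: E.pair_transformation[OF \<theta>, case_names hom nat L K])
    case (L A B)
    thus ?case using tL[OF L, THEN S.reassoc] tm[of A "FO d B"] differential_mapD(7)[OF G L, THEN S.reassoc3]
      by (simp add: t p S.interchange)
  next
    case (K A B)
    thus ?case using tK[OF K, THEN S.reassoc] tm[of "FO d A" B] differential_mapD(8)[OF G K, THEN S.reassoc3]
      by (simp add: t p S.interchange)
  next
    case (nat f)
    thus ?case using tn[of "FA d f"] differential_mapD(6)[OF G nat, THEN S.reassoc] by (simp add: t p)
  qed (simp add: t p hom_def)
  show "monoidal_transformation D (dual_rig S) (left_pair F) (right_pair G) (\<lambda>A\<in>Ob D. (\<theta> A, FA d' (\<theta> A) \<cdot> \<phi> A))"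
    unfolding left_pair_def right_pair_def
  proof (induct rule: E.pair_transformation[OF \<theta>, case_names hom nat L K])
    case (L A B)
    thus ?case using differential_mapD(7)[OF F L] dm[OF L, THEN S.reassoc] by (simp add: t p S.interchange nat)
  next
    case (K A B)
    thus ?case using differential_mapD(8)[OF F K] dm[OF K, THEN S.reassoc] by (simp add: t p S.interchange nat)
  next
    case (nat f)
    have "FA d' (\<theta> (Cod D f)) \<cdot> FA d' (FA F f) = FA d' (FA G f) \<cdot> FA d' (\<theta> (Dom D f))"
      using arg_cong[OF tn[OF nat], of "FA d'"] nat by (simp add: t)
    from this[THEN S.reassoc]
    show ?case using nat differential_mapD(6)[OF F nat] by (simp add: t p)
  qed (simp add: t p hom_def)
qed

end

section \<open>The free differential rig\<close>

lemma infinite_if_all_cards: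
  assumes "\<And>n. \<exists>A :: 'x set. finite A \<and> card A = n" shows "infinite (UNIV :: 'x set)"
proof
  assume fin: "finite (UNIV :: 'x set)"
  obtain A :: "'x set" where "card A = Suc (card (UNIV :: 'x set))" using assms by blast
  thus False using card_mono[OF fin, of A] by simp
qed

text \<open>A discrete shape with \<open>n\<close> objects uses \<open>n\<close> values of
  \<open>'i\<close>; its identities are \<open>n\<close> distinct values of \<open>'j\<close>, since
  \<open>Dom\<close> recovers the object from its identity.\<close>

lemma doctrine_infinite:
  fixes \<A> :: "('i, 'j) category set"
  assumes \<A>: "additive_doctrine \<A>" shows "infinite (UNIV :: 'i set)" "infinite (UNIV :: 'j set)"
proof -
  have *: "\<exists>J\<in>\<A>. discrete_category J \<and> finite (Ob J) \<and> card (Ob J) = n" for n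
    using \<A> unfolding additive_doctrine_def by blast
  show "infinite (UNIV :: 'i set)" by (rule infinite_if_all_cards) (use * in blast)
  show "infinite (UNIV :: 'j set)"
  proof (rule infinite_if_all_cards)
    fix n obtain J :: "('i, 'j) category" where J: "discrete_category J" "finite (Ob J)" "card (Ob J) = n" using *[of n] by blast
    interpret J: category J using J(1) by (simp add: discrete_category_def)
    have "inj_on (Id J) (Ob J)" by (rule inj_on_inverseI[where g = "Dom J"]) simp
    hence "card (Id J ` Ob J) = n" using J(3) by (simp add: card_image)
    thus "\<exists>A :: 'j set. finite A \<and> card A = n" using J(2) by blast
  qed
qed

text \<open>The cardinal law that an infinite cardinal equals its square, in the form of a
  bijection.\<close>

lemma infinite_bij_pair:
  assumes "infinite (UNIV :: 'x set)" shows "\<exists>p :: 'x \<Rightarrow> 'x \<times> 'x. bij p"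
proof -
  have "(card_of ((UNIV :: 'x set) \<times> (UNIV :: 'x set)), card_of (UNIV :: 'x set)) \<in> ordIso"
    using assms by (rule card_of_Times_same_infinite)
  hence "(card_of (UNIV :: 'x set), card_of (UNIV :: ('x \<times> 'x) set)) \<in> ordIso"
    using ordIso_symmetric by fastforce
  thus ?thesis by (simp add: card_of_ordIso[symmetric])
qed

lemma relative_derivation_cong:
  "\<lbrakk>relative_derivation D S F P L K; FO P = FO Q; FA P = FA Q\<rbrakk> \<Longrightarrow> relative_derivation D S F Q L K"
  by (simp add: relative_derivation_def relative_derivation_axioms_def functor_cong[of P Q])

text \<open>The shapes are typed over the universe \<open>'o\<close>, \<open>'a\<close> of the rigs
  themselves, so \<open>doctrine_infinite\<close> applies to these types and justifies the encodings
  \<open>enc_Ob\<close> and \<open>enc_Ar\<close>.\<close>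

locale free_rig_sequence =
  fixes \<A> :: "('o, 'a) category set" and D :: "('o, 'a) monoidal_data" and Y :: "nat \<Rightarrow> 'o"
  assumes \<A>: "additive_doctrine \<A>" and free: "is_free_rig \<A> D UNIV Y"
begin

lemma D_rig: "is_rig \<A> D" and Y_Ob [simp]: "Y i \<in> Ob D"
  using free by (simp_all add: is_free_rig_def)

definition "enc_Ob = (SOME p :: 'o \<Rightarrow> 'o \<times> 'o. bij p)"
definition "enc_Ar = (SOME q :: 'a \<Rightarrow> 'a \<times> 'a. bij q)"

lemma free_rig_dual: "is_rig \<A> S \<Longrightarrow> free_rig enc_Ob enc_Ar (dual_rig S) \<A> D UNIV Y"
  using someI_ex[OF infinite_bij_pair[OF doctrine_infinite(1)[OF \<A>]]]
    someI_ex[OF infinite_bij_pair[OF doctrine_infinite(2)[OF \<A>]]] free rig_dual_rig[OF \<A>]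
  by (simp add: free_rig_def transport_def free_rig_axioms_def enc_Ob_def enc_Ar_def)

text \<open>Transport along identities makes the results of the locale \<open>free_rig\<close>
  available for maps into \<open>S\<close> itself.\<close>

lemma free_rig_id: "is_rig \<A> S \<Longrightarrow> free_rig id id S \<A> D UNIV Y"
  for S :: "('o, 'a) monoidal_data"
  using free by (simp add: free_rig_def transport_def free_rig_axioms_def)

lemma ex_shift_derivation: "\<exists>d. is_shift_derivation \<A> D Y d"
proof -
  interpret D: distributive_category D by (rule rig_distributive[OF \<A> D_rig])
  interpret T: free_rig enc_Ob enc_Ar "dual_rig D" \<A> D UNIV Y by (rule free_rig_dual[OF D_rig])
  interpret U: free_rig id id D \<A> D UNIV Y by (rule free_rig_id[OF D_rig])
  obtain G :: "('o, 'a, 'o \<times> 'o, 'a \<times> 'a) monoidal_functor_data" where G: "is_rig_map \<A> D (dual_rig D) G"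
    "\<forall>i\<in>UNIV. isomorphic (dual_rig D) (FO G (Y i)) (Y i, Y (Suc i))"
    by (rule T.ex_rig_map[of "\<lambda>i. (Y i, Y (Suc i))"]) auto
  interpret G: dual_functor D D G
    by unfold_locales (use G(1) in \<open>simp add: is_rig_map_def\<close>)
  have "cocontinuous \<A> D D (fst_functor G)" "cocontinuous \<A> D D G.P"
    using G(1) unfolding is_rig_map_def cocontinuous_dual_rig G.P_def by blast+
  hence "cocontinuous \<A> D D G.F" and P: "cocontinuous \<A> D D G.P"
    by (auto elim!: cocontinuous_cong[rotated 2] simp: fun_eq_iff)
  hence F: "is_rig_map \<A> D D G.F" using G.strong_F by (simp add: is_rig_map_def)
  have "\<forall>i. \<exists>u. u \<in> isos (dual_rig D) (FO G (Y i)) (Y i, Y (Suc i))"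
    using G(2) unfolding isomorphic_def by blast
  then obtain u where "\<And>i. u i \<in> isos (dual_rig D) (FO G (Y i)) (Y i, Y (Suc i))" by metis
  hence u: "fst (u i) \<in> isos D (FO G.F (Y i)) (Y i)" "snd (u i) \<in> isos D (FO G.P (Y i)) (Y (Suc i))" for i
    by (cases "u i", metis D.isos_dual_rig G.G_simps(1) fst_conv snd_conv)+
  have id: "is_rig_map \<A> D D (id_monoidal D)"
    using D.strong_id cocontinuous_id by (simp add: is_rig_map_def)
  obtain \<theta> where \<theta>: "monoidal_transformation D D (id_monoidal D) G.F \<theta>"
    "\<And>A. A \<in> Ob D \<Longrightarrow> \<theta> A \<in> isos D (FO (id_monoidal D) A) (FO G.F A)"
    by (rule U.ex_iso_transformation[OF id F, of "\<lambda>i. inv_arrow D (fst (u i))"])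
      (use u(1) in \<open>auto simp: D.isos_iff\<close>)
  interpret R: relative_derivation D D G.F G.P G.L G.K by (rule G.relative_derivation)
  \<comment> \<open>The functor is \<open>G.P\<close> unchanged; its strengths are corrected by
    \<open>\<theta>\<close>, so that \<open>A\<close> itself acts instead of
    \<open>FO G.F A\<close>.\<close>
  define d where "d = \<lparr>FO = FO G.P, FA = FA G.P, LStr = \<lambda>A B. G.L A B \<cdot>\<^bsub>D\<^esub> (\<theta> A \<otimes>\<^bsub>D\<^esub> Id D (FO G.P B)),
    RStr = \<lambda>A B. G.K A B \<cdot>\<^bsub>D\<^esub> (Id D (FO G.P A) \<otimes>\<^bsub>D\<^esub> \<theta> B)\<rparr>"
  have "relative_derivation D D (id_monoidal D) G.P (LStr d) (RStr d)"
    unfolding d_def derivation_data.simps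
    by (rule R.restrict_scalars[OF D.strong_id \<theta>(1)]) (use \<theta>(2) in \<open>simp add: D.isos_iff\<close>)
  hence rel: "relative_derivation D D (id_monoidal D) d (LStr d) (RStr d)"
    by (rule relative_derivation_cong) (simp_all add: d_def)
  have coc: "cocontinuous \<A> D D d" by (rule cocontinuous_cong[OF _ _ P]) (simp_all add: d_def)
  have "is_derivation \<A> D d" using rel coc by (simp add: D.derivation_iff derivation_def)
  moreover have "is_rig_map \<A> D (dual_rig D) (dual_map D d)"
    unfolding dual_map_eq by (rule relative_derivation.rig_map_dual_pair[OF rel cocontinuous_id coc])
  moreover have "isomorphic (dual_rig D) (FO (dual_map D d) (Y i)) (Y i, Y (Suc i))" for i
  proof -
    \<comment> \<open>The first component of \<open>dual_map D d\<close> is exactly the identity, so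
      \<open>Id D (Y i)\<close> takes the place of \<open>fst (u i)\<close>.\<close>
    have "(Id D (Y i), snd (u i)) \<in> isos (dual_rig D) (FO (dual_map D d) (Y i)) (Y i, Y (Suc i))"
      using u(2)[of i] by (simp add: dual_map_def D.isos_dual_rig d_def) (simp add: D.isos_iff)
    thus ?thesis by (auto simp: isomorphic_def)
  qed
  ultimately show ?thesis unfolding is_shift_derivation_def by blast
qed

end

text \<open>Derivatives of generators are prescribed up to isomorphism; \<open>s\<close> fixes one
  such identification for each generator, and all later choices are made relative to it.\<close>

locale shift_derivation_target = free_rig_sequence \<A> D Y + differential_rigs \<A> D d S d'
  for \<A> :: "('o, 'a) category set" and D :: "('o, 'a) monoidal_data" and Y :: "nat \<Rightarrow> 'o" and d
    and S :: "('o, 'a) monoidal_data" (structure) and d' +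
  fixes s :: "nat \<Rightarrow> 'a"
  assumes s: "s i \<in> isos D (FO d (Y i)) (Y (Suc i))"
begin

sublocale T: free_rig enc_Ob enc_Ar "dual_rig S" \<A> D UNIV Y by (rule free_rig_dual[OF S_rig])
sublocale U: free_rig id id S \<A> D UNIV Y by (rule free_rig_id[OF S_rig])

lemma s_iso [simp]: "D.iso (s i)" "Dom D (s i) = FO d (Y i)" "Cod D (s i) = Y (Suc i)"
  using s[of i] by (simp_all add: D.isos_iff)

lemma s_Ar [simp]: "s i \<in> Ar D" by (simp add: D.iso_Ar)

lemma ex_differential_map:
  assumes A: "A \<in> Ob S"
  obtains F :: "('o, 'a, 'o, 'a) monoidal_functor_data" and \<phi> \<alpha>
  where "is_differential_map \<A> D d S d' F \<phi>" "\<alpha> \<in> isos S (FO F (Y 0)) A"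
proof -
  let ?B = "\<lambda>i. (FO d' ^^ i) A"
  have B: "?B i \<in> Ob S" for i by (induction i) (simp_all add: A)
  obtain F :: "('o, 'a, 'o, 'a) monoidal_functor_data" where F: "is_rig_map \<A> D S F"
    "\<forall>i\<in>UNIV. isomorphic S (FO F (Y i)) (?B i)"
    by (rule U.ex_rig_map[of ?B]) (use B in auto)
  interpret F: monoidal_functor D S F by (rule monoidal[OF F(1)])
  have "\<forall>i. \<exists>t. t \<in> isos S (FO F (Y i)) (?B i)" using F(2) by (auto simp: isomorphic_def)
  then obtain t where t: "\<And>i. t i \<in> isos S (FO F (Y i)) (?B i)" by metis
  hence t' [simp]: "S.iso (t i)" "Dom S (t i) = FO F (Y i)" "Cod S (t i) = ?B i" for i
    by (simp_all add: S.isos_iff)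
  have t_Ar [simp]: "t i \<in> Ar S" for i by (simp add: S.iso_Ar)
  \<comment> \<open>The composite from \<open>FO F (FO d (Y i))\<close> by \<open>s i\<close> to
    \<open>FO F (Y (Suc i))\<close>, by \<open>t (Suc i)\<close> to the derivative of
    \<open>?B i\<close>, and back by \<open>t i\<close> to
    \<open>FO d' (FO F (Y i))\<close>.\<close>
  let ?g = "\<lambda>i. inv_arrow S (FA d' (t i)) \<cdot> (t (Suc i) \<cdot> FA F (s i))"
  have g: "(Id S (FO F (Y i)), ?g i) \<in> isos (dual_rig S) (FO (left_pair F) (Y i)) (FO (right_pair F) (Y i))" for i
    by (simp add: S.isos_dual_rig) (simp add: S.isos_iff dS.iso_d)
  obtain \<Theta> where \<Theta>: "monoidal_transformation D (dual_rig S) (left_pair F) (right_pair F) \<Theta>"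
    "\<And>i. i \<in> UNIV \<Longrightarrow> \<Theta> (Y i) = (Id S (FO F (Y i)), ?g i)"
    "\<And>A. A \<in> Ob D \<Longrightarrow> \<Theta> A \<in> isos (dual_rig S) (FO (left_pair F) A) (FO (right_pair F) A)"
    by (rule T.ex_iso_transformation[OF rig_map_left_pair[OF F(1)] rig_map_right_pair[OF F(1)], of "\<lambda>i. (Id S (FO F (Y i)), ?g i)"])
      (use g in blast)+
  \<comment> \<open>\<open>\<Theta>\<close> was prescribed with identities as first components on
    generators only; uniqueness of extensions propagates this to all objects.\<close>
  have "(\<lambda>A\<in>Ob D. fst (\<Theta> A)) = (\<lambda>A\<in>Ob D. Id S (FO F A))"
    by (rule U.transformation_unique[OF F(1) F(1)
        relative_derivations.transformation_components(1)[OF relative_derivations[OF F(1) F(1)] \<Theta>(1)[unfolded left_pair_def right_pair_def]]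
        F.id_transformation]) (simp add: \<Theta>(2))
  hence "fst (\<Theta> A) = Id S (FO F A)" if "A \<in> Ob D" for A
    using that by (metis restrict_apply')
  from differential_mapI[OF F(1) \<Theta>(1,3) this]
  have "is_differential_map \<A> D d S d' F (\<lambda>A. snd (\<Theta> A))" by blast
  moreover have "t 0 \<in> isos S (FO F (Y 0)) A" using t[of 0] by simp
  ultimately show thesis using that by blast
qed

lemma ex1_differential_2cell:
  fixes F G :: "('o, 'a, 'o, 'a) monoidal_functor_data"
  assumes F: "is_differential_map \<A> D d S d' F \<phi>" and \<alpha>: "\<alpha> \<in> isos S (FO F (Y 0)) A"
    and G: "is_differential_map \<A> D d S d' G \<psi>" and \<beta>: "\<beta> \<in> isos S (FO G (Y 0)) A"
  shows "\<exists>!\<theta>. is_differential_2cell D d S d' F \<phi> G \<psi> \<theta> \<and>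
    (\<forall>X\<in>Ob D. \<theta> X \<in> isos S (FO F X) (FO G X)) \<and> \<beta> \<cdot> \<theta> (Y 0) = \<alpha>"
proof -
  note Fr = differential_mapD(1)[OF F] and Gr = differential_mapD(1)[OF G]
  interpret F: monoidal_functor D S F by (rule monoidal[OF Fr])
  interpret G: monoidal_functor D S G by (rule monoidal[OF Gr])
  interpret FG: monoidal_functors D S F G ..
  note p = differential_mapD(2-5)[OF F] differential_mapD(2-5)[OF G]
  have ab: "S.iso \<alpha>" "Dom S \<alpha> = FO F (Y 0)" "Cod S \<alpha> = A" "S.iso \<beta>" "Dom S \<beta> = FO G (Y 0)" "Cod S \<beta> = A"
    using \<alpha> \<beta> by (simp_all add: S.isos_iff)
  \<comment> \<open>Uniqueness dictates the recursion: the 2-cell equation at \<open>Y i\<close>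
    determines the value at \<open>FO d (Y i)\<close> from the value \<open>h\<close> at
    \<open>Y i\<close>, and naturality at \<open>s i\<close> then determines the value at
    \<open>Y (Suc i)\<close>. The start of the recursion is forced by the comparison with
    \<open>\<alpha>\<close> and \<open>\<beta>\<close>.\<close>
  let ?step = "\<lambda>i h. FA G (s i) \<cdot> (inv_arrow S (\<psi> (Y i)) \<cdot> (FA d' h \<cdot> (\<phi> (Y i) \<cdot> inv_arrow S (FA F (s i)))))"
  define h where "h = rec_nat (inv_arrow S \<beta> \<cdot> \<alpha>) ?step"
  have h0: "h 0 = inv_arrow S \<beta> \<cdot> \<alpha>" and hS: "h (Suc i) = ?step i (h i)" for i
    by (simp_all add: h_def)
  have h: "S.iso (h i) \<and> Dom S (h i) = FO F (Y i) \<and> Cod S (h i) = FO G (Y i)" for i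
  proof (induction i)
    case 0 show ?case using ab by (simp add: h0 S.iso_Ar)
  next
    case (Suc i) thus ?case by (simp add: hS S.iso_Ar p dS.iso_d)
  qed
  obtain \<theta> where \<theta>: "monoidal_transformation D S F G \<theta>" "\<And>i. i \<in> UNIV \<Longrightarrow> \<theta> (Y i) = h i"
    "\<And>A. A \<in> Ob D \<Longrightarrow> \<theta> A \<in> isos S (FO F A) (FO G A)"
    by (rule U.ex_iso_transformation[OF Fr Gr, of h]) (use h in \<open>auto simp: S.isos_iff\<close>)
  note t = FG.transformation_Ar[OF \<theta>(1)]
  have gen: "\<theta> (Y (Suc i)) = FA G (s i) \<cdot> (\<theta> (FO d (Y i)) \<cdot> inv_arrow S (FA F (s i)))"
    if \<theta>: "monoidal_transformation D S F G \<theta>" for \<theta> i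
    using FG.transformation_nat[OF \<theta>, of "s i", THEN S.reassoc, of "inv_arrow S (FA F (s i))"]
      FG.transformation_Ar[OF \<theta>] by simp
  have "(\<lambda>A\<in>Ob D. (\<theta> A, \<psi> A \<cdot> \<theta> (FO d A))) = (\<lambda>A\<in>Ob D. (\<theta> A, FA d' (\<theta> A) \<cdot> \<phi> A))"
  proof (rule T.transformation_unique[OF rig_map_left_pair[OF Fr] rig_map_right_pair[OF Gr] paste_transformations[OF F G \<theta>(1)]])
    fix i
    \<comment> \<open>Naturality and the recursion give two expressions for the value at
      \<open>Y (Suc i)\<close>. Cancelling \<open>FA G (s i)\<close> on the left and the inverse of
      \<open>FA F (s i)\<close> on the right leaves the 2-cell equation at
      \<open>Y i\<close>.\<close>
    have "FA G (s i) \<cdot> (\<theta> (FO d (Y i)) \<cdot> inv_arrow S (FA F (s i))) = ?step i (h i)"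
      unfolding gen[OF \<theta>(1), of i, symmetric] hS[of i, symmetric] by (simp add: \<theta>(2))
    hence "\<theta> (FO d (Y i)) \<cdot> inv_arrow S (FA F (s i)) =
        inv_arrow S (\<psi> (Y i)) \<cdot> (FA d' (h i) \<cdot> (\<phi> (Y i) \<cdot> inv_arrow S (FA F (s i))))"
      by (rule S.iso_mono) (use h[of i] in \<open>simp_all add: t p S.iso_Ar\<close>)
    hence "\<theta> (FO d (Y i)) \<cdot> inv_arrow S (FA F (s i)) =
        (inv_arrow S (\<psi> (Y i)) \<cdot> (FA d' (h i) \<cdot> \<phi> (Y i))) \<cdot> inv_arrow S (FA F (s i))"
      using h[of i] by (simp add: p S.iso_Ar)
    hence "\<theta> (FO d (Y i)) = inv_arrow S (\<psi> (Y i)) \<cdot> (FA d' (h i) \<cdot> \<phi> (Y i))"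
      by (rule S.iso_epi) (use h[of i] in \<open>simp_all add: t p S.iso_Ar\<close>)
    thus "(\<lambda>A\<in>Ob D. (\<theta> A, \<psi> A \<cdot> \<theta> (FO d A))) (Y i) = (\<lambda>A\<in>Ob D. (\<theta> A, FA d' (\<theta> A) \<cdot> \<phi> A)) (Y i)"
      using h[of i] by (simp add: \<theta>(2) p S.iso_Ar)
  qed
  note eq = this
  have "\<psi> A \<cdot> \<theta> (FO d A) = FA d' (\<theta> A) \<cdot> \<phi> A" if "A \<in> Ob D" for A
    using fun_cong[OF eq, of A] unfolding restrict_apply'[OF that] prod.inject by (rule conjunct2)
  hence cell: "is_differential_2cell D d S d' F \<phi> G \<psi> \<theta>"
    using \<theta>(1) by (simp add: is_differential_2cell_def)
  have "\<beta> \<cdot> \<theta> (Y 0) = \<alpha>" using ab by (simp add: \<theta>(2) h0 S.iso_Ar)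
  show ?thesis
  proof (rule ex1I[of _ \<theta>])
    show "is_differential_2cell D d S d' F \<phi> G \<psi> \<theta> \<and> (\<forall>X\<in>Ob D. \<theta> X \<in> isos S (FO F X) (FO G X)) \<and> \<beta> \<cdot> \<theta> (Y 0) = \<alpha>"
      using cell \<theta>(3) \<open>\<beta> \<cdot> \<theta> (Y 0) = \<alpha>\<close> by blast
    fix \<zeta> assume \<zeta>: "is_differential_2cell D d S d' F \<phi> G \<psi> \<zeta> \<and> (\<forall>X\<in>Ob D. \<zeta> X \<in> isos S (FO F X) (FO G X)) \<and> \<beta> \<cdot> \<zeta> (Y 0) = \<alpha>"
    hence \<zeta>1: "monoidal_transformation D S F G \<zeta>" by (simp add: is_differential_2cell_def)
    have \<zeta>2: "\<psi> A \<cdot> \<zeta> (FO d A) = FA d' (\<zeta> A) \<cdot> \<phi> A" if "A \<in> Ob D" for A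
      using \<zeta> that by (simp add: is_differential_2cell_def)
    note z = FG.transformation_Ar[OF \<zeta>1]
    \<comment> \<open>A competing 2-cell has the same start and obeys the same recursion, so it
      agrees with \<open>h\<close> on every generator.\<close>
    have "\<zeta> (Y i) = h i" for i
    proof (induction i)
      case 0
      have "inv_arrow S \<beta> \<cdot> (\<beta> \<cdot> \<zeta> (Y 0)) = inv_arrow S \<beta> \<cdot> \<alpha>" using \<zeta> by simp
      thus ?case using ab by (simp add: h0 z S.iso_Ar)
    next
      case (Suc i)
      have "inv_arrow S (\<psi> (Y i)) \<cdot> (\<psi> (Y i) \<cdot> \<zeta> (FO d (Y i))) = inv_arrow S (\<psi> (Y i)) \<cdot> (FA d' (\<zeta> (Y i)) \<cdot> \<phi> (Y i))"
        using \<zeta>2[of "Y i"] by simp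
      hence "\<zeta> (FO d (Y i)) = inv_arrow S (\<psi> (Y i)) \<cdot> (FA d' (\<zeta> (Y i)) \<cdot> \<phi> (Y i))" by (simp add: z p)
      thus ?case using h[of i] by (simp add: gen[OF \<zeta>1] hS Suc p S.iso_Ar)
    qed
    thus "\<zeta> = \<theta>"
      by (intro U.transformation_unique[OF Fr Gr \<zeta>1 \<theta>(1)]) (simp add: \<theta>(2))
  qed
qed

end

theorem theorem5p16:
  fixes \<A> :: "('o, 'a) category set"
    and D :: "('o, 'a) monoidal_data"
    and Y :: "nat \<Rightarrow> 'o"
  assumes "additive_doctrine \<A>"
    and "is_free_rig \<A> D UNIV Y"
  shows "(\<exists>d. is_shift_derivation \<A> D Y d) \<and>
    (\<forall>d. is_shift_derivation \<A> D Y d \<longrightarrow> is_free_differential_rig_on \<A> D d (Y 0))"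
proof (intro conjI allI impI)
  interpret D: free_rig_sequence \<A> D Y using assms by unfold_locales
  show "\<exists>d. is_shift_derivation \<A> D Y d" by (rule D.ex_shift_derivation)
  fix d assume d: "is_shift_derivation \<A> D Y d"
  hence der: "is_derivation \<A> D d" by (simp add: is_shift_derivation_def)
  interpret C: distributive_category D by (rule rig_distributive[OF assms(1) D.D_rig])
  have "\<forall>i. \<exists>u. u \<in> isos (dual_rig D) (Y i, FO d (Y i)) (Y i, Y (Suc i))"
  proof
    fix i
    have "isos (dual_rig D) (FO (dual_map D d) (Y i)) (Y i, Y (Suc i)) \<noteq> {}"
      using d unfolding is_shift_derivation_def isomorphic_def by blast
    thus "\<exists>u. u \<in> isos (dual_rig D) (Y i, FO d (Y i)) (Y i, Y (Suc i))"
      unfolding dual_map_eq dual_pair_simps id_monoidal_simps by blast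
  qed
  then obtain u where "\<And>i. u i \<in> isos (dual_rig D) (Y i, FO d (Y i)) (Y i, Y (Suc i))" by metis
  \<comment> \<open>A shift derivation comes with isomorphisms in the dual numbers; their second
    components are the identifications required by \<open>shift_derivation_target\<close>.\<close>
  hence s: "snd (u i) \<in> isos D (FO d (Y i)) (Y (Suc i))" for i
    by (cases "u i") (metis C.isos_dual_rig snd_conv)
  show "is_free_differential_rig_on \<A> D d (Y 0)"
    unfolding is_free_differential_rig_on_def
  proof (intro conjI allI impI ballI)
    show "is_differential_rig \<A> D d" using der D.D_rig by (simp add: is_differential_rig_def)
    show "Y 0 \<in> Ob D" by simp
    fix S :: "('o, 'a) monoidal_data" and d' :: "('o, 'a) derivation_data" and A
    assume S: "is_differential_rig \<A> S d'" and A: "A \<in> Ob S"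
    interpret T: shift_derivation_target \<A> D Y d S d' "\<lambda>i. snd (u i)"
      by unfold_locales (use assms D.D_rig der S s in \<open>simp_all add: is_differential_rig_def\<close>)
    obtain F :: "('o, 'a, 'o, 'a) monoidal_functor_data" and \<phi> \<alpha>
      where "is_differential_map \<A> D d S d' F \<phi>" "\<alpha> \<in> isos S (FO F (Y 0)) A"
      by (rule T.ex_differential_map[OF A])
    thus "\<exists>(F :: ('o, 'a, 'o, 'a) monoidal_functor_data) \<phi> \<alpha>. is_differential_map \<A> D d S d' F \<phi> \<and> \<alpha> \<in> isos S (FO F (Y 0)) A \<and>
        (\<forall>(G :: ('o, 'a, 'o, 'a) monoidal_functor_data) \<psi> \<beta>. is_differential_map \<A> D d S d' G \<psi> \<and> \<beta> \<in> isos S (FO G (Y 0)) A \<longrightarrow>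
          (\<exists>!\<theta>. is_differential_2cell D d S d' F \<phi> G \<psi> \<theta> \<and> (\<forall>X\<in>Ob D. \<theta> X \<in> isos S (FO F X) (FO G X)) \<and>
            \<beta> \<cdot>\<^bsub>S\<^esub> \<theta> (Y 0) = \<alpha>))"
      using T.ex1_differential_2cell by blast
  qed
qed

end
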